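(* Let $R$ be a valuation ring and let $\widehat{R}$ be the pure-injective hull of the $R$-module $R$. Then $\widehat{R}$ is a faithfully flat $R$-module.
   Context: All rings are commutative with unity and all modules are unital. A valuation ring is a ring whose ideals are linearly ordered by inclusion (zero divisors are allowed). An exact sequence $0\to F\to E\to G\to 0$ is pure if it remains exact when tensored with any $R$-module; then $F$ is a pure submodule of $E$. A module $F$ is pure-injective if $\mathrm{Hom}_R(-,F)$ sends every pure exact sequence to an exact sequence. $B$ is a pure-essential extension of a submodule $A$ if $A$ is a pure submodule of $B$ and, for each submodule $K$ of $B$, either $K\cap A\neq 0$ or $(A+K)/K$ is not a pure submodule of $B/K$ (as usual, for $K\ne 0$). $B$ is a pure-injective hull of $A$ if $B$ is pure-injective and a pure-essential extension of $A$. Each $R$-module has a pure-injective hull, unique up to isomorphism. *)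

theory Defs
  imports "HOL-Algebra.Algebra"
begin

text \<open>
  A formula of HOL cannot quantify over types, so ``all \<open>R\<close>-modules'' has to be read as
  ``all \<open>R\<close>-modules whose carrier is a subset of a given type''.  The notions below that involve
  such a quantification take that type as an explicit argument \<open>TYPE('u)\<close>.
\<close>

definition valuation_ring :: "'a ring \<Rightarrow> bool" where
  "valuation_ring R \<longleftrightarrow>
     cring R \<and> (\<forall>I J. ideal I R \<and> ideal J R \<longrightarrow> I \<subseteq> J \<or> J \<subseteq> I)"

definition regular_module :: "'a ring \<Rightarrow> ('a, 'a) module" where
  "regular_module R =
     \<lparr>carrier = carrier R, monoid.mult = monoid.mult R, one = one R,
      ring.zero = ring.zero R, add = add R, smult = monoid.mult R\<rparr>"

definition mod_hom :: "'a ring \<Rightarrow> ('a, 'm) module \<Rightarrow> ('a, 'n) module \<Rightarrow> ('m \<Rightarrow> 'n) set" where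
  "mod_hom R M N =
     {f \<in> hom (add_monoid M) (add_monoid N).
        \<forall>r \<in> carrier R. \<forall>x \<in> carrier M. f (r \<odot>\<^bsub>M\<^esub> x) = r \<odot>\<^bsub>N\<^esub> f x}"

text \<open>
  The record type of modules extends that of rings; its multiplication and unit play no role
  for modules.  For a coset \<open>V = x + K\<close> the set \<open>K + r V\<close> is the coset \<open>r x + K\<close>.
\<close>

definition quot_module :: "('a, 'm) module \<Rightarrow> 'm set \<Rightarrow> ('a, 'm set) module" where
  "quot_module M K =
     \<lparr>carrier = a_rcosets\<^bsub>M\<^esub> K, monoid.mult = undefined, one = undefined,
      ring.zero = K, add = set_add M,
      smult = (\<lambda>r V. K <+>\<^bsub>M\<^esub> ((\<lambda>x. r \<odot>\<^bsub>M\<^esub> x) ` V))\<rparr>"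

text \<open>
  Exactness only concerns the underlying abelian groups, so it is stated for groups (written
  multiplicatively, as in the library) and applied to \<open>add_monoid M\<close> for a module \<open>M\<close>.
  The library's \<open>exact_seq\<close> and \<open>short_exact_sequence\<close> force all groups of a sequence to have
  the same element type and are therefore not applicable here.
\<close>

definition exact_at ::
  "('x, 'p) monoid_scheme \<Rightarrow> ('y, 'q) monoid_scheme \<Rightarrow> ('z, 'r) monoid_scheme \<Rightarrow> ('x \<Rightarrow> 'y) \<Rightarrow> ('y \<Rightarrow> 'z) \<Rightarrow> bool" where
  "exact_at A B C f g \<longleftrightarrow> f ` carrier A = kernel B C g"

definition short_exact ::
  "('x, 'p) monoid_scheme \<Rightarrow> ('y, 'q) monoid_scheme \<Rightarrow> ('z, 'r) monoid_scheme \<Rightarrow> ('x \<Rightarrow> 'y) \<Rightarrow> ('y \<Rightarrow> 'z) \<Rightarrow> bool" where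
  "short_exact A B C f g \<longleftrightarrow>
     inj_on f (carrier A) \<and> exact_at A B C f g \<and> g ` carrier B = carrier C"

text \<open>
  The underlying abelian group of the tensor product of \<open>M\<close> and \<open>N\<close> over \<open>R\<close>: the free abelian
  group on \<open>M \<times> N\<close> modulo the subgroup generated by the bilinearity and balancing relations.
  Its \<open>R\<close>-module structure is not needed for exactness of tensored sequences.
\<close>

definition tensor_relations ::
  "'a ring \<Rightarrow> ('a, 'm) module \<Rightarrow> ('a, 'n) module \<Rightarrow> ('m \<times> 'n \<Rightarrow>\<^sub>0 int) set" where
  "tensor_relations R M N =
     generate (free_Abelian_group (carrier M \<times> carrier N))
       ({frag_of (x \<oplus>\<^bsub>M\<^esub> x', y) - frag_of (x, y) - frag_of (x', y) | x x' y.
           x \<in> carrier M \<and> x' \<in> carrier M \<and> y \<in> carrier N} \<union>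
        {frag_of (x, y \<oplus>\<^bsub>N\<^esub> y') - frag_of (x, y) - frag_of (x, y') | x y y'.
           x \<in> carrier M \<and> y \<in> carrier N \<and> y' \<in> carrier N} \<union>
        {frag_of (r \<odot>\<^bsub>M\<^esub> x, y) - frag_of (x, r \<odot>\<^bsub>N\<^esub> y) | r x y.
           r \<in> carrier R \<and> x \<in> carrier M \<and> y \<in> carrier N})"

definition tensor_group ::
  "'a ring \<Rightarrow> ('a, 'm) module \<Rightarrow> ('a, 'n) module \<Rightarrow> ('m \<times> 'n \<Rightarrow>\<^sub>0 int) set monoid" where
  "tensor_group R M N =
     free_Abelian_group (carrier M \<times> carrier N) Mod tensor_relations R M N"

text \<open>
  The map \<open>M \<otimes> N \<rightarrow> M \<otimes> N'\<close> induced by \<open>f : N \<rightarrow> N'\<close>.  All representatives \<open>c\<close> of an element \<open>V\<close>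
  of \<open>M \<otimes> N\<close> yield the same coset, so the union is that coset.
\<close>

definition tensor_map ::
  "'a ring \<Rightarrow> ('a, 'm) module \<Rightarrow> ('a, 'n') module \<Rightarrow> ('n \<Rightarrow> 'n') \<Rightarrow>
     ('m \<times> 'n \<Rightarrow>\<^sub>0 int) set \<Rightarrow> ('m \<times> 'n' \<Rightarrow>\<^sub>0 int) set" where
  "tensor_map R M N' f V =
     (\<Union>c\<in>V. tensor_relations R M N' #>\<^bsub>free_Abelian_group (carrier M \<times> carrier N')\<^esub>
              frag_extend (\<lambda>(x, y). frag_of (x, f y)) c)"

definition pure_exact ::
  "'u itself \<Rightarrow> 'a ring \<Rightarrow> ('a, 'x) module \<Rightarrow> ('a, 'y) module \<Rightarrow> ('a, 'z) module \<Rightarrow>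
     ('x \<Rightarrow> 'y) \<Rightarrow> ('y \<Rightarrow> 'z) \<Rightarrow> bool" where
  "pure_exact U R F E G f g \<longleftrightarrow>
     module R F \<and> module R E \<and> module R G \<and> f \<in> mod_hom R F E \<and> g \<in> mod_hom R E G \<and>
     short_exact (add_monoid F) (add_monoid E) (add_monoid G) f g \<and>
     (\<forall>M :: ('a, 'u) module. module R M \<longrightarrow>
        short_exact (tensor_group R M F) (tensor_group R M E) (tensor_group R M G)
          (tensor_map R M E f) (tensor_map R M G g))"

definition pure_submodule ::
  "'u itself \<Rightarrow> 'a ring \<Rightarrow> 'y set \<Rightarrow> ('a, 'y) module \<Rightarrow> bool" where
  "pure_submodule U R F E \<longleftrightarrow>
     submodule F R E \<and>
     pure_exact U R (E\<lparr>carrier := F\<rparr>) E (quot_module E F) (\<lambda>x. x) (\<lambda>x. F +>\<^bsub>E\<^esub> x)"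

definition pure_essential ::
  "'u itself \<Rightarrow> 'a ring \<Rightarrow> 'y set \<Rightarrow> ('a, 'y) module \<Rightarrow> bool" where
  "pure_essential U R A B \<longleftrightarrow>
     module R B \<and> pure_submodule U R A B \<and>
     (\<forall>K. submodule K R B \<and> K \<noteq> {\<zero>\<^bsub>B\<^esub>} \<longrightarrow>
        K \<inter> A \<noteq> {\<zero>\<^bsub>B\<^esub>} \<or>
        \<not> pure_submodule U R ((\<lambda>x. K +>\<^bsub>B\<^esub> x) ` (A <+>\<^bsub>B\<^esub> K)) (quot_module B K))"

text \<open>
  Homomorphisms are taken extensional (\<open>undefined\<close> outside the carrier), so that equality of
  functions is equality on the carrier.
\<close>

definition Hom_group ::
  "'a ring \<Rightarrow> ('a, 'm) module \<Rightarrow> ('a, 'n) module \<Rightarrow> ('m \<Rightarrow> 'n) monoid" where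
  "Hom_group R M N =
     \<lparr>carrier = mod_hom R M N \<inter> extensional (carrier M),
      monoid.mult = (\<lambda>h k. \<lambda>x\<in>carrier M. h x \<oplus>\<^bsub>N\<^esub> k x),
      one = (\<lambda>x\<in>carrier M. \<zero>\<^bsub>N\<^esub>)\<rparr>"

definition pure_injective :: "'u itself \<Rightarrow> 'a ring \<Rightarrow> ('a, 'n) module \<Rightarrow> bool" where
  "pure_injective U R N \<longleftrightarrow>
     module R N \<and>
     (\<forall>(F :: ('a, 'u) module) (E :: ('a, 'u) module) (G :: ('a, 'u) module) f g.
        pure_exact U R F E G f g \<longrightarrow>
        short_exact (Hom_group R G N) (Hom_group R E N) (Hom_group R F N)
          (\<lambda>h. compose (carrier E) h g) (\<lambda>h. compose (carrier F) h f))"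

text \<open>\<open>B\<close> is a pure-injective hull of \<open>A\<close>, where \<open>A\<close> is viewed as a submodule of \<open>B\<close> via \<open>i\<close>.\<close>

definition pure_injective_hull ::
  "'u itself \<Rightarrow> 'a ring \<Rightarrow> ('a, 'm) module \<Rightarrow> ('a, 'n) module \<Rightarrow> ('m \<Rightarrow> 'n) \<Rightarrow> bool" where
  "pure_injective_hull U R A B i \<longleftrightarrow>
     module R A \<and> i \<in> mod_hom R A B \<and> inj_on i (carrier A) \<and>
     pure_injective U R B \<and> pure_essential U R (i ` carrier A) B"

definition faithfully_flat :: "'v itself \<Rightarrow> 'a ring \<Rightarrow> ('a, 'm) module \<Rightarrow> bool" where
  "faithfully_flat V R M \<longleftrightarrow>
     module R M \<and>
     (\<forall>(A :: ('a, 'v) module) (B :: ('a, 'v) module) (C :: ('a, 'v) module) f g.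
        module R A \<and> module R B \<and> module R C \<and> f \<in> mod_hom R A B \<and> g \<in> mod_hom R B C \<longrightarrow>
        (exact_at (add_monoid A) (add_monoid B) (add_monoid C) f g \<longleftrightarrow>
         exact_at (tensor_group R M A) (tensor_group R M B) (tensor_group R M C)
           (tensor_map R M B f) (tensor_map R M C g)))"

text \<open>
  A type \<open>'u\<close> serves as a universe of test modules for an \<open>R\<close>-module \<open>B\<close>, with \<open>R\<close> carried by
  \<open>'a\<close> and \<open>B\<close> by \<open>'b\<close>, as soon as it is at least as large as the type below.  Then, up to
  isomorphism, the modules carried by \<open>'u\<close> include

  \<^item> all finitely presented \<open>R\<close>-modules.  Every module is a direct limit of such modules and tensor
    products commute with direct limits, so purity tested on \<open>'u\<close> is purity tested on modules of
    arbitrary size.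

  \<^item> the pure-injective character bidual \<open>B\<^sup>*\<^sup>*\<close> (characters being homomorphisms of abelian groups
    into the rationals modulo the integers), together with \<open>B\<close> and \<open>B\<^sup>*\<^sup>*/B\<close>.  Since \<open>B\<close> is pure in
    \<open>B\<^sup>*\<^sup>*\<close>, testing pure-injectivity of \<open>B\<close> on \<open>'u\<close> already makes \<open>B\<close> a direct summand of \<open>B\<^sup>*\<^sup>*\<close>,
    so it is pure-injectivity tested on modules of arbitrary size.
\<close>

type_synonym ('a, 'b) test_universe = "(nat + 'a + 'b) set set"

end

theory Submission
  imports Defs
begin

text \<open>
  Let \<open>u\<close> be the image of \<open>1\<close> in \<open>M = Rhat\<close>, so that the ring is identified with \<open>R u\<close>.  The argument
  rests on the comparability of principal ideals, which makes linear algebra over \<open>R\<close> possible: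
  a finite set of coefficients contains one that divides all others,
  and that one can be used as a pivot.

  Flatness is reduced to single elements (\<open>torsion_flat_exact\<close>): it suffices that each \<open>m \<in> M\<close> has
  the form \<open>m = x p\<close> with \<open>x \<in> R\<close> killed by the annihilator of \<open>m\<close>.  Indeed, eliminating one equation
  after the other then shows that finitely many relations in \<open>M\<close> come from a finitely generated free
  module.  Faithfulness is due to the purity of \<open>R u\<close>, which makes \<open>u \<otimes> _\<close> injective
  (\<open>pure_generator_tensor_injective\<close>).

  By elimination again, purity over \<open>R\<close> is the same as relative divisibility \<open>S \<inter> t M = t S\<close>
  (\<open>rd_pure_pure_submodule\<close>, \<open>pure_submodule_rd_pure\<close>).  Applied to \<open>K = R m\<close>, pure-essentialness
  therefore yields, for each \<open>m \<noteq> 0\<close>, an equation \<open>t y = r u + s m\<close> in which \<open>t\<close> does not divide \<open>r\<close>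
  (\<open>pure_essential_nonzero_element\<close>).  Relative divisibility provides an \<open>x \<in> R\<close> that is killed by
  the annihilator of \<open>m\<close> and imitates \<open>m\<close> in this equation, and a suitable \<open>m - x p\<close> is killed by
  \<open>s\<close> while \<open>s x \<noteq> 0\<close> (\<open>descends_step\<close>).  Thus \<open>m\<close> can be changed by a multiple of an admissible
  scalar so that its annihilator grows.  Such steps compose, and pure-injectivity provides limits of
  chains of steps (\<open>pure_injective_filter_limit\<close>, \<open>descends_chain_bound\<close>).  By Zorn's lemma every \<open>m\<close>
  descends to an element from which no step is possible, namely \<open>0\<close>; the composite of the steps from
  \<open>m\<close> to \<open>0\<close> is the desired factorisation.
\<close>

section \<open>Elements of tensor products\<close>

abbreviation formal_sum ::
  "('a, 'm) module \<Rightarrow> ('a, 'n) module \<Rightarrow> ('m \<times> 'n \<Rightarrow>\<^sub>0 int) \<Rightarrow> bool" where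
  "formal_sum M N c \<equiv> Poly_Mapping.keys c \<subseteq> carrier M \<times> carrier N"

definition tensor_class ::
  "'a ring \<Rightarrow> ('a, 'm) module \<Rightarrow> ('a, 'n) module \<Rightarrow> ('m \<times> 'n \<Rightarrow>\<^sub>0 int) \<Rightarrow> ('m \<times> 'n \<Rightarrow>\<^sub>0 int) set" where
  "tensor_class R M N c =
     tensor_relations R M N #>\<^bsub>free_Abelian_group (carrier M \<times> carrier N)\<^esub> c"

text \<open>
  The map on formal sums that induces \<^const>\<open>tensor_map\<close>.  Arguments about tensor products are
  carried out with formal sums modulo \<^const>\<open>tensor_relations\<close>, so that no coset has to be handled.
\<close>

definition push :: "('n \<Rightarrow> 'n') \<Rightarrow> ('m \<times> 'n \<Rightarrow>\<^sub>0 int) \<Rightarrow> ('m \<times> 'n' \<Rightarrow>\<^sub>0 int)" where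
  "push f = frag_extend (\<lambda>(x, y). frag_of (x, f y))"

lemma push_simps [simp]:
  "push f 0 = 0" "push f (frag_of (x, y)) = frag_of (x, f y)"
  "push f (c - d) = push f c - push f d" "push f (c + d) = push f c + push f d"
  "push f (- c) = - push f c"
  by (simp_all add: push_def frag_extend_diff frag_extend_add frag_extend_minus)

lemma keys_push:
  assumes "Poly_Mapping.keys c \<subseteq> A \<times> B" "\<And>y. y \<in> B \<Longrightarrow> f y \<in> B'"
  shows "Poly_Mapping.keys (push f c) \<subseteq> A \<times> B'"
proof -
  have "Poly_Mapping.keys (push f c) \<subseteq>
      (\<Union>z \<in> Poly_Mapping.keys c. Poly_Mapping.keys ((\<lambda>(x, y). frag_of (x, f y)) z))"
    unfolding push_def by (rule keys_frag_extend)
  also have "\<dots> \<subseteq> A \<times> B'" using assms by auto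
  finally show ?thesis .
qed

lemma push_push: "push g (push f c) = push (\<lambda>y. g (f y)) c"
  by (rule frag_induction[of c UNIV]) auto

lemma push_ident:
  assumes "\<And>x y. (x, y) \<in> Poly_Mapping.keys c \<Longrightarrow> f y = y"
  shows "push f c = c"
proof -
  have "push f c = frag_extend frag_of c"
    unfolding push_def using assms by (intro frag_extend_eq) auto
  then show ?thesis using frag_expansion[of c] by simp
qed

lemma keys_diff_subset:
  fixes c d :: "'x \<Rightarrow>\<^sub>0 int"
  assumes "Poly_Mapping.keys c \<subseteq> S" "Poly_Mapping.keys d \<subseteq> S"
  shows "Poly_Mapping.keys (c - d) \<subseteq> S"
  using keys_diff[of c d] assms by blast

lemma keys_add_subset:
  fixes c d :: "'x \<Rightarrow>\<^sub>0 int"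
  assumes "Poly_Mapping.keys c \<subseteq> S" "Poly_Mapping.keys d \<subseteq> S"
  shows "Poly_Mapping.keys (c + d) \<subseteq> S"
  using keys_add[of c d] assms by blast

locale module_pair = M: module R M + N: module R N
  for R :: "'a ring" and M :: "('a, 'm) module" and N :: "('a, 'n) module"
begin

lemma relations_subgroup:
  "subgroup (tensor_relations R M N) (free_Abelian_group (carrier M \<times> carrier N))"
  unfolding tensor_relations_def
  by (rule group.generate_is_subgroup[OF group_free_Abelian_group])
    (auto dest!: subsetD[OF keys_diff])

lemma relations_keys:
  "c \<in> tensor_relations R M N \<Longrightarrow> formal_sum M N c"
  using subsetD[OF subgroup.subset[OF relations_subgroup]] by simp

lemma relations_zero: "0 \<in> tensor_relations R M N"
  using subgroup.one_closed[OF relations_subgroup] by simp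

lemma relations_add:
  "c \<in> tensor_relations R M N \<Longrightarrow> d \<in> tensor_relations R M N \<Longrightarrow> c + d \<in> tensor_relations R M N"
  using subgroup.m_closed[OF relations_subgroup] by simp

lemma relations_minus: "c \<in> tensor_relations R M N \<Longrightarrow> - c \<in> tensor_relations R M N"
  using subgroup.m_inv_closed[OF relations_subgroup] relations_keys by fastforce

lemma relations_diff:
  "c \<in> tensor_relations R M N \<Longrightarrow> d \<in> tensor_relations R M N \<Longrightarrow> c - d \<in> tensor_relations R M N"
  using relations_add[OF _ relations_minus] by fastforce

lemma relations_trans:
  "c - d \<in> tensor_relations R M N \<Longrightarrow> d - e \<in> tensor_relations R M N \<Longrightarrow>
    c - e \<in> tensor_relations R M N"
  using relations_add by fastforce

lemma relation_add_left:
  "x \<in> carrier M \<Longrightarrow> x' \<in> carrier M \<Longrightarrow> y \<in> carrier N \<Longrightarrow>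
    frag_of (x \<oplus>\<^bsub>M\<^esub> x', y) - frag_of (x, y) - frag_of (x', y) \<in> tensor_relations R M N"
  unfolding tensor_relations_def by (rule generate.incl) blast

lemma relation_add_right:
  "x \<in> carrier M \<Longrightarrow> y \<in> carrier N \<Longrightarrow> y' \<in> carrier N \<Longrightarrow>
    frag_of (x, y \<oplus>\<^bsub>N\<^esub> y') - frag_of (x, y) - frag_of (x, y') \<in> tensor_relations R M N"
  unfolding tensor_relations_def by (rule generate.incl) blast

lemma relation_smult:
  "r \<in> carrier R \<Longrightarrow> x \<in> carrier M \<Longrightarrow> y \<in> carrier N \<Longrightarrow>
    frag_of (r \<odot>\<^bsub>M\<^esub> x, y) - frag_of (x, r \<odot>\<^bsub>N\<^esub> y) \<in> tensor_relations R M N"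
  unfolding tensor_relations_def by (rule generate.incl) blast

lemma relation_zero_left:
  assumes "y \<in> carrier N"
  shows "frag_of (\<zero>\<^bsub>M\<^esub>, y) \<in> tensor_relations R M N"
  using relations_minus[OF relation_add_left[of "\<zero>\<^bsub>M\<^esub>" "\<zero>\<^bsub>M\<^esub>" y]] assms by simp

lemma relation_zero_right:
  assumes "x \<in> carrier M"
  shows "frag_of (x, \<zero>\<^bsub>N\<^esub>) \<in> tensor_relations R M N"
  using relations_minus[OF relation_add_right[of x "\<zero>\<^bsub>N\<^esub>" "\<zero>\<^bsub>N\<^esub>"]] assms by simp

lemma push_null:
  assumes "Poly_Mapping.keys d \<subseteq> carrier M \<times> A" "\<And>y. y \<in> A \<Longrightarrow> h y = \<zero>\<^bsub>N\<^esub>"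
  shows "push h d \<in> tensor_relations R M N"
  using assms(1)
proof (induction rule: free_Abelian_group_induct[consumes 1, case_names zero diff generator])
  case zero
  then show ?case by (simp add: relations_zero)
next
  case (diff c d)
  then show ?case by (simp add: relations_diff)
next
  case (generator a)
  then show ?case using assms(2) by (cases a) (auto simp: relation_zero_right)
qed

lemma relations_induct [consumes 1, case_names zero diff add_left add_right smult]:
  assumes c: "c \<in> tensor_relations R M N"
    and zero: "P 0"
    and diff: "\<And>c d. \<lbrakk>c \<in> tensor_relations R M N; d \<in> tensor_relations R M N; P c; P d\<rbrakk> \<Longrightarrow> P (c - d)"
    and add_left: "\<And>x x' y. \<lbrakk>x \<in> carrier M; x' \<in> carrier M; y \<in> carrier N\<rbrakk> \<Longrightarrow>
      P (frag_of (x \<oplus>\<^bsub>M\<^esub> x', y) - frag_of (x, y) - frag_of (x', y))"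
    and add_right: "\<And>x y y'. \<lbrakk>x \<in> carrier M; y \<in> carrier N; y' \<in> carrier N\<rbrakk> \<Longrightarrow>
      P (frag_of (x, y \<oplus>\<^bsub>N\<^esub> y') - frag_of (x, y) - frag_of (x, y'))"
    and smult: "\<And>r x y. \<lbrakk>r \<in> carrier R; x \<in> carrier M; y \<in> carrier N\<rbrakk> \<Longrightarrow>
      P (frag_of (r \<odot>\<^bsub>M\<^esub> x, y) - frag_of (x, r \<odot>\<^bsub>N\<^esub> y))"
  shows "P c"
  using c unfolding tensor_relations_def
proof (induction rule: generate.induct)
  case one
  show ?case using zero by simp
next
  case (incl h)
  then show ?case
    by (elim UnE CollectE exE conjE) (simp_all only: add_left add_right smult)
next
  case (inv h)
  have h: "h \<in> tensor_relations R M N"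
    unfolding tensor_relations_def using inv by (rule generate.incl)
  have "P h"
    using inv by (elim UnE CollectE exE conjE) (simp_all only: add_left add_right smult)
  then have "P (0 - h)" by (intro diff relations_zero h zero)
  then show ?case using relations_keys[OF h] by simp
next
  case (eng a b)
  have a: "a \<in> tensor_relations R M N" and b: "b \<in> tensor_relations R M N"
    unfolding tensor_relations_def using eng by blast+
  have "P (a - (0 - b))" by (intro diff relations_diff relations_zero a b zero eng)
  then show ?case by simp
qed

lemma carrier_tensor_group:
  "carrier (tensor_group R M N) =
     tensor_class R M N ` {c. formal_sum M N c}"
  by (auto simp: tensor_group_def FactGroup_def RCOSETS_def tensor_class_def)

lemma tensor_class_eq_iff:
  assumes "formal_sum M N c" "formal_sum M N d"
  shows "tensor_class R M N c = tensor_class R M N d \<longleftrightarrow> c - d \<in> tensor_relations R M N"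
proof
  assume "tensor_class R M N c = tensor_class R M N d"
  moreover have "c \<in> tensor_class R M N c"
    using relations_zero by (auto simp: tensor_class_def r_coset_def)
  ultimately have "c \<in> tensor_class R M N d" by simp
  then show "c - d \<in> tensor_relations R M N"
    by (auto simp: tensor_class_def r_coset_def)
next
  assume *: "c - d \<in> tensor_relations R M N"
  have "h + c \<in> tensor_class R M N d" if "h \<in> tensor_relations R M N" for h
    using relations_add[OF that *] by (force simp: tensor_class_def r_coset_def)
  moreover have "h + d \<in> tensor_class R M N c" if "h \<in> tensor_relations R M N" for h
    using relations_diff[OF that *] by (force simp: tensor_class_def r_coset_def)
  ultimately show "tensor_class R M N c = tensor_class R M N d"
    by (auto simp: tensor_class_def r_coset_def)
qed

lemma one_tensor_group: "\<one>\<^bsub>tensor_group R M N\<^esub> = tensor_class R M N 0"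
  by (auto simp: tensor_group_def FactGroup_def tensor_class_def r_coset_def)

end

lemma mod_homD:
  assumes "f \<in> mod_hom R M N"
  shows "x \<in> carrier M \<Longrightarrow> f x \<in> carrier N"
    and "x \<in> carrier M \<Longrightarrow> y \<in> carrier M \<Longrightarrow> f (x \<oplus>\<^bsub>M\<^esub> y) = f x \<oplus>\<^bsub>N\<^esub> f y"
    and "r \<in> carrier R \<Longrightarrow> x \<in> carrier M \<Longrightarrow> f (r \<odot>\<^bsub>M\<^esub> x) = r \<odot>\<^bsub>N\<^esub> f x"
  using assms by (auto simp: mod_hom_def hom_def)

lemma mod_homI:
  assumes "\<And>x. x \<in> carrier M \<Longrightarrow> f x \<in> carrier N"
    and "\<And>x y. x \<in> carrier M \<Longrightarrow> y \<in> carrier M \<Longrightarrow> f (x \<oplus>\<^bsub>M\<^esub> y) = f x \<oplus>\<^bsub>N\<^esub> f y"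
    and "\<And>r x. r \<in> carrier R \<Longrightarrow> x \<in> carrier M \<Longrightarrow> f (r \<odot>\<^bsub>M\<^esub> x) = r \<odot>\<^bsub>N\<^esub> f x"
  shows "f \<in> mod_hom R M N"
  using assms by (auto simp: mod_hom_def hom_def)

lemma mod_hom_zero:
  assumes "module R M" "module R N" "f \<in> mod_hom R M N"
  shows "f \<zero>\<^bsub>M\<^esub> = \<zero>\<^bsub>N\<^esub>"
proof -
  interpret M: module R M by fact
  interpret N: module R N by fact
  have "f \<zero>\<^bsub>M\<^esub> = f (\<zero>\<^bsub>R\<^esub> \<odot>\<^bsub>M\<^esub> \<zero>\<^bsub>M\<^esub>)" by simp
  also have "\<dots> = \<zero>\<^bsub>R\<^esub> \<odot>\<^bsub>N\<^esub> f \<zero>\<^bsub>M\<^esub>" by (rule mod_homD(3)[OF assms(3)]) simp_all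
  also have "\<dots> = \<zero>\<^bsub>N\<^esub>" using mod_homD(1)[OF assms(3)] by simp
  finally show ?thesis .
qed

lemma mod_hom_minus:
  assumes "module R M" "module R N" "f \<in> mod_hom R M N" "x \<in> carrier M"
  shows "f (\<ominus>\<^bsub>M\<^esub> x) = \<ominus>\<^bsub>N\<^esub> f x"
proof -
  interpret M: module R M by fact
  interpret N: module R N by fact
  have "f (\<ominus>\<^bsub>M\<^esub> x) \<oplus>\<^bsub>N\<^esub> f x = f (\<ominus>\<^bsub>M\<^esub> x \<oplus>\<^bsub>M\<^esub> x)"
    using mod_homD(2)[OF assms(3)] assms(4) by simp
  also have "\<dots> = \<zero>\<^bsub>N\<^esub>" using assms(4) mod_hom_zero[OF assms(1-3)] by (simp add: M.M.l_neg)
  finally show ?thesis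
    using mod_homD(1)[OF assms(3)] assms(4) by (simp add: N.M.minus_equality)
qed

lemma push_relations:
  assumes "module R M" "module R N" "module R N'" "f \<in> mod_hom R N N'"
    and "c \<in> tensor_relations R M N"
  shows "push f c \<in> tensor_relations R M N'"
proof -
  interpret MN: module_pair R M N using assms by (simp add: module_pair_def)
  interpret MN': module_pair R M N' using assms by (simp add: module_pair_def)
  note f = mod_homD[OF assms(4)]
  from assms(5) show ?thesis
    by (induction rule: MN.relations_induct)
      (simp_all add: f MN'.relations_zero MN'.relations_diff MN'.relation_add_left
        MN'.relation_add_right MN'.relation_smult)
qed

lemma tensor_map_class:
  assumes "module R M" "module R N" "module R N'" "f \<in> mod_hom R N N'"
    and c: "formal_sum M N c"
  shows "tensor_map R M N' f (tensor_class R M N c) = tensor_class R M N' (push f c)"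
proof -
  interpret MN: module_pair R M N using assms by (simp add: module_pair_def)
  interpret MN': module_pair R M N' using assms by (simp add: module_pair_def)
  have "tensor_class R M N' (push f d) = tensor_class R M N' (push f c)"
    if "d \<in> tensor_class R M N c" for d
  proof -
    have d: "d - c \<in> tensor_relations R M N"
      using that by (auto simp: tensor_class_def r_coset_def)
    have "formal_sum M N (d - c + c)"
      by (rule keys_add_subset[OF MN.relations_keys[OF d] c])
    then have dk: "formal_sum M N d" by simp
    have "push f d - push f c \<in> tensor_relations R M N'"
      using push_relations[OF assms(1-4) d] by simp
    then show ?thesis
      by (subst MN'.tensor_class_eq_iff)
        (auto intro!: keys_push[OF dk] keys_push[OF c] mod_homD(1)[OF assms(4)])
  qed
  moreover have "c \<in> tensor_class R M N c"
    using MN.relations_zero by (auto simp: tensor_class_def r_coset_def)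
  ultimately show ?thesis
    unfolding tensor_map_def push_def[symmetric] tensor_class_def[symmetric] by blast
qed

lemma exact_at_tensor_iff:
  assumes mods: "module R M" "module R A" "module R B" "module R C"
    and f: "f \<in> mod_hom R A B" and g: "g \<in> mod_hom R B C"
  shows "exact_at (tensor_group R M A) (tensor_group R M B) (tensor_group R M C)
      (tensor_map R M B f) (tensor_map R M C g) \<longleftrightarrow>
    (\<forall>c. formal_sum M B c \<longrightarrow>
      (push g c \<in> tensor_relations R M C \<longleftrightarrow>
       (\<exists>d. formal_sum M A d \<and> c - push f d \<in> tensor_relations R M B)))"
    (is "?L \<longleftrightarrow> ?R")
proof -
  interpret MA: module_pair R M A using mods by (simp add: module_pair_def)
  interpret MB: module_pair R M B using mods by (simp add: module_pair_def)
  interpret MC: module_pair R M C using mods by (simp add: module_pair_def)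
  let ?FA = "{c. formal_sum M A c}"
  let ?FB = "{c. formal_sum M B c}"
  have pf: "push f d \<in> ?FB" if "d \<in> ?FA" for d :: "'b \<times> 'c \<Rightarrow>\<^sub>0 int"
    using that keys_push[of d "carrier M" "carrier A" f "carrier B"] mod_homD(1)[OF f] by auto
  have pg: "formal_sum M C (push g d)" if "d \<in> ?FB" for d :: "'b \<times> 'd \<Rightarrow>\<^sub>0 int"
    using that keys_push[of d "carrier M" "carrier B" g "carrier C"] mod_homD(1)[OF g] by auto
  have im: "tensor_map R M B f ` carrier (tensor_group R M A) =
      (\<lambda>d. tensor_class R M B (push f d)) ` ?FA"
    unfolding MA.carrier_tensor_group image_image
    by (rule image_cong) (simp_all add: tensor_map_class[OF mods(1-3) f])
  have "kernel (tensor_group R M B) (tensor_group R M C) (tensor_map R M C g) =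
      {v \<in> tensor_class R M B ` ?FB. tensor_map R M C g v = tensor_class R M C 0}"
    unfolding kernel_def MB.carrier_tensor_group MC.one_tensor_group ..
  also have "\<dots> = tensor_class R M B ` {c \<in> ?FB. tensor_map R M C g (tensor_class R M B c) = tensor_class R M C 0}"
    by blast
  also have "{c \<in> ?FB. tensor_map R M C g (tensor_class R M B c) = tensor_class R M C 0} =
      {c \<in> ?FB. push g c \<in> tensor_relations R M C}"
    using MC.tensor_class_eq_iff[OF pg, of _ 0]
    by (intro Collect_cong conj_cong refl) (simp add: tensor_map_class[OF mods(1,3,4) g])
  finally have ker: "kernel (tensor_group R M B) (tensor_group R M C) (tensor_map R M C g) =
      tensor_class R M B ` {c \<in> ?FB. push g c \<in> tensor_relations R M C}" .
  have L: "?L \<longleftrightarrow> (\<lambda>d. tensor_class R M B (push f d)) ` ?FA =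
      tensor_class R M B ` {c \<in> ?FB. push g c \<in> tensor_relations R M C}"
    unfolding exact_at_def im ker ..
  have sat: "push g c \<in> tensor_relations R M C"
    if "push g c' \<in> tensor_relations R M C" "c - c' \<in> tensor_relations R M B" for c c'
    using MC.relations_add[OF that(1) push_relations[OF mods(1,3,4) g that(2)]] by simp
  show ?thesis
  proof
    assume ?L
    then have eq: "(\<lambda>d. tensor_class R M B (push f d)) ` ?FA =
      tensor_class R M B ` {c \<in> ?FB. push g c \<in> tensor_relations R M C}" using L by simp
    show ?R
    proof (intro allI impI iffI)
      fix c :: "'b \<times> 'd \<Rightarrow>\<^sub>0 int"
      assume c: "formal_sum M B c"
        and "push g c \<in> tensor_relations R M C"
      then have "tensor_class R M B c \<in> (\<lambda>d. tensor_class R M B (push f d)) ` ?FA"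
        unfolding eq by blast
      then obtain d where "d \<in> ?FA" "tensor_class R M B c = tensor_class R M B (push f d)" by blast
      then show "\<exists>d. formal_sum M A d \<and>
          c - push f d \<in> tensor_relations R M B"
        using MB.tensor_class_eq_iff[OF c, of "push f d"] pf by blast
    next
      fix c :: "'b \<times> 'd \<Rightarrow>\<^sub>0 int"
      assume c: "formal_sum M B c"
        and "\<exists>d. formal_sum M A d \<and>
          c - push f d \<in> tensor_relations R M B"
      then obtain d where d: "d \<in> ?FA" "c - push f d \<in> tensor_relations R M B" by blast
      have "tensor_class R M B (push f d) \<in>
          tensor_class R M B ` {c \<in> ?FB. push g c \<in> tensor_relations R M C}"
        unfolding eq[symmetric] using d by blast
      then obtain c' where c': "c' \<in> ?FB" "push g c' \<in> tensor_relations R M C"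
        "tensor_class R M B (push f d) = tensor_class R M B c'" by blast
      then have "push f d - c' \<in> tensor_relations R M B"
        using MB.tensor_class_eq_iff[of "push f d" c'] pf[OF d(1)] by blast
      then have "c - c' \<in> tensor_relations R M B"
        using MB.relations_trans[OF d(2)] by blast
      then show "push g c \<in> tensor_relations R M C" using sat c'(2) by blast
    qed
  next
    assume R: ?R
    show ?L unfolding L
    proof (intro subset_antisym subsetI)
      fix v assume "v \<in> (\<lambda>d. tensor_class R M B (push f d)) ` ?FA"
      then obtain d where d: "d \<in> ?FA" "v = tensor_class R M B (push f d)" by blast
      have "push g (push f d) \<in> tensor_relations R M C"
        using R pf[OF d(1)] d(1) MB.relations_zero by auto
      then show "v \<in> tensor_class R M B ` {c \<in> ?FB. push g c \<in> tensor_relations R M C}"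
        using d pf[OF d(1)] by blast
    next
      fix v assume "v \<in> tensor_class R M B ` {c \<in> ?FB. push g c \<in> tensor_relations R M C}"
      then obtain c where c: "c \<in> ?FB" "push g c \<in> tensor_relations R M C" "v = tensor_class R M B c"
        by blast
      then obtain d where d: "d \<in> ?FA" "c - push f d \<in> tensor_relations R M B" using R by blast
      then have "v = tensor_class R M B (push f d)"
        using MB.tensor_class_eq_iff[of c "push f d"] pf[OF d(1)] c by blast
      then show "v \<in> (\<lambda>d. tensor_class R M B (push f d)) ` ?FA" using d by blast
    qed
  qed
qed

lemma inj_tensor_map_iff:
  assumes mods: "module R M" "module R A" "module R B" and f: "f \<in> mod_hom R A B"
  shows "inj_on (tensor_map R M B f) (carrier (tensor_group R M A)) \<longleftrightarrow>
    (\<forall>c. formal_sum M A c \<longrightarrow>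
      push f c \<in> tensor_relations R M B \<longrightarrow> c \<in> tensor_relations R M A)"
proof -
  interpret MA: module_pair R M A using mods by (simp add: module_pair_def)
  interpret MB: module_pair R M B using mods by (simp add: module_pair_def)
  let ?FA = "{c. formal_sum M A c}"
  have pf: "formal_sum M B (push f d)" if "d \<in> ?FA" for d :: "'b \<times> 'c \<Rightarrow>\<^sub>0 int"
    using that keys_push[of d "carrier M" "carrier A" f "carrier B"] mod_homD(1)[OF f] by auto
  have eq: "tensor_map R M B f (tensor_class R M A c) = tensor_map R M B f (tensor_class R M A d)
      \<longleftrightarrow> push f (c - d) \<in> tensor_relations R M B" if "c \<in> ?FA" "d \<in> ?FA" for c d
    using MB.tensor_class_eq_iff[OF pf pf, OF that] that
    by (simp add: tensor_map_class[OF mods(1-3) f])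
  show ?thesis
  proof (intro iffI allI impI)
    fix c :: "'b \<times> 'c \<Rightarrow>\<^sub>0 int"
    assume inj: "inj_on (tensor_map R M B f) (carrier (tensor_group R M A))"
      and c: "formal_sum M A c" "push f c \<in> tensor_relations R M B"
    then have "tensor_class R M A c = tensor_class R M A 0"
      using eq[of c 0] by (intro inj_onD[OF inj]) (auto simp: MA.carrier_tensor_group)
    then show "c \<in> tensor_relations R M A"
      using MA.tensor_class_eq_iff[OF c(1), of 0] by simp
  next
    assume *: "\<forall>c. formal_sum M A c \<longrightarrow>
      push f c \<in> tensor_relations R M B \<longrightarrow> c \<in> tensor_relations R M A"
    show "inj_on (tensor_map R M B f) (carrier (tensor_group R M A))"
    proof (rule inj_onI, unfold MA.carrier_tensor_group, elim imageE)
      fix v w c d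
      assume v: "v = tensor_class R M A c" "w = tensor_class R M A d" and cd: "c \<in> ?FA" "d \<in> ?FA"
        and "tensor_map R M B f v = tensor_map R M B f w"
      then have "push f (c - d) \<in> tensor_relations R M B" using eq[OF cd] by blast
      then have "c - d \<in> tensor_relations R M A" using * cd keys_diff_subset[of c _ d] by blast
      then show "v = w" using MA.tensor_class_eq_iff[of c d] cd v by blast
    qed
  qed
qed

text \<open>
  Tensoring is right exact.  A set-theoretic section of \<open>g\<close> is additive and linear up to elements
  of the image of \<open>f\<close>, so it carries relations to relations modulo the image of \<open>M \<otimes> F\<close>.
\<close>

lemma tensor_right_exact:
  assumes mods: "module R M" "module R F" "module R E" "module R G"
    and f: "f \<in> mod_hom R F E" and g: "g \<in> mod_hom R E G"
    and im: "f ` carrier F = {x \<in> carrier E. g x = \<zero>\<^bsub>G\<^esub>}"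
    and surj: "g ` carrier E = carrier G"
  shows "exact_at (tensor_group R M F) (tensor_group R M E) (tensor_group R M G)
      (tensor_map R M E f) (tensor_map R M G g)"
    and "tensor_map R M G g ` carrier (tensor_group R M E) = carrier (tensor_group R M G)"
proof -
  interpret MF: module_pair R M F using mods by (simp add: module_pair_def)
  interpret ME: module_pair R M E using mods by (simp add: module_pair_def)
  interpret MG: module_pair R M G using mods by (simp add: module_pair_def)
  note fh = mod_homD[OF f] note gh = mod_homD[OF g]
  define s where "s = inv_into (carrier E) g"
  have s: "s z \<in> carrier E" "g (s z) = z" if "z \<in> carrier G" for z
    using that surj by (auto simp: s_def inv_into_into f_inv_into_f)
  define H where "H = {c. \<exists>d. formal_sum M F d \<and>
      c - push f d \<in> tensor_relations R M E}"
  have H0: "c \<in> H" if "c \<in> tensor_relations R M E" for c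
    unfolding H_def using that by (auto intro!: exI[of _ 0])
  have Hd: "c - d \<in> H" if cd: "c \<in> H" "d \<in> H" for c d
  proof -
    obtain c' d' where c': "formal_sum M F c'" "c - push f c' \<in> tensor_relations R M E"
      and d': "formal_sum M F d'" "d - push f d' \<in> tensor_relations R M E"
      using cd unfolding H_def by blast
    have "c - d - push f (c' - d') \<in> tensor_relations R M E"
      using ME.relations_diff[OF c'(2) d'(2)] by (simp add: algebra_simps)
    then show ?thesis unfolding H_def using keys_diff_subset[OF c'(1) d'(1)] by blast
  qed
  have Ha: "c + d \<in> H" if "c \<in> H" "d \<in> H" for c d
    using Hd[OF that(1) Hd[OF H0[OF ME.relations_zero] that(2)]] by simp
  have Hf: "frag_of (x, f y) \<in> H" if "x \<in> carrier M" "y \<in> carrier F" for x y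
    unfolding H_def using that ME.relations_zero by (auto intro!: exI[of _ "frag_of (x, y)"])
  \<comment> \<open>elements of \<open>E\<close> with the same image under \<open>g\<close> are interchangeable modulo \<open>H\<close>\<close>
  have Hg: "frag_of (x, y) - frag_of (x, y') \<in> H"
    if x: "x \<in> carrier M" and y: "y \<in> carrier E" "y' \<in> carrier E" and eq: "g y = g y'" for x y y'
  proof -
    have "g (y \<oplus>\<^bsub>E\<^esub> \<ominus>\<^bsub>E\<^esub> y') = \<zero>\<^bsub>G\<^esub>"
      using y eq gh by (simp add: mod_hom_minus[OF mods(3,4) g] MG.N.M.r_neg)
    then obtain z where z: "z \<in> carrier F" "f z = y \<oplus>\<^bsub>E\<^esub> \<ominus>\<^bsub>E\<^esub> y'"
      using im y by (metis (mono_tags, lifting) ME.N.M.a_closed ME.N.M.a_inv_closed imageE mem_Collect_eq)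
    have yz: "y = f z \<oplus>\<^bsub>E\<^esub> y'" using y z(2) by (simp add: ME.N.M.a_assoc ME.N.M.l_neg)
    have "frag_of (x, y) - frag_of (x, f z) - frag_of (x, y') \<in> H"
      unfolding yz using fh(1) z x y by (intro H0 ME.relation_add_right) auto
    from Ha[OF this Hf[OF x z(1)]] show ?thesis by (simp add: algebra_simps)
  qed
  have sH: "push s c \<in> H" if "c \<in> tensor_relations R M G" for c
    using that
  proof (induction rule: MG.relations_induct)
    case zero then show ?case by (simp add: H0 ME.relations_zero)
  next
    case (diff c d) then show ?case by (simp add: Hd)
  next
    case (add_left x x' y) then show ?case using s by (simp add: H0 ME.relation_add_left)
  next
    case (add_right x y y')
    have 1: "frag_of (x, s (y \<oplus>\<^bsub>G\<^esub> y')) - frag_of (x, s y \<oplus>\<^bsub>E\<^esub> s y') \<in> H"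
      using add_right s gh by (intro Hg) auto
    have 2: "frag_of (x, s y \<oplus>\<^bsub>E\<^esub> s y') - frag_of (x, s y) - frag_of (x, s y') \<in> H"
      using add_right s by (intro H0 ME.relation_add_right) auto
    from Ha[OF 1 2] show ?case by (simp add: algebra_simps)
  next
    case (smult r x y)
    have 1: "frag_of (x, r \<odot>\<^bsub>E\<^esub> s y) - frag_of (x, s (r \<odot>\<^bsub>G\<^esub> y)) \<in> H"
      using smult s gh by (intro Hg) auto
    have 2: "frag_of (r \<odot>\<^bsub>M\<^esub> x, s y) - frag_of (x, r \<odot>\<^bsub>E\<^esub> s y) \<in> H"
      using smult s by (intro H0 ME.relation_smult) auto
    from Ha[OF 1 2] show ?case by (simp add: algebra_simps)
  qed
  have sg: "c - push s (push g c) \<in> H" if "formal_sum M E c" for c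
    using that
  proof (induction rule: free_Abelian_group_induct[consumes 1, case_names zero diff generator])
    case zero then show ?case by (simp add: H0 ME.relations_zero)
  next
    case (diff c d)
    from Hd[OF diff(3,4)] show ?case by (simp add: algebra_simps)
  next
    case (generator a)
    then obtain x y where "a = (x, y)" "x \<in> carrier M" "y \<in> carrier E" by auto
    then show ?case using s gh by (auto intro: Hg)
  qed
  have gf: "push g (push f d) \<in> tensor_relations R M G"
    if "formal_sum M F d" for d
    unfolding push_push using im by (intro MG.push_null[OF that]) blast
  show "exact_at (tensor_group R M F) (tensor_group R M E) (tensor_group R M G)
      (tensor_map R M E f) (tensor_map R M G g)"
    unfolding exact_at_tensor_iff[OF mods f g]
  proof (intro allI impI iffI)
    fix c :: "'b \<times> 'd \<Rightarrow>\<^sub>0 int"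
    assume c: "formal_sum M E c" and gc: "push g c \<in> tensor_relations R M G"
    have "c \<in> H" using Ha[OF sg[OF c] sH[OF gc]] by simp
    then show "\<exists>d. formal_sum M F d \<and> c - push f d \<in> tensor_relations R M E"
      by (simp add: H_def)
  next
    fix c :: "'b \<times> 'd \<Rightarrow>\<^sub>0 int"
    assume "formal_sum M E c"
      "\<exists>d. formal_sum M F d \<and> c - push f d \<in> tensor_relations R M E"
    then obtain d where d: "formal_sum M F d"
      "c - push f d \<in> tensor_relations R M E" by blast
    show "push g c \<in> tensor_relations R M G"
      using MG.relations_add[OF push_relations[OF mods(1,3,4) g d(2)] gf[OF d(1)]] by simp
  qed
  show "tensor_map R M G g ` carrier (tensor_group R M E) = carrier (tensor_group R M G)"
  proof (intro subset_antisym subsetI)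
    fix v assume "v \<in> tensor_map R M G g ` carrier (tensor_group R M E)"
    then obtain c where c: "formal_sum M E c"
      "v = tensor_map R M G g (tensor_class R M E c)"
      unfolding ME.carrier_tensor_group by blast
    then show "v \<in> carrier (tensor_group R M G)"
      unfolding MG.carrier_tensor_group
      using keys_push[OF c(1), of g "carrier G"] gh(1)
      by (auto simp: tensor_map_class[OF mods(1,3,4) g c(1)])
  next
    fix v assume "v \<in> carrier (tensor_group R M G)"
    then obtain c where c: "formal_sum M G c" "v = tensor_class R M G c"
      unfolding MG.carrier_tensor_group by blast
    have sk: "formal_sum M E (push s c)"
      using keys_push[OF c(1)] s by blast
    have "push g (push s c) = c"
      unfolding push_push using c(1) s(2) by (intro push_ident) auto
    then have "v = tensor_map R M G g (tensor_class R M E (push s c))"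
      by (simp add: tensor_map_class[OF mods(1,3,4) g sk] c)
    then show "v \<in> tensor_map R M G g ` carrier (tensor_group R M E)"
      unfolding ME.carrier_tensor_group using sk by blast
  qed
qed

section \<open>Linear systems over a valuation ring\<close>

definition lincomb :: "('a, 'm, 'x) module_scheme \<Rightarrow> 'v set \<Rightarrow> ('v \<Rightarrow> 'a) \<Rightarrow> ('v \<Rightarrow> 'm) \<Rightarrow> 'm" where
  "lincomb M V a \<xi> = (\<Oplus>\<^bsub>M\<^esub>v\<in>V. a v \<odot>\<^bsub>M\<^esub> \<xi> v)"

context module
begin

lemma lincomb_closed:
  assumes "a \<in> V \<rightarrow> carrier R" "\<xi> \<in> V \<rightarrow> carrier M"
  shows "lincomb M V a \<xi> \<in> carrier M"
  unfolding lincomb_def using assms by (intro M.finsum_closed) auto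

lemma lincomb_empty: "lincomb M {} a \<xi> = \<zero>\<^bsub>M\<^esub>"
  by (simp add: lincomb_def)

lemma lincomb_insert:
  assumes "finite V" "w \<notin> V" "a \<in> insert w V \<rightarrow> carrier R" "\<xi> \<in> insert w V \<rightarrow> carrier M"
  shows "lincomb M (insert w V) a \<xi> = a w \<odot>\<^bsub>M\<^esub> \<xi> w \<oplus>\<^bsub>M\<^esub> lincomb M V a \<xi>"
  unfolding lincomb_def using assms by (subst M.finsum_insert) auto

lemma lincomb_cong:
  assumes "a \<in> V \<rightarrow> carrier R" "\<xi> \<in> V \<rightarrow> carrier M"
    "\<And>v. v \<in> V \<Longrightarrow> b v = a v" "\<And>v. v \<in> V \<Longrightarrow> \<eta> v = \<xi> v"
  shows "lincomb M V b \<eta> = lincomb M V a \<xi>"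
  unfolding lincomb_def using assms by (intro M.finsum_cong') auto

lemma lincomb_remove:
  assumes "finite V" "w \<in> V" "a \<in> V \<rightarrow> carrier R" "\<xi> \<in> V \<rightarrow> carrier M"
  shows "lincomb M V a \<xi> = a w \<odot>\<^bsub>M\<^esub> \<xi> w \<oplus>\<^bsub>M\<^esub> lincomb M (V - {w}) a \<xi>"
  using lincomb_insert[of "V - {w}" w a \<xi>] assms by (simp add: insert_absorb)

lemma lincomb_add:
  assumes "finite V" "a \<in> V \<rightarrow> carrier R" "b \<in> V \<rightarrow> carrier R" "\<xi> \<in> V \<rightarrow> carrier M"
  shows "lincomb M V (\<lambda>v. a v \<oplus> b v) \<xi> = lincomb M V a \<xi> \<oplus>\<^bsub>M\<^esub> lincomb M V b \<xi>"
proof -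
  have "lincomb M V (\<lambda>v. a v \<oplus> b v) \<xi> = (\<Oplus>\<^bsub>M\<^esub>v\<in>V. a v \<odot>\<^bsub>M\<^esub> \<xi> v \<oplus>\<^bsub>M\<^esub> b v \<odot>\<^bsub>M\<^esub> \<xi> v)"
    unfolding lincomb_def using assms by (intro M.finsum_cong') (auto simp: smult_l_distr Pi_def)
  also have "\<dots> = lincomb M V a \<xi> \<oplus>\<^bsub>M\<^esub> lincomb M V b \<xi>"
    unfolding lincomb_def using assms by (intro M.finsum_addf) auto
  finally show ?thesis .
qed

lemma lincomb_scale:
  assumes "finite V" "a \<in> V \<rightarrow> carrier R" "r \<in> carrier R" "\<xi> \<in> V \<rightarrow> carrier M"
  shows "lincomb M V (\<lambda>v. r \<otimes> a v) \<xi> = r \<odot>\<^bsub>M\<^esub> lincomb M V a \<xi>"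
proof -
  have "lincomb M V (\<lambda>v. r \<otimes> a v) \<xi> = (\<Oplus>\<^bsub>M\<^esub>v\<in>V. r \<odot>\<^bsub>M\<^esub> (a v \<odot>\<^bsub>M\<^esub> \<xi> v))"
    unfolding lincomb_def using assms by (intro M.finsum_cong') (auto simp: smult_assoc1 Pi_def)
  also have "\<dots> = r \<odot>\<^bsub>M\<^esub> lincomb M V a \<xi>"
    unfolding lincomb_def using assms by (intro finsum_smult_ldistr[symmetric]) auto
  finally show ?thesis .
qed

lemma lincomb_zero:
  assumes "\<xi> \<in> V \<rightarrow> carrier M" "\<And>v. v \<in> V \<Longrightarrow> a v = \<zero>"
  shows "lincomb M V a \<xi> = \<zero>\<^bsub>M\<^esub>"
proof -
  have "lincomb M V a \<xi> = (\<Oplus>\<^bsub>M\<^esub>v\<in>V. \<zero>\<^bsub>M\<^esub>)"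
    unfolding lincomb_def using assms by (intro M.finsum_cong') (auto intro!: smult_l_null)
  then show ?thesis by simp
qed

lemma lincomb_minus:
  assumes "finite V" "a \<in> V \<rightarrow> carrier R" "\<xi> \<in> V \<rightarrow> carrier M"
  shows "lincomb M V (\<lambda>v. \<ominus> a v) \<xi> = \<ominus>\<^bsub>M\<^esub> lincomb M V a \<xi>"
proof -
  have "lincomb M V (\<lambda>v. \<ominus> a v) \<xi> = lincomb M V (\<lambda>v. (\<ominus> \<one>) \<otimes> a v) \<xi>"
    using assms by (intro lincomb_cong) (auto simp: R.l_minus Pi_def)
  also have "\<dots> = (\<ominus> \<one>) \<odot>\<^bsub>M\<^esub> lincomb M V a \<xi>"
    using assms by (intro lincomb_scale) auto
  also have "\<dots> = \<ominus>\<^bsub>M\<^esub> lincomb M V a \<xi>"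
    using assms by (simp add: smult_l_minus lincomb_closed)
  finally show ?thesis .
qed

lemma lincomb_diff:
  assumes "finite V" "a \<in> V \<rightarrow> carrier R" "b \<in> V \<rightarrow> carrier R" "\<xi> \<in> V \<rightarrow> carrier M"
  shows "lincomb M V (\<lambda>v. a v \<ominus> b v) \<xi> = lincomb M V a \<xi> \<ominus>\<^bsub>M\<^esub> lincomb M V b \<xi>"
  using assms by (simp add: a_minus_def lincomb_add lincomb_minus Pi_def)

lemma lincomb_delta:
  assumes "finite V" "w \<in> V" "r \<in> carrier R" "\<xi> \<in> V \<rightarrow> carrier M"
  shows "lincomb M V (\<lambda>v. if v = w then r else \<zero>) \<xi> = r \<odot>\<^bsub>M\<^esub> \<xi> w"
proof -
  have "lincomb M (V - {w}) (\<lambda>v. if v = w then r else \<zero>) \<xi> = \<zero>\<^bsub>M\<^esub>"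
    using assms by (intro lincomb_zero) auto
  moreover have "\<xi> w \<in> carrier M" using assms by auto
  ultimately show ?thesis using assms by (subst lincomb_remove[of V w]) auto
qed

end

lemma regular_module_simps [simp]:
  "carrier (regular_module R) = carrier R" "add (regular_module R) = add R"
  "ring.zero (regular_module R) = ring.zero R" "smult (regular_module R) = monoid.mult R"
  by (simp_all add: regular_module_def)

lemma module_regular_module:
  assumes "cring R"
  shows "module R (regular_module R)"
proof -
  interpret cring R by fact
  show ?thesis
  proof (rule moduleI)
    show "abelian_group (regular_module R)"
    proof (rule abelian_groupI)
      show "\<exists>y\<in>carrier (regular_module R). y \<oplus>\<^bsub>regular_module R\<^esub> x = \<zero>\<^bsub>regular_module R\<^esub>"
        if "x \<in> carrier (regular_module R)" for x
        using that by (auto intro!: bexI[of _ "\<ominus>\<^bsub>R\<^esub> x"] simp: l_neg)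
    qed (auto simp: a_ac)
  qed (auto simp: m_assoc l_distr r_distr cring_axioms)
qed

text \<open>
  Substituting linear combinations into a linear combination multiplies the coefficient matrices;
  the products are linear combinations in the regular module.
\<close>

lemma lincomb_swap:
  fixes R (structure)
  assumes "module R M" "finite V" "finite W" "a \<in> W \<rightarrow> carrier R" "\<And>w. w \<in> W \<Longrightarrow> e w \<in> V \<rightarrow> carrier R"
    "p \<in> V \<rightarrow> carrier M"
  shows "lincomb M W a (\<lambda>w. lincomb M V (e w) p) =
    lincomb M V (\<lambda>v. lincomb (regular_module R) W a (\<lambda>w. e w v)) p"
  using assms(3,4,5)
proof (induction W rule: finite_induct)
  case empty
  interpret module R M by fact
  interpret reg: module R "regular_module R" by (rule module_regular_module) (rule R.cring_axioms)
  show ?case using assms(6) by (simp add: lincomb_empty lincomb_zero reg.lincomb_empty)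
next
  case (insert w W)
  interpret module R M by fact
  interpret reg: module R "regular_module R" by (rule module_regular_module) (rule R.cring_axioms)
  have eW: "(\<lambda>w. e w v) \<in> insert w W \<rightarrow> carrier R" if "v \<in> V" for v
    using insert.prems that by blast
  have cl: "lincomb (regular_module R) W a (\<lambda>w. e w v) \<in> carrier R" if "v \<in> V" for v
    using reg.lincomb_closed[of a W "\<lambda>w. e w v"] eW[OF that] insert.prems by auto
  have "lincomb M V (\<lambda>v. lincomb (regular_module R) (insert w W) a (\<lambda>w. e w v)) p =
      lincomb M V (\<lambda>v. a w \<otimes> e w v \<oplus> lincomb (regular_module R) W a (\<lambda>w. e w v)) p"
  proof (rule lincomb_cong)
    show "(\<lambda>v. a w \<otimes> e w v \<oplus> lincomb (regular_module R) W a (\<lambda>w. e w v)) \<in> V \<rightarrow> carrier R"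
      using cl eW insert.prems by (auto intro!: R.a_closed R.m_closed)
    show "lincomb (regular_module R) (insert w W) a (\<lambda>w. e w v) =
        a w \<otimes> e w v \<oplus> lincomb (regular_module R) W a (\<lambda>w. e w v)" if "v \<in> V" for v
      using reg.lincomb_insert[OF insert.hyps insert.prems(1), of "\<lambda>w. e w v"] eW[OF that] by simp
  qed (use assms in auto)
  also have "\<dots> = lincomb M V (\<lambda>v. a w \<otimes> e w v) p \<oplus>\<^bsub>M\<^esub>
      lincomb M V (\<lambda>v. lincomb (regular_module R) W a (\<lambda>w. e w v)) p"
    using cl eW insert.prems assms by (intro lincomb_add) auto
  also have "lincomb M V (\<lambda>v. a w \<otimes> e w v) p = a w \<odot>\<^bsub>M\<^esub> lincomb M V (e w) p"
    using insert.prems assms by (intro lincomb_scale) auto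
  also have "lincomb M V (\<lambda>v. lincomb (regular_module R) W a (\<lambda>w. e w v)) p =
      lincomb M W a (\<lambda>w. lincomb M V (e w) p)"
    using insert by auto
  also have "a w \<odot>\<^bsub>M\<^esub> lincomb M V (e w) p \<oplus>\<^bsub>M\<^esub> lincomb M W a (\<lambda>w. lincomb M V (e w) p) =
      lincomb M (insert w W) a (\<lambda>w. lincomb M V (e w) p)"
    using insert assms by (intro lincomb_insert[symmetric]) (auto intro!: lincomb_closed)
  finally show ?case ..
qed

lemma valuation_ringD:
  fixes R (structure)
  assumes "valuation_ring R" "a \<in> carrier R" "b \<in> carrier R"
  shows "(\<exists>c\<in>carrier R. a = b \<otimes> c) \<or> (\<exists>c\<in>carrier R. b = a \<otimes> c)"
proof -
  interpret cring R using assms by (simp add: valuation_ring_def)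
  have "ideal (PIdl a) R" "ideal (PIdl b) R" using assms by (auto intro: cgenideal_ideal)
  then have "PIdl a \<subseteq> PIdl b \<or> PIdl b \<subseteq> PIdl a" using assms(1) by (simp add: valuation_ring_def)
  moreover have "a \<in> PIdl a" "b \<in> PIdl b" using assms by (auto intro: cgenideal_self)
  ultimately have "a \<in> PIdl b \<or> b \<in> PIdl a" by blast
  then show ?thesis using assms by (auto simp: cgenideal_def m_comm)
qed

lemma valuation_ring_least_divisor:
  fixes R (structure)
  assumes "valuation_ring R" "finite A" "A \<noteq> {}" "A \<subseteq> carrier R"
  shows "\<exists>a\<in>A. \<forall>b\<in>A. \<exists>c\<in>carrier R. b = a \<otimes> c"
  using assms(2-4)
proof (induction rule: finite_ne_induct)
  case (singleton x)
  interpret cring R using assms by (simp add: valuation_ring_def)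
  show ?case using singleton by (auto intro!: bexI[of _ "\<one>"])
next
  case (insert x A)
  interpret cring R using assms by (simp add: valuation_ring_def)
  obtain a where a: "a \<in> A" "\<forall>b\<in>A. \<exists>c\<in>carrier R. b = a \<otimes> c" using insert by auto
  have aR: "a \<in> carrier R" "x \<in> carrier R" using a insert.prems by auto
  from valuation_ringD[OF assms(1) aR] show ?case
  proof (elim disjE bexE)
    fix c assume c: "c \<in> carrier R" "a = x \<otimes> c"
    have "\<exists>d\<in>carrier R. b = x \<otimes> d" if b: "b \<in> insert x A" for b
    proof (cases "b = x")
      case True
      then show ?thesis using aR by (auto intro!: bexI[of _ "\<one>"])
    next
      case False
      then obtain d where "d \<in> carrier R" "b = a \<otimes> d" using a b by blast
      then show ?thesis using c aR by (auto simp: m_assoc intro!: bexI[of _ "c \<otimes> d"])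
    qed
    then show ?thesis by blast
  next
    fix c assume "c \<in> carrier R" "x = a \<otimes> c"
    then show ?thesis using a by blast
  qed
qed

text \<open>
  The condition that Warfield calls relative divisibility: \<open>S \<inter> t M = t S\<close> for all scalars \<open>t\<close>.
\<close>

definition rd_pure :: "'a ring \<Rightarrow> 'm set \<Rightarrow> ('a, 'm) module \<Rightarrow> bool" where
  "rd_pure R S M \<longleftrightarrow> submodule S R M \<and>
     (\<forall>t\<in>carrier R. \<forall>y\<in>carrier M. t \<odot>\<^bsub>M\<^esub> y \<in> S \<longrightarrow> (\<exists>y'\<in>S. t \<odot>\<^bsub>M\<^esub> y' = t \<odot>\<^bsub>M\<^esub> y))"

lemma (in module) submodule_zero: "submodule S R M \<Longrightarrow> \<zero>\<^bsub>M\<^esub> \<in> S"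
  using subgroup.one_closed[OF submodule.axioms(1)] by simp

lemma (in module) lincomb_in_submodule:
  assumes "submodule S R M" "finite V" "a \<in> V \<rightarrow> carrier R" "\<xi> \<in> V \<rightarrow> S"
  shows "lincomb M V a \<xi> \<in> S"
  using assms(2-4)
proof (induction rule: finite_induct)
  case empty
  show ?case using submodule_zero[OF assms(1)] by (simp add: lincomb_empty)
next
  case (insert w W)
  note S = submoduleE[OF assms(1)]
  have "\<xi> \<in> insert w W \<rightarrow> carrier M" using insert.prems(2) S(1) by blast
  then show ?case using insert S(4,5) by (simp add: lincomb_insert)
qed

text \<open>
  Gaussian elimination: a coefficient that divides all others can serve as a pivot, and relative
  divisibility suffices to solve the pivot equation once the other unknowns are known.
\<close>

lemma rd_pure_linear_system:
  fixes R (structure)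
  assumes vr: "valuation_ring R" and mod: "module R M" and rd: "rd_pure R S M"
    and "finite J" "finite V"
    and "\<And>j. j \<in> J \<Longrightarrow> a j \<in> V \<rightarrow> carrier R" "b \<in> J \<rightarrow> S" "\<xi> \<in> V \<rightarrow> carrier M"
    and "\<And>j. j \<in> J \<Longrightarrow> lincomb M V (a j) \<xi> = b j"
  shows "\<exists>\<eta>\<in>V \<rightarrow> S. \<forall>j\<in>J. lincomb M V (a j) \<eta> = b j"
  using assms(4-)
proof (induction "card J" arbitrary: J V a b)
  case 0
  interpret module R M by fact
  have "(\<lambda>v. \<zero>\<^bsub>M\<^esub>) \<in> V \<rightarrow> S" using rd submodule_zero by (auto simp: rd_pure_def)
  then show ?case using 0 by auto
next
  case (Suc n)
  interpret module R M by fact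
  have sub: "submodule S R M" using rd by (simp add: rd_pure_def)
  note S = submoduleE[OF sub]
  show ?case
  proof (cases "V = {}")
    case True
    then show ?thesis using Suc.prems by (auto simp: lincomb_empty)
  next
    case False
    have "J \<noteq> {}" using Suc by auto
    define A where "A = (\<lambda>(j, v). a j v) ` (J \<times> V)"
    have aR: "a j v \<in> carrier R" if "j \<in> J" "v \<in> V" for j v using that Suc.prems(3) by blast
    have A: "finite A" "A \<noteq> {}" "A \<subseteq> carrier R"
      using \<open>J \<noteq> {}\<close> False Suc.prems aR by (auto simp: A_def)
    obtain \<alpha> where \<alpha>: "\<alpha> \<in> A" "\<forall>b\<in>A. \<exists>c\<in>carrier R. b = \<alpha> \<otimes> c"
      using valuation_ring_least_divisor[OF vr A] by blast
    then obtain j0 v0 where jv: "j0 \<in> J" "v0 \<in> V" "\<alpha> = a j0 v0" by (auto simp: A_def)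
    have \<alpha>R: "\<alpha> \<in> carrier R" using \<alpha> A by blast
    have "\<forall>j\<in>J. \<exists>c\<in>carrier R. a j v0 = \<alpha> \<otimes> c" using \<alpha>(2) jv(2) by (auto simp: A_def)
    then obtain d where d: "\<And>j. j \<in> J \<Longrightarrow> d j \<in> carrier R" "\<And>j. j \<in> J \<Longrightarrow> a j v0 = \<alpha> \<otimes> d j"
      by metis
    have "\<forall>v\<in>V. \<exists>c\<in>carrier R. a j0 v = \<alpha> \<otimes> c" using \<alpha>(2) jv(1) by (auto simp: A_def)
    then obtain e where e: "\<And>v. v \<in> V \<Longrightarrow> e v \<in> carrier R" "\<And>v. v \<in> V \<Longrightarrow> a j0 v = \<alpha> \<otimes> e v"
      by metis
    let ?V = "V - {v0}" and ?J = "J - {j0}"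
    define a' where "a' j v = a j v \<ominus> d j \<otimes> a j0 v" for j v
    define b' where "b' j = b j \<ominus>\<^bsub>M\<^esub> d j \<odot>\<^bsub>M\<^esub> b j0" for j
    have fV: "finite ?V" using Suc.prems by simp
    have bS: "b j \<in> S" "b j \<in> carrier M" if "j \<in> J" for j
      using that Suc.prems(4) subsetD[OF S(1)] by auto
    have a'R: "a' j \<in> ?V \<rightarrow> carrier R" if "j \<in> J" for j
      using that aR d(1) jv(1,2) by (auto simp: a'_def)
    \<comment> \<open>the given solution and the one to be constructed split in the same way into the pivot
      equation and the remaining ones\<close>
    have pivot: "lincomb M V (a j0) \<zeta> = \<alpha> \<odot>\<^bsub>M\<^esub> (\<zeta> v0 \<oplus>\<^bsub>M\<^esub> lincomb M ?V e \<zeta>)"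
      if \<zeta>: "\<zeta> \<in> V \<rightarrow> carrier M" for \<zeta>
    proof -
      have \<zeta>': "\<zeta> v0 \<in> carrier M" "lincomb M ?V e \<zeta> \<in> carrier M"
        using \<zeta> e(1) jv(1,2) by (auto intro!: lincomb_closed)
      have "lincomb M ?V (a j0) \<zeta> = lincomb M ?V (\<lambda>v. \<alpha> \<otimes> e v) \<zeta>"
        using \<zeta> e \<alpha>R by (intro lincomb_cong) auto
      also have "\<dots> = \<alpha> \<odot>\<^bsub>M\<^esub> lincomb M ?V e \<zeta>"
        using \<zeta> e(1) \<alpha>R fV by (intro lincomb_scale) auto
      finally have 1: "lincomb M ?V (a j0) \<zeta> = \<alpha> \<odot>\<^bsub>M\<^esub> lincomb M ?V e \<zeta>" .
      have "lincomb M V (a j0) \<zeta> = a j0 v0 \<odot>\<^bsub>M\<^esub> \<zeta> v0 \<oplus>\<^bsub>M\<^esub> lincomb M ?V (a j0) \<zeta>"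
        using jv(1,2) aR \<zeta> Suc.prems(1-5) by (intro lincomb_remove) auto
      then show ?thesis using 1 jv(3) \<zeta>' \<alpha>R by (simp add: smult_r_distr)
    qed
    have rest: "lincomb M V (a j) \<zeta> = lincomb M ?V (a' j) \<zeta> \<oplus>\<^bsub>M\<^esub> d j \<odot>\<^bsub>M\<^esub> lincomb M V (a j0) \<zeta>"
      if j: "j \<in> J" and \<zeta>: "\<zeta> \<in> V \<rightarrow> carrier M" for j \<zeta>
    proof -
      have \<zeta>v: "\<zeta> v0 \<in> carrier M" using \<zeta> jv(2) by auto
      have c1: "lincomb M ?V (a j) \<zeta> \<in> carrier M" "lincomb M ?V (a j0) \<zeta> \<in> carrier M"
        using j jv(1,2) aR \<zeta> by (auto intro!: lincomb_closed)
      have "lincomb M ?V (a' j) \<zeta> = lincomb M ?V (a j) \<zeta> \<ominus>\<^bsub>M\<^esub> lincomb M ?V (\<lambda>v. d j \<otimes> a j0 v) \<zeta>"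
        unfolding a'_def using j jv(1,2) aR \<zeta> d(1) fV by (intro lincomb_diff) auto
      also have "lincomb M ?V (\<lambda>v. d j \<otimes> a j0 v) \<zeta> = d j \<odot>\<^bsub>M\<^esub> lincomb M ?V (a j0) \<zeta>"
        using j jv(1,2) aR \<zeta> d(1) fV by (intro lincomb_scale) auto
      finally have 1: "lincomb M ?V (a j) \<zeta> =
          lincomb M ?V (a' j) \<zeta> \<oplus>\<^bsub>M\<^esub> d j \<odot>\<^bsub>M\<^esub> lincomb M ?V (a j0) \<zeta>"
        using c1 d(1)[OF j] by (simp add: a_minus_def M.a_assoc M.l_neg)
      have c2: "lincomb M ?V (a' j) \<zeta> \<in> carrier M"
        using a'R[OF j] \<zeta> by (auto intro!: lincomb_closed)
      have 2: "lincomb M V (a j) \<zeta> = a j v0 \<odot>\<^bsub>M\<^esub> \<zeta> v0 \<oplus>\<^bsub>M\<^esub> lincomb M ?V (a j) \<zeta>"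
        using j jv(1,2) aR \<zeta> Suc.prems(1-5) by (intro lincomb_remove) auto
      have 3: "lincomb M V (a j0) \<zeta> = \<alpha> \<odot>\<^bsub>M\<^esub> \<zeta> v0 \<oplus>\<^bsub>M\<^esub> lincomb M ?V (a j0) \<zeta>"
        unfolding jv(3) using j jv(1,2) aR \<zeta> Suc.prems(1-5) by (intro lincomb_remove) auto
      have 4: "a j v0 \<odot>\<^bsub>M\<^esub> \<zeta> v0 = d j \<odot>\<^bsub>M\<^esub> (\<alpha> \<odot>\<^bsub>M\<^esub> \<zeta> v0)"
        using d[OF j] \<alpha>R \<zeta>v by (simp add: smult_assoc1[symmetric] R.m_comm)
      show ?thesis
        unfolding 2 1 3 4 using c1 c2 d(1)[OF j] \<alpha>R \<zeta>v
        by (simp add: smult_r_distr M.a_lcomm)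
    qed
    have "\<exists>\<eta>\<in>?V \<rightarrow> S. \<forall>j\<in>?J. lincomb M ?V (a' j) \<eta> = b' j"
    proof (rule Suc.hyps(1))
      show "n = card ?J" using Suc.hyps(2) jv(1) Suc.prems(1) by simp
      show "finite ?J" "finite ?V" using Suc.prems by auto
      show "a' j \<in> ?V \<rightarrow> carrier R" if "j \<in> ?J" for j
        using that a'R by blast
      show "b' \<in> ?J \<rightarrow> S"
        using bS S(3,4,5) d(1) jv(1,2) by (auto simp: b'_def a_minus_def)
      show "\<xi> \<in> ?V \<rightarrow> carrier M" using Suc.prems by auto
      show "lincomb M ?V (a' j) \<xi> = b' j" if "j \<in> ?J" for j
      proof -
        have c2: "lincomb M ?V (a' j) \<xi> \<in> carrier M"
          using that a'R[of j] Suc.prems(5) by (auto intro!: lincomb_closed)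
        have "b j = lincomb M ?V (a' j) \<xi> \<oplus>\<^bsub>M\<^esub> d j \<odot>\<^bsub>M\<^esub> b j0"
          using rest[of j \<xi>] that jv(1,2) Suc.prems(5,6) by auto
        then show ?thesis
          using c2 d(1)[of j] bS[OF jv(1)] that
          by (simp add: b'_def a_minus_def M.a_assoc M.r_neg)
      qed
    qed
    then obtain \<eta> where \<eta>: "\<eta> \<in> ?V \<rightarrow> S" "\<And>j. j \<in> ?J \<Longrightarrow> lincomb M ?V (a' j) \<eta> = b' j" by blast
    let ?y = "\<xi> v0 \<oplus>\<^bsub>M\<^esub> lincomb M ?V e \<xi>"
    have y: "?y \<in> carrier M"
      using Suc.prems(5) jv(2) e(1) by (auto intro!: lincomb_closed M.a_closed)
    have "\<alpha> \<odot>\<^bsub>M\<^esub> ?y = b j0" using pivot[OF Suc.prems(5)] Suc.prems(6)[OF jv(1)] by simp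
    then obtain q where q: "q \<in> S" "\<alpha> \<odot>\<^bsub>M\<^esub> q = b j0"
      using rd \<alpha>R y bS[OF jv(1)] unfolding rd_pure_def by metis
    have fS: "lincomb M ?V e \<eta> \<in> S"
      using \<eta>(1) e(1) fV by (intro lincomb_in_submodule[OF sub]) auto
    define \<theta> where "\<theta> v = (if v = v0 then q \<ominus>\<^bsub>M\<^esub> lincomb M ?V e \<eta> else \<eta> v)" for v
    have \<theta>: "\<theta> \<in> V \<rightarrow> S" using q fS \<eta>(1) S(3,5) by (auto simp: \<theta>_def a_minus_def)
    then have \<theta>M: "\<theta> \<in> V \<rightarrow> carrier M" using S(1) by blast
    have \<eta>M: "\<eta> \<in> ?V \<rightarrow> carrier M" using \<eta>(1) S(1) by blast
    have \<theta>\<eta>: "lincomb M ?V c \<theta> = lincomb M ?V c \<eta>" if "c \<in> ?V \<rightarrow> carrier R" for c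
      using that \<eta>M by (intro lincomb_cong) (auto simp: \<theta>_def)
    have qM: "q \<in> carrier M" "lincomb M ?V e \<eta> \<in> carrier M" using q fS S(1) by blast+
    have "lincomb M ?V e \<theta> = lincomb M ?V e \<eta>" using e(1) by (intro \<theta>\<eta>) auto
    then have p: "lincomb M V (a j0) \<theta> = b j0"
      using pivot[OF \<theta>M] q qM by (simp add: \<theta>_def a_minus_def M.a_assoc M.l_neg)
    have "lincomb M V (a j) \<theta> = b j" if j: "j \<in> J" for j
    proof (cases "j = j0")
      case False
      have "lincomb M V (a j) \<theta> = b' j \<oplus>\<^bsub>M\<^esub> d j \<odot>\<^bsub>M\<^esub> b j0"
        using rest[OF j \<theta>M] p \<theta>\<eta>[OF a'R[OF j]] \<eta>(2)[of j] j False by simp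
      also have "\<dots> = b j"
        using bS j jv(1) d(1)[OF j] by (simp add: b'_def a_minus_def M.a_assoc M.l_neg)
      finally show ?thesis .
    qed (simp add: p)
    then show ?thesis using \<theta> by blast
  qed
qed

section \<open>Finite sets of relations\<close>

text \<open>
  Compatibility with the sums \<open>x + y\<close> for \<open>(x, y) \<in> Q\<close> and the multiples \<open>r x\<close> for \<open>(r, x) \<in> P\<close> only.
  For finite \<open>Q\<close> and \<open>P\<close> such maps exist where homomorphisms do not, and since a tensor vanishes on
  account of finitely many relations they can replace homomorphisms in computations with tensors.
\<close>

definition preserves ::
  "'a ring \<Rightarrow> ('a, 'm) module \<Rightarrow> ('a, 'n) module \<Rightarrow> ('m \<times> 'm) set \<Rightarrow> ('a \<times> 'm) set \<Rightarrow> ('m \<Rightarrow> 'n) \<Rightarrow> bool" where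
  "preserves R M N Q P \<phi> \<longleftrightarrow> \<phi> \<in> carrier M \<rightarrow> carrier N \<and>
     (\<forall>(x, y)\<in>Q. \<phi> (x \<oplus>\<^bsub>M\<^esub> y) = \<phi> x \<oplus>\<^bsub>N\<^esub> \<phi> y) \<and> (\<forall>(r, x)\<in>P. \<phi> (r \<odot>\<^bsub>M\<^esub> x) = r \<odot>\<^bsub>N\<^esub> \<phi> x)"

definition relation_pairs ::
  "'a ring \<Rightarrow> ('a, 'm) module \<Rightarrow> ('m \<times> 'm) set \<Rightarrow> ('a \<times> 'm) set \<Rightarrow> bool" where
  "relation_pairs R M Q P \<longleftrightarrow>
     finite Q \<and> finite P \<and> Q \<subseteq> carrier M \<times> carrier M \<and> P \<subseteq> carrier R \<times> carrier M"

lemma relation_pairs_Un: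
  "relation_pairs R M Q P \<Longrightarrow> relation_pairs R M Q' P' \<Longrightarrow> relation_pairs R M (Q \<union> Q') (P \<union> P')"
  by (auto simp: relation_pairs_def)

lemma preserves_mono:
  "preserves R M N Q P \<phi> \<Longrightarrow> Q' \<subseteq> Q \<Longrightarrow> P' \<subseteq> P \<Longrightarrow> preserves R M N Q' P' \<phi>"
  unfolding preserves_def by blast

text \<open>
  Every finite part of \<open>E\<close> admits a retraction onto \<open>F\<close>.  This is the form of purity that is easy to
  verify, by linear systems or by evaluation in reduced powers.
\<close>

definition finitely_split ::
  "'a ring \<Rightarrow> ('a, 'x) module \<Rightarrow> ('a, 'y) module \<Rightarrow> ('x \<Rightarrow> 'y) \<Rightarrow> bool" where
  "finitely_split R F E f \<longleftrightarrow>
     (\<forall>Q P T. relation_pairs R E Q P \<and> finite T \<and> T \<subseteq> carrier F \<longrightarrow>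
        (\<exists>\<phi>. preserves R E F Q P \<phi> \<and> (\<forall>x\<in>T. \<phi> (f x) = x)))"

text \<open>
  Membership of an element in the subgroup of tensor relations is witnessed by finitely many sums
  and multiples in the second factor.
\<close>

lemma push_preserves_relations:
  assumes mods: "module R N" "module R E" "module R F" and c: "c \<in> tensor_relations R N E"
  shows "\<exists>Q P. relation_pairs R E Q P \<and>
    (\<forall>\<phi>. preserves R E F Q P \<phi> \<longrightarrow> push \<phi> c \<in> tensor_relations R N F)"
proof -
  interpret NE: module_pair R N E using mods by (simp add: module_pair_def)
  interpret NF: module_pair R N F using mods by (simp add: module_pair_def)
  show ?thesis
    using c
  proof (induction rule: NE.relations_induct)
    case zero
    show ?case by (rule exI[of _ "{}"], rule exI[of _ "{}"])
        (simp add: relation_pairs_def NF.relations_zero)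
  next
    case (diff c d)
    obtain Q P where 1: "relation_pairs R E Q P"
      "\<And>\<phi>. preserves R E F Q P \<phi> \<Longrightarrow> push \<phi> c \<in> tensor_relations R N F" using diff(3) by blast
    obtain Q' P' where 2: "relation_pairs R E Q' P'"
      "\<And>\<phi>. preserves R E F Q' P' \<phi> \<Longrightarrow> push \<phi> d \<in> tensor_relations R N F" using diff(4) by blast
    have "push \<phi> (c - d) \<in> tensor_relations R N F" if \<phi>: "preserves R E F (Q \<union> Q') (P \<union> P') \<phi>" for \<phi>
      using 1(2)[OF preserves_mono[OF \<phi>]] 2(2)[OF preserves_mono[OF \<phi>]]
      by (simp add: NF.relations_diff)
    then show ?case using relation_pairs_Un[OF 1(1) 2(1)] by blast
  next
    case (add_left x x' y)
    show ?case
      by (rule exI[of _ "{}"], rule exI[of _ "{}"])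
        (use add_left in \<open>auto simp: relation_pairs_def preserves_def intro!: NF.relation_add_left\<close>)
  next
    case (add_right x y y')
    show ?case
      by (rule exI[of _ "{(y, y')}"], rule exI[of _ "{}"])
        (use add_right in \<open>auto simp: relation_pairs_def preserves_def intro!: NF.relation_add_right\<close>)
  next
    case (smult r x y)
    show ?case
      by (rule exI[of _ "{}"], rule exI[of _ "{(r, y)}"])
        (use smult in \<open>auto simp: relation_pairs_def preserves_def intro!: NF.relation_smult\<close>)
  qed
qed

text \<open>
  If \<open>push f c\<close> vanishes, a partial retraction \<open>\<phi>\<close> that respects the relations responsible for it
  also makes \<open>push \<phi> (push f c)\<close> vanish, and this is \<open>c\<close>.
\<close>

lemma finitely_split_tensor_injective:
  assumes mods: "module R N" "module R F" "module R E" and f: "f \<in> mod_hom R F E"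
    and split: "finitely_split R F E f"
  shows "inj_on (tensor_map R N E f) (carrier (tensor_group R N F))"
  unfolding inj_tensor_map_iff[OF mods f]
proof (intro allI impI)
  fix c :: "'b \<times> 'c \<Rightarrow>\<^sub>0 int"
  assume c: "formal_sum N F c"
    and fc: "push f c \<in> tensor_relations R N E"
  obtain Q P where QP: "relation_pairs R E Q P"
    "\<And>\<phi>. preserves R E F Q P \<phi> \<Longrightarrow> push \<phi> (push f c) \<in> tensor_relations R N F"
    using push_preserves_relations[OF mods(1,3,2) fc] by blast
  let ?T = "snd ` Poly_Mapping.keys c"
  have "finite ?T" "?T \<subseteq> carrier F" using c by auto
  then obtain \<phi> where \<phi>: "preserves R E F Q P \<phi>" "\<forall>x\<in>?T. \<phi> (f x) = x"
    using split QP(1) unfolding finitely_split_def by blast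
  have "push \<phi> (push f c) = c"
    unfolding push_push using \<phi>(2) by (intro push_ident) force
  then show "c \<in> tensor_relations R N F" using QP(2)[OF \<phi>(1)] by simp
qed

text \<open>The linear forms that vanish at \<open>\<xi>\<close> iff \<open>\<xi> z = \<xi> x + \<xi> y\<close> and iff \<open>\<xi> z = r \<xi> x\<close>.\<close>

definition add_form :: "('a, 'x) ring_scheme \<Rightarrow> 'v \<Rightarrow> 'v \<Rightarrow> 'v \<Rightarrow> 'v \<Rightarrow> 'a" where
  "add_form R x y z v = (if v = z then \<one>\<^bsub>R\<^esub> else \<zero>\<^bsub>R\<^esub>) \<ominus>\<^bsub>R\<^esub>
     ((if v = x then \<one>\<^bsub>R\<^esub> else \<zero>\<^bsub>R\<^esub>) \<oplus>\<^bsub>R\<^esub> (if v = y then \<one>\<^bsub>R\<^esub> else \<zero>\<^bsub>R\<^esub>))"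

definition smult_form :: "('a, 'x) ring_scheme \<Rightarrow> 'a \<Rightarrow> 'v \<Rightarrow> 'v \<Rightarrow> 'v \<Rightarrow> 'a" where
  "smult_form R r x z v = (if v = z then \<one>\<^bsub>R\<^esub> else \<zero>\<^bsub>R\<^esub>) \<ominus>\<^bsub>R\<^esub> (if v = x then r else \<zero>\<^bsub>R\<^esub>)"

context module
begin

lemma add_form_closed: "add_form R x y z \<in> V \<rightarrow> carrier R"
  by (auto simp: add_form_def)

lemma smult_form_closed: "r \<in> carrier R \<Longrightarrow> smult_form R r x z \<in> V \<rightarrow> carrier R"
  by (auto simp: smult_form_def)

lemma diff_eq_zero_iff:
  assumes "x \<in> carrier M" "y \<in> carrier M"
  shows "x \<ominus>\<^bsub>M\<^esub> y = \<zero>\<^bsub>M\<^esub> \<longleftrightarrow> x = y"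
  using M.minus_equality[of x "\<ominus>\<^bsub>M\<^esub> y"] assms by (auto simp: a_minus_def M.r_neg)

lemma lincomb_add_form:
  assumes "finite V" "x \<in> V" "y \<in> V" "z \<in> V" "\<xi> \<in> V \<rightarrow> carrier M"
  shows "lincomb M V (add_form R x y z) \<xi> = \<zero>\<^bsub>M\<^esub> \<longleftrightarrow> \<xi> z = \<xi> x \<oplus>\<^bsub>M\<^esub> \<xi> y"
proof -
  have [simp]: "\<xi> x \<in> carrier M" "\<xi> y \<in> carrier M" "\<xi> z \<in> carrier M" using assms by auto
  let ?d = "\<lambda>w v. if v = w then \<one> else \<zero>"
  have d: "?d w \<in> V \<rightarrow> carrier R" for w by auto
  have "lincomb M V (add_form R x y z) \<xi> = lincomb M V (?d z) \<xi> \<ominus>\<^bsub>M\<^esub> lincomb M V (\<lambda>v. ?d x v \<oplus> ?d y v) \<xi>"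
    unfolding add_form_def using assms by (intro lincomb_diff) auto
  also have "lincomb M V (\<lambda>v. ?d x v \<oplus> ?d y v) \<xi> = lincomb M V (?d x) \<xi> \<oplus>\<^bsub>M\<^esub> lincomb M V (?d y) \<xi>"
    using assms by (intro lincomb_add) auto
  finally show ?thesis using assms by (simp add: lincomb_delta diff_eq_zero_iff)
qed

lemma lincomb_smult_form:
  assumes "finite V" "x \<in> V" "z \<in> V" "r \<in> carrier R" "\<xi> \<in> V \<rightarrow> carrier M"
  shows "lincomb M V (smult_form R r x z) \<xi> = \<zero>\<^bsub>M\<^esub> \<longleftrightarrow> \<xi> z = r \<odot>\<^bsub>M\<^esub> \<xi> x"
proof -
  have [simp]: "\<xi> x \<in> carrier M" "\<xi> z \<in> carrier M" using assms by auto
  let ?d = "\<lambda>w r v. if v = w then r else \<zero>"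
  have "lincomb M V (smult_form R r x z) \<xi> = lincomb M V (?d z \<one>) \<xi> \<ominus>\<^bsub>M\<^esub> lincomb M V (?d x r) \<xi>"
    unfolding smult_form_def using assms by (intro lincomb_diff) auto
  then show ?thesis using assms by (simp add: lincomb_delta diff_eq_zero_iff)
qed

end

definition relation_support :: "('a, 'm) module \<Rightarrow> ('m \<times> 'm) set \<Rightarrow> ('a \<times> 'm) set \<Rightarrow> 'm set" where
  "relation_support M Q P = (\<Union>(x, y)\<in>Q. {x, y, x \<oplus>\<^bsub>M\<^esub> y}) \<union> (\<Union>(r, x)\<in>P. {x, r \<odot>\<^bsub>M\<^esub> x})"

lemma relation_support:
  assumes "module R M" "relation_pairs R M Q P"
  shows "finite (relation_support M Q P)" "relation_support M Q P \<subseteq> carrier M"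
proof -
  interpret module R M by fact
  show "finite (relation_support M Q P)" "relation_support M Q P \<subseteq> carrier M"
    using assms(2) by (auto simp: relation_support_def relation_pairs_def)
qed

definition relation_forms ::
  "'a ring \<Rightarrow> ('a, 'm) module \<Rightarrow> ('m \<times> 'm) set \<Rightarrow> ('a \<times> 'm) set \<Rightarrow> ('m \<Rightarrow> 'a) set" where
  "relation_forms R M Q P =
     (\<lambda>(x, y). add_form R x y (x \<oplus>\<^bsub>M\<^esub> y)) ` Q \<union> (\<lambda>(r, x). smult_form R r x (r \<odot>\<^bsub>M\<^esub> x)) ` P"

lemma preserves_iff_relation_forms:
  assumes "module R M" "module R N" "relation_pairs R M Q P"
    and "finite V" "relation_support M Q P \<subseteq> V" "\<phi> \<in> V \<rightarrow> carrier N"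
  shows "(\<forall>a\<in>relation_forms R M Q P. lincomb N V a \<phi> = \<zero>\<^bsub>N\<^esub>) \<longleftrightarrow>
    (\<forall>(x, y)\<in>Q. \<phi> (x \<oplus>\<^bsub>M\<^esub> y) = \<phi> x \<oplus>\<^bsub>N\<^esub> \<phi> y) \<and> (\<forall>(r, x)\<in>P. \<phi> (r \<odot>\<^bsub>M\<^esub> x) = r \<odot>\<^bsub>N\<^esub> \<phi> x)"
proof -
  interpret N: module R N by fact
  have "lincomb N V (add_form R x y (x \<oplus>\<^bsub>M\<^esub> y)) \<phi> = \<zero>\<^bsub>N\<^esub> \<longleftrightarrow> \<phi> (x \<oplus>\<^bsub>M\<^esub> y) = \<phi> x \<oplus>\<^bsub>N\<^esub> \<phi> y"
    if "(x, y) \<in> Q" for x y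
    using that assms by (intro N.lincomb_add_form) (auto simp: relation_support_def)
  moreover have "lincomb N V (smult_form R r x (r \<odot>\<^bsub>M\<^esub> x)) \<phi> = \<zero>\<^bsub>N\<^esub> \<longleftrightarrow> \<phi> (r \<odot>\<^bsub>M\<^esub> x) = r \<odot>\<^bsub>N\<^esub> \<phi> x"
    if "(r, x) \<in> P" for r x
    using that assms by (intro N.lincomb_smult_form) (auto simp: relation_support_def relation_pairs_def)
  ultimately show ?thesis
    unfolding relation_forms_def by (simp add: ball_Un split_beta)
qed

lemma relation_forms:
  assumes "module R M" "relation_pairs R M Q P"
  shows "finite (relation_forms R M Q P)"
    and "a \<in> relation_forms R M Q P \<Longrightarrow> a \<in> V \<rightarrow> carrier R"
proof -
  interpret module R M by fact
  show "finite (relation_forms R M Q P)"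
    using assms(2) by (auto simp: relation_forms_def relation_pairs_def)
  show "a \<in> V \<rightarrow> carrier R" if "a \<in> relation_forms R M Q P"
    using that assms(2) unfolding relation_forms_def relation_pairs_def
    by (auto intro!: funcset_mem[OF add_form_closed] funcset_mem[OF smult_form_closed])
qed

text \<open>
  Over a valuation ring relative divisibility implies purity: a finite set of relations is a finite
  system of linear equations, and such systems can be solved in the submodule.
\<close>

lemma rd_pure_finitely_split:
  fixes R (structure)
  assumes vr: "valuation_ring R" and mod: "module R M" and rd: "rd_pure R S M"
  shows "finitely_split R (M\<lparr>carrier := S\<rparr>) M (\<lambda>x. x)"
  unfolding finitely_split_def
proof (intro allI impI, elim conjE)
  fix Q P T assume QP: "relation_pairs R M Q P" and T: "finite T" "T \<subseteq> carrier (M\<lparr>carrier := S\<rparr>)"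
  interpret module R M by fact
  have sub: "submodule S R M" using rd by (simp add: rd_pure_def)
  note S = submoduleE[OF sub]
  have z: "\<zero>\<^bsub>M\<^esub> \<in> S" by (rule submodule_zero[OF sub])
  define V where "V = relation_support M Q P \<union> T"
  have V: "finite V" "V \<subseteq> carrier M" "relation_support M Q P \<subseteq> V"
    using relation_support[OF mod QP] T S(1) by (auto simp: V_def)
  let ?d = "\<lambda>w v. if v = w then \<one> else \<zero>"
  define J where "J = (\<lambda>a. (a, \<zero>\<^bsub>M\<^esub>)) ` relation_forms R M Q P \<union> (\<lambda>w. (?d w, w)) ` T"
  have "\<exists>\<eta>\<in>V \<rightarrow> S. \<forall>j\<in>J. lincomb M V (fst j) \<eta> = snd j"
  proof (rule rd_pure_linear_system[OF vr mod rd])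
    show "finite J" using relation_forms(1)[OF mod QP] T by (simp add: J_def)
    show "finite V" by fact
    show "fst j \<in> V \<rightarrow> carrier R" if "j \<in> J" for j
    proof -
      consider a where "a \<in> relation_forms R M Q P" "j = (a, \<zero>\<^bsub>M\<^esub>)" | w where "j = (?d w, w)"
        using \<open>j \<in> J\<close> by (auto simp: J_def)
      then show ?thesis
      proof cases
        case 1
        then show ?thesis using relation_forms(2)[OF mod QP 1(1), of V] by simp
      next
        case 2
        then show ?thesis by simp
      qed
    qed
    show "snd \<in> J \<rightarrow> S" using T z by (auto simp: J_def)
    show id: "(\<lambda>x. x) \<in> V \<rightarrow> carrier M" using V by auto
    have "\<forall>a\<in>relation_forms R M Q P. lincomb M V a (\<lambda>x. x) = \<zero>\<^bsub>M\<^esub>"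
      unfolding preserves_iff_relation_forms[OF mod mod QP V(1,3) id] by auto
    moreover have "lincomb M V (?d w) (\<lambda>x. x) = w" if "w \<in> T" for w
      using that V id by (subst lincomb_delta) (auto simp: V_def)
    ultimately show "lincomb M V (fst j) (\<lambda>x. x) = snd j" if "j \<in> J" for j
      using that by (auto simp: J_def)
  qed
  then obtain \<eta> where \<eta>: "\<eta> \<in> V \<rightarrow> S" "\<And>j. j \<in> J \<Longrightarrow> lincomb M V (fst j) \<eta> = snd j" by blast
  have \<eta>M: "\<eta> \<in> V \<rightarrow> carrier M" using \<eta>(1) S(1) by blast
  define \<phi> where "\<phi> x = (if x \<in> V then \<eta> x else \<zero>\<^bsub>M\<^esub>)" for x
  have \<phi>M: "\<phi> \<in> V \<rightarrow> carrier M" using \<eta>M by (auto simp: \<phi>_def)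
  have "lincomb M V a \<phi> = lincomb M V a \<eta>" if "a \<in> V \<rightarrow> carrier R" for a
    using that \<eta>M by (intro lincomb_cong) (auto simp: \<phi>_def)
  then have "\<forall>a\<in>relation_forms R M Q P. lincomb M V a \<phi> = \<zero>\<^bsub>M\<^esub>"
    using \<eta>(2) relation_forms(2)[OF mod QP, of _ V] by (auto simp: J_def)
  then have "preserves R M (M\<lparr>carrier := S\<rparr>) Q P \<phi>"
    unfolding preserves_iff_relation_forms[OF mod mod QP V(1,3) \<phi>M]
    using \<eta>(1) z by (auto simp: preserves_def \<phi>_def)
  moreover have "\<phi> w = w" if w: "w \<in> T" for w
  proof -
    have "lincomb M V (?d w) \<eta> = w" using \<eta>(2)[of "(?d w, w)"] w by (auto simp: J_def)
    moreover have "w \<in> V" "\<eta> w \<in> carrier M" using w \<eta>M by (auto simp: V_def)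
    ultimately show ?thesis using lincomb_delta[OF V(1) \<open>w \<in> V\<close> _ \<eta>M, of "\<one>"] by (simp add: \<phi>_def)
  qed
  ultimately show "\<exists>\<phi>. preserves R M (M\<lparr>carrier := S\<rparr>) Q P \<phi> \<and> (\<forall>x\<in>T. \<phi> x = x)" by blast
qed

text \<open>
  An elementwise form of flatness over a valuation ring: the relations \<open>a m = 0\<close> are consequences
  of relations \<open>a x = 0\<close> in the ring.  A single factorisation \<open>m = x p\<close> has to serve all \<open>a\<close>.
\<close>

definition torsion_flat :: "'a ring \<Rightarrow> ('a, 'm) module \<Rightarrow> bool" where
  "torsion_flat R M \<longleftrightarrow> (\<forall>m\<in>carrier M. \<exists>x\<in>carrier R. \<exists>p\<in>carrier M. m = x \<odot>\<^bsub>M\<^esub> p \<and>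
     (\<forall>a\<in>carrier R. a \<odot>\<^bsub>M\<^esub> m = \<zero>\<^bsub>M\<^esub> \<longrightarrow> a \<otimes>\<^bsub>R\<^esub> x = \<zero>\<^bsub>R\<^esub>))"

text \<open>
  The equational criterion for flatness, for one equation.  Dividing by a pivot \<open>\<alpha>\<close> turns it into
  \<open>\<alpha> z = 0\<close>, and \<open>z = x p\<^sub>0\<close> with \<open>\<alpha> x = 0\<close>.  Replacing the pivot unknown by \<open>p\<^sub>0\<close> and keeping the
  others gives coordinates that satisfy the equation in the ring.
\<close>

lemma torsion_flat_equation:
  fixes R (structure)
  assumes vr: "valuation_ring R" and mod: "module R M" and tf: "torsion_flat R M"
    and V: "finite V" and a: "a \<in> V \<rightarrow> carrier R" and m: "m \<in> V \<rightarrow> carrier M"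
    and eq: "lincomb M V a m = \<zero>\<^bsub>M\<^esub>"
  shows "\<exists>e p. p \<in> V \<rightarrow> carrier M \<and> (\<forall>v\<in>V. e v \<in> V \<rightarrow> carrier R) \<and>
    (\<forall>v\<in>V. m v = lincomb M V (e v) p) \<and>
    (\<forall>w\<in>V. lincomb (regular_module R) V a (\<lambda>v. e v w) = \<zero>)"
proof (cases "V = {}")
  case False
  interpret module R M by fact
  interpret reg: module R "regular_module R"
    by (rule module_regular_module) (rule R.cring_axioms)
  have "finite (a ` V)" "a ` V \<noteq> {}" "a ` V \<subseteq> carrier R" using V a False by auto
  from valuation_ring_least_divisor[OF vr this]
  obtain v0 where v0: "v0 \<in> V" and "\<forall>v\<in>V. \<exists>c\<in>carrier R. a v = a v0 \<otimes> c" by auto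
  then obtain d where d: "\<And>v. v \<in> V \<Longrightarrow> d v \<in> carrier R" and ad: "\<And>v. v \<in> V \<Longrightarrow> a v = a v0 \<otimes> d v"
    by metis
  let ?V = "V - {v0}" and ?\<alpha> = "a v0"
  have \<alpha>: "?\<alpha> \<in> carrier R" and m0: "m v0 \<in> carrier M" using a m v0 by auto
  have dm: "lincomb M ?V d m \<in> carrier M" using d m by (intro lincomb_closed) auto
  have "lincomb M ?V a m = lincomb M ?V (\<lambda>v. ?\<alpha> \<otimes> d v) m"
    using d \<alpha> m ad by (intro lincomb_cong) auto
  also have "\<dots> = ?\<alpha> \<odot>\<^bsub>M\<^esub> lincomb M ?V d m"
    using d \<alpha> m V by (intro lincomb_scale) auto
  finally have "lincomb M V a m = ?\<alpha> \<odot>\<^bsub>M\<^esub> m v0 \<oplus>\<^bsub>M\<^esub> ?\<alpha> \<odot>\<^bsub>M\<^esub> lincomb M ?V d m"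
    using lincomb_remove[OF V v0 a m] by simp
  then have z: "?\<alpha> \<odot>\<^bsub>M\<^esub> (m v0 \<oplus>\<^bsub>M\<^esub> lincomb M ?V d m) = \<zero>\<^bsub>M\<^esub>"
    using \<alpha> m0 dm eq by (simp add: smult_r_distr)
  have "m v0 \<oplus>\<^bsub>M\<^esub> lincomb M ?V d m \<in> carrier M" using m0 dm by simp
  then obtain x p0 where x: "x \<in> carrier R" and p0: "p0 \<in> carrier M"
    and xp: "m v0 \<oplus>\<^bsub>M\<^esub> lincomb M ?V d m = x \<odot>\<^bsub>M\<^esub> p0" and \<alpha>x: "?\<alpha> \<otimes> x = \<zero>"
    using tf \<alpha> z unfolding torsion_flat_def by metis
  define p where "p v = (if v = v0 then p0 else m v)" for v
  \<comment> \<open>the pivot unknown is \<open>x p0\<close> minus the combination of the others, which stay coordinates\<close>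
  define e where "e v w = (if v = v0 then (if w = v0 then x else \<ominus> d w)
    else (if w = v then \<one> else \<zero>))" for v w
  have p: "p \<in> V \<rightarrow> carrier M" using p0 m by (auto simp: p_def)
  have e: "e v \<in> V \<rightarrow> carrier R" for v using x d by (auto simp: e_def)
  have "m v = lincomb M V (e v) p" if v: "v \<in> V" for v
  proof (cases "v = v0")
    case True
    have "lincomb M ?V (e v0) p = lincomb M ?V (\<lambda>w. \<ominus> d w) m"
      using d m by (intro lincomb_cong) (auto simp: e_def p_def)
    also have "\<dots> = \<ominus>\<^bsub>M\<^esub> lincomb M ?V d m"
      using d m V by (intro lincomb_minus) auto
    finally have "lincomb M V (e v0) p = (m v0 \<oplus>\<^bsub>M\<^esub> lincomb M ?V d m) \<oplus>\<^bsub>M\<^esub> \<ominus>\<^bsub>M\<^esub> lincomb M ?V d m"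
      using lincomb_remove[OF V v0 e p] xp by (simp add: e_def p_def)
    then show ?thesis using m0 dm True by (simp add: M.a_assoc M.r_neg)
  next
    case False
    have "m v \<in> carrier M" using m v by auto
    moreover have "lincomb M V (e v) p = lincomb M V (\<lambda>w. if w = v then \<one> else \<zero>) p"
      using False p by (intro lincomb_cong) (auto simp: e_def)
    ultimately show ?thesis using lincomb_delta[OF V v _ p, of "\<one>"] False by (simp add: p_def)
  qed
  moreover have "lincomb (regular_module R) V a (\<lambda>v. e v w) = \<zero>" if w: "w \<in> V" for w
  proof -
    have ew: "(\<lambda>v. e v w) \<in> V \<rightarrow> carrier (regular_module R)" using e w by auto
    have 1: "lincomb (regular_module R) V a (\<lambda>v. e v w) =
        ?\<alpha> \<otimes> e v0 w \<oplus> lincomb (regular_module R) ?V a (\<lambda>v. e v w)"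
      using reg.lincomb_remove[OF V v0 a ew] by simp
    show ?thesis
    proof (cases "w = v0")
      case True
      have "lincomb (regular_module R) ?V a (\<lambda>v. e v w) =
          lincomb (regular_module R) ?V (\<lambda>v. \<zero>) (\<lambda>v. \<one>)"
        unfolding lincomb_def using a True
        by (intro reg.M.finsum_cong') (auto simp: e_def Pi_def)
      also have "\<dots> = \<zero>" using reg.lincomb_zero[of "\<lambda>v. \<one>" ?V "\<lambda>v. \<zero>"] by simp
      finally show ?thesis using 1 True \<alpha>x by (simp add: e_def)
    next
      case False
      have wV: "w \<in> ?V" using w False by simp
      have aw: "a w \<in> carrier R" "d w \<in> carrier R" using a d w by auto
      have "lincomb (regular_module R) ?V a (\<lambda>v. e v w) =
          lincomb (regular_module R) ?V (\<lambda>v. if v = w then a w else \<zero>) (\<lambda>v. \<one>)"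
        unfolding lincomb_def using a False
        by (intro reg.M.finsum_cong') (auto simp: e_def Pi_def)
      also have "\<dots> = a w"
        using reg.lincomb_delta[of ?V w "a w" "\<lambda>v. \<one>"] V wV aw by simp
      finally show ?thesis
        using 1 False ad[OF w] \<alpha> aw by (simp add: e_def R.r_minus R.l_neg)
    qed
  qed
  ultimately show ?thesis using p e by blast
qed (simp add: lincomb_def)

text \<open>
  Several equations are treated one after the other: each is rewritten in the coordinates found for
  the previous ones, and passing to finer coordinates preserves the equations already satisfied.
\<close>

lemma torsion_flat_system:
  fixes R (structure)
  assumes vr: "valuation_ring R" and mod: "module R M" and tf: "torsion_flat R M"
    and V: "finite V" and m: "m \<in> V \<rightarrow> carrier M"
    and J: "finite J" "\<And>a. a \<in> J \<Longrightarrow> a \<in> V \<rightarrow> carrier R"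
    and eq: "\<And>a. a \<in> J \<Longrightarrow> lincomb M V a m = \<zero>\<^bsub>M\<^esub>"
  shows "\<exists>e p. p \<in> V \<rightarrow> carrier M \<and> (\<forall>v\<in>V. e v \<in> V \<rightarrow> carrier R) \<and>
    (\<forall>v\<in>V. m v = lincomb M V (e v) p) \<and>
    (\<forall>a\<in>J. \<forall>w\<in>V. lincomb (regular_module R) V a (\<lambda>v. e v w) = \<zero>)"
  using J eq
proof (induction J rule: finite_induct)
  case empty
  interpret module R M by fact
  let ?e = "\<lambda>v w. if w = v then \<one> else \<zero>"
  have "m v = lincomb M V (?e v) m" if v: "v \<in> V" for v
  proof -
    have "m v \<in> carrier M" using m v by auto
    then show ?thesis using lincomb_delta[OF V v _ m, of "\<one>"] by simp
  qed
  then show ?case using m by (intro exI[of _ ?e] exI[of _ m]) auto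
next
  case (insert a J)
  interpret module R M by fact
  interpret reg: module R "regular_module R"
    by (rule module_regular_module) (rule R.cring_axioms)
  have "\<exists>e p. p \<in> V \<rightarrow> carrier M \<and> (\<forall>v\<in>V. e v \<in> V \<rightarrow> carrier R) \<and>
      (\<forall>v\<in>V. m v = lincomb M V (e v) p) \<and>
      (\<forall>b\<in>J. \<forall>w\<in>V. lincomb (regular_module R) V b (\<lambda>v. e v w) = \<zero>)"
    by (rule insert.IH) (simp_all add: insert.prems)
  then obtain e p where p: "p \<in> V \<rightarrow> carrier M" and e0: "\<forall>v\<in>V. e v \<in> V \<rightarrow> carrier R"
    and me0: "\<forall>v\<in>V. m v = lincomb M V (e v) p"
    and eJ0: "\<forall>b\<in>J. \<forall>w\<in>V. lincomb (regular_module R) V b (\<lambda>v. e v w) = \<zero>"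
    by (elim exE conjE) (rule that)
  note e = e0[rule_format] and me = me0[rule_format] and eJ = eJ0[rule_format]
  have a: "a \<in> V \<rightarrow> carrier R" using insert.prems(1) by simp
  define \<alpha> where "\<alpha> w = lincomb (regular_module R) V a (\<lambda>v. e v w)" for w
  have ew: "(\<lambda>v. e v w) \<in> V \<rightarrow> carrier (regular_module R)" if "w \<in> V" for w
    using e that by fastforce
  have \<alpha>: "\<alpha> \<in> V \<rightarrow> carrier R"
    using reg.lincomb_closed[OF a ew] by (auto simp: \<alpha>_def)
  have "lincomb M V \<alpha> p = lincomb M V a (\<lambda>v. lincomb M V (e v) p)"
    unfolding \<alpha>_def by (rule lincomb_swap[OF mod V V a e p, symmetric])
  also have "\<dots> = lincomb M V a m"
    using a m me by (intro lincomb_cong) auto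
  also have "\<dots> = \<zero>\<^bsub>M\<^esub>" using insert.prems(2) by simp
  finally have "lincomb M V \<alpha> p = \<zero>\<^bsub>M\<^esub>" .
  from torsion_flat_equation[OF vr mod tf V \<alpha> p this]
  obtain e' p' where p': "p' \<in> V \<rightarrow> carrier M" and "\<forall>v\<in>V. e' v \<in> V \<rightarrow> carrier R"
    and "\<forall>v\<in>V. p v = lincomb M V (e' v) p'"
    and "\<forall>w\<in>V. lincomb (regular_module R) V \<alpha> (\<lambda>v. e' v w) = \<zero>"
    by (elim exE conjE) (rule that)
  then have e': "e' v \<in> V \<rightarrow> carrier R" and pe: "p v = lincomb M V (e' v) p'"
    and \<alpha>e: "lincomb (regular_module R) V \<alpha> (\<lambda>u. e' u v) = \<zero>" if "v \<in> V" for v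
    using that by simp_all
  have ew': "(\<lambda>v. e' v w) \<in> V \<rightarrow> carrier (regular_module R)" if "w \<in> V" for w
    using e' that by fastforce
  define f where "f v w = lincomb (regular_module R) V (e v) (\<lambda>u. e' u w)" for v w
  have f: "f v \<in> V \<rightarrow> carrier R" if "v \<in> V" for v
    using reg.lincomb_closed[OF e[OF that] ew'] by (auto simp: f_def)
  have "m v = lincomb M V (f v) p'" if v: "v \<in> V" for v
  proof -
    have "m v = lincomb M V (e v) (\<lambda>u. lincomb M V (e' u) p')"
      unfolding me[OF v] using e[OF v] p' e' pe p
      by (intro lincomb_cong[symmetric]) auto
    then show ?thesis unfolding f_def using lincomb_swap[OF mod V V e[OF v] e' p'] by simp
  qed
  moreover have "lincomb (regular_module R) V b (\<lambda>v. f v w) = \<zero>"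
    if b: "b \<in> insert a J" and w: "w \<in> V" for b w
  proof -
    have bR: "b \<in> V \<rightarrow> carrier R" using b insert.prems(1) by blast
    have "lincomb (regular_module R) V b (\<lambda>v. f v w) =
        lincomb (regular_module R) V (\<lambda>u. lincomb (regular_module R) V b (\<lambda>v. e v u)) (\<lambda>u. e' u w)"
      unfolding f_def by (rule lincomb_swap[OF reg.module_axioms V V bR e ew'[OF w]])
    also have "\<dots> = \<zero>"
    proof (cases "b = a")
      case True
      then show ?thesis using \<alpha>e[OF w] by (simp add: \<alpha>_def[abs_def])
    next
      case False
      then have "b \<in> J" using b by simp
      then show ?thesis using reg.lincomb_zero[OF ew'[OF w]] eJ by auto
    qed
    finally show ?thesis .
  qed
  ultimately show ?case using p' f by blast
qed

text \<open>
  A finite piece of a torsion flat module factors through a free module of finite rank: the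
  functions \<open>e _ w\<close> are its coordinates and \<open>p\<close> maps its basis to the module.
\<close>

lemma torsion_flat_coordinates:
  fixes R (structure) and M :: "('a, 'm) module"
  assumes vr: "valuation_ring R" and mod: "module R M" and tf: "torsion_flat R M"
    and QP: "relation_pairs R M Q P" and T: "finite T" "T \<subseteq> carrier M"
  shows "\<exists>(V :: 'm set) e p. finite V \<and> p \<in> V \<rightarrow> carrier M \<and>
    (\<forall>w\<in>V. preserves R M (regular_module R) Q P (\<lambda>m. e m w)) \<and>
    (\<forall>m\<in>T. m = lincomb M V (e m) p)"
proof -
  interpret module R M by fact
  interpret reg: module R "regular_module R"
    by (rule module_regular_module) (rule R.cring_axioms)
  define V where "V = relation_support M Q P \<union> T"
  have V: "finite V" "V \<subseteq> carrier M" "relation_support M Q P \<subseteq> V"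
    using relation_support[OF mod QP] T by (auto simp: V_def)
  have id: "(\<lambda>x. x) \<in> V \<rightarrow> carrier M" using V by auto
  have "\<forall>a\<in>relation_forms R M Q P. lincomb M V a (\<lambda>x. x) = \<zero>\<^bsub>M\<^esub>"
    unfolding preserves_iff_relation_forms[OF mod mod QP V(1,3) id] by auto
  then have "\<exists>e p. p \<in> V \<rightarrow> carrier M \<and> (\<forall>v\<in>V. e v \<in> V \<rightarrow> carrier R) \<and>
      (\<forall>v\<in>V. v = lincomb M V (e v) p) \<and>
      (\<forall>a\<in>relation_forms R M Q P. \<forall>w\<in>V. lincomb (regular_module R) V a (\<lambda>v. e v w) = \<zero>)"
    by (intro torsion_flat_system[OF vr mod tf V(1) id relation_forms(1)[OF mod QP]]
        relation_forms(2)[OF mod QP]) simp_all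
  then obtain e p where p: "p \<in> V \<rightarrow> carrier M" and e0: "\<forall>v\<in>V. e v \<in> V \<rightarrow> carrier R"
    and ve0: "\<forall>v\<in>V. v = lincomb M V (e v) p"
    and ea0: "\<forall>a\<in>relation_forms R M Q P. \<forall>w\<in>V.
      lincomb (regular_module R) V a (\<lambda>v. e v w) = \<zero>"
    by (elim exE conjE) (rule that)
  note e = e0[rule_format] and ve = ve0[rule_format] and ea = ea0[rule_format]
  define e' where "e' m w = (if m \<in> V then e m w else \<zero>)" for m w
  have e_pres: "preserves R M (regular_module R) Q P (\<lambda>m. e' m w)" if w: "w \<in> V" for w
  proof -
    have e'R: "(\<lambda>m. e' m w) \<in> UNIV \<rightarrow> carrier (regular_module R)"
      using e w by (fastforce simp: e'_def)
    then have e'V: "(\<lambda>m. e' m w) \<in> V \<rightarrow> carrier (regular_module R)" by auto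
    have "lincomb (regular_module R) V a (\<lambda>v. e' v w) = \<zero>" if "a \<in> relation_forms R M Q P" for a
    proof -
      have ew: "(\<lambda>v. e v w) \<in> V \<rightarrow> carrier (regular_module R)" using e w by fastforce
      have "lincomb (regular_module R) V a (\<lambda>v. e' v w) = lincomb (regular_module R) V a (\<lambda>v. e v w)"
        using relation_forms(2)[OF mod QP that, of V] ew
        by (intro reg.lincomb_cong) (auto simp: e'_def)
      then show ?thesis using ea[OF that w] by simp
    qed
    then show ?thesis
      using preserves_iff_relation_forms[OF mod reg.module_axioms QP V(1,3) e'V] e'R
      by (auto simp: preserves_def)
  qed
  have e_coord: "m = lincomb M V (e' m) p" if "m \<in> T" for m
  proof -
    have "m \<in> V" using that by (simp add: V_def)
    then have "e' m = e m" by (auto simp: e'_def)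
    then show ?thesis using ve[OF \<open>m \<in> V\<close>] by simp
  qed
  show ?thesis
    by (intro exI[of _ V] exI[of _ e'] exI[of _ p] conjI ballI V(1) p e_pres e_coord)
qed

section \<open>Quotient modules\<close>

lemma coset_eq_iff:
  assumes "module R M" "submodule K R M" "x \<in> carrier M" "y \<in> carrier M"
  shows "K +>\<^bsub>M\<^esub> x = K +>\<^bsub>M\<^esub> y \<longleftrightarrow> x \<ominus>\<^bsub>M\<^esub> y \<in> K"
proof -
  interpret module R M by fact
  note K = submoduleE[OF assms(2)]
  have sg: "subgroup K (add_monoid M)" using assms(2) by (rule submodule.axioms)
  show ?thesis
  proof
    assume "K +>\<^bsub>M\<^esub> x = K +>\<^bsub>M\<^esub> y"
    moreover have "\<zero>\<^bsub>M\<^esub> \<oplus>\<^bsub>M\<^esub> x \<in> K +>\<^bsub>M\<^esub> x"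
      using submodule_zero[OF assms(2)] K(1) assms(3) by (rule M.a_rcosI)
    ultimately have "x \<in> K +>\<^bsub>M\<^esub> y" using assms by simp
    then obtain k where k: "k \<in> K" "x = k \<oplus>\<^bsub>M\<^esub> y" by (auto simp: a_r_coset_def')
    then have "x \<ominus>\<^bsub>M\<^esub> y = k"
      using K(1) assms(4) by (auto simp: a_minus_def M.a_assoc M.r_neg)
    then show "x \<ominus>\<^bsub>M\<^esub> y \<in> K" using k by simp
  next
    assume *: "x \<ominus>\<^bsub>M\<^esub> y \<in> K"
    have "(x \<ominus>\<^bsub>M\<^esub> y) \<oplus>\<^bsub>M\<^esub> y \<in> K +>\<^bsub>M\<^esub> y" by (rule M.a_rcosI[OF * K(1) assms(4)])
    then have "x \<in> K +>\<^bsub>M\<^esub> y" using assms by (simp add: a_minus_def M.a_assoc M.l_neg)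
    then show "K +>\<^bsub>M\<^esub> x = K +>\<^bsub>M\<^esub> y"
      using M.a_repr_independence[OF _ assms(4) sg] by simp
  qed
qed

lemma carrier_quot_module: "carrier (quot_module M K) = (\<lambda>x. K +>\<^bsub>M\<^esub> x) ` carrier M"
  by (auto simp: quot_module_def A_RCOSETS_def')

lemma zero_quot_module: "\<zero>\<^bsub>quot_module M K\<^esub> = K"
  by (simp add: quot_module_def)

lemma add_quot_module:
  assumes "module R M" "submodule K R M" "x \<in> carrier M" "y \<in> carrier M"
  shows "(K +>\<^bsub>M\<^esub> x) \<oplus>\<^bsub>quot_module M K\<^esub> (K +>\<^bsub>M\<^esub> y) = K +>\<^bsub>M\<^esub> (x \<oplus>\<^bsub>M\<^esub> y)"
proof -
  interpret module R M by fact
  have "abelian_subgroup K M"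
    using submodule.axioms(1)[OF assms(2)] M.abelian_group_axioms
    by (intro abelian_subgroupI3 additive_subgroupI)
  then show ?thesis using assms by (simp add: quot_module_def abelian_subgroup.a_rcos_sum)
qed

lemma smult_quot_module:
  assumes "module R M" "submodule K R M" "r \<in> carrier R" "x \<in> carrier M"
  shows "r \<odot>\<^bsub>quot_module M K\<^esub> (K +>\<^bsub>M\<^esub> x) = K +>\<^bsub>M\<^esub> (r \<odot>\<^bsub>M\<^esub> x)"
proof -
  interpret module R M by fact
  note K = submoduleE[OF assms(2)]
  have 1: "k \<oplus>\<^bsub>M\<^esub> r \<odot>\<^bsub>M\<^esub> (k' \<oplus>\<^bsub>M\<^esub> x) \<in> K +>\<^bsub>M\<^esub> (r \<odot>\<^bsub>M\<^esub> x)" if k: "k \<in> K" "k' \<in> K" for k k'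
  proof -
    have "k \<in> carrier M" "k' \<in> carrier M" using k K(1) by blast+
    then have "k \<oplus>\<^bsub>M\<^esub> r \<odot>\<^bsub>M\<^esub> (k' \<oplus>\<^bsub>M\<^esub> x) = (k \<oplus>\<^bsub>M\<^esub> r \<odot>\<^bsub>M\<^esub> k') \<oplus>\<^bsub>M\<^esub> r \<odot>\<^bsub>M\<^esub> x"
      using assms by (simp add: smult_r_distr M.a_assoc)
    also have "\<dots> \<in> K +>\<^bsub>M\<^esub> (r \<odot>\<^bsub>M\<^esub> x)"
      using k K assms by (intro M.a_rcosI) auto
    finally show ?thesis .
  qed
  have 2: "k \<oplus>\<^bsub>M\<^esub> r \<odot>\<^bsub>M\<^esub> x \<in> K <+>\<^bsub>M\<^esub> ((\<lambda>x. r \<odot>\<^bsub>M\<^esub> x) ` (K +>\<^bsub>M\<^esub> x))" if "k \<in> K" for k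
  proof -
    have "x \<in> K +>\<^bsub>M\<^esub> x"
      using M.a_rcosI[OF submodule_zero[OF assms(2)] K(1) assms(4)] assms by simp
    then show ?thesis using that by (auto simp: set_add_def')
  qed
  from 1 2 show ?thesis
    by (auto simp: quot_module_def set_add_def' a_r_coset_def')
qed

lemma quot_module:
  assumes "module R M" "submodule K R M"
  shows "module R (quot_module M K)"
proof -
  interpret module R M by fact
  note add = add_quot_module[OF assms] and smult = smult_quot_module[OF assms]
  have zero: "\<zero>\<^bsub>quot_module M K\<^esub> = K +>\<^bsub>M\<^esub> \<zero>\<^bsub>M\<^esub>"
    using submoduleE(1)[OF assms(2)] by (simp add: zero_quot_module)
  show ?thesis
  proof (rule moduleI)
    show "abelian_group (quot_module M K)"
    proof (rule abelian_groupI)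
      show "\<exists>y\<in>carrier (quot_module M K). y \<oplus>\<^bsub>quot_module M K\<^esub> x = \<zero>\<^bsub>quot_module M K\<^esub>"
        if x: "x \<in> carrier (quot_module M K)" for x
      proof -
        obtain x' where x': "x' \<in> carrier M" "x = K +>\<^bsub>M\<^esub> x'" using x by (auto simp: carrier_quot_module)
        have "(K +>\<^bsub>M\<^esub> (\<ominus>\<^bsub>M\<^esub> x')) \<oplus>\<^bsub>quot_module M K\<^esub> x = \<zero>\<^bsub>quot_module M K\<^esub>"
          using x' by (simp add: add zero M.l_neg)
        then show ?thesis using x' by (auto simp: carrier_quot_module)
      qed
    qed (auto simp: carrier_quot_module add zero M.a_ac)
  qed (auto simp: carrier_quot_module add smult R.cring_axioms smult_l_distr smult_r_distr smult_assoc1)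
qed

lemma quot_proj:
  assumes "module R M" "submodule K R M"
  shows "(\<lambda>x. K +>\<^bsub>M\<^esub> x) \<in> mod_hom R M (quot_module M K)"
    and "x \<in> carrier M \<Longrightarrow> K +>\<^bsub>M\<^esub> x = \<zero>\<^bsub>quot_module M K\<^esub> \<longleftrightarrow> x \<in> K"
proof -
  interpret module R M by fact
  show "(\<lambda>x. K +>\<^bsub>M\<^esub> x) \<in> mod_hom R M (quot_module M K)"
    by (rule mod_homI) (auto simp: carrier_quot_module add_quot_module[OF assms] smult_quot_module[OF assms])
  show "K +>\<^bsub>M\<^esub> x = \<zero>\<^bsub>quot_module M K\<^esub> \<longleftrightarrow> x \<in> K" if "x \<in> carrier M"
    using coset_eq_iff[OF assms that M.zero_closed] that submoduleE(1)[OF assms(2)]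
      M.minus_equality[of "\<zero>\<^bsub>M\<^esub>" "\<zero>\<^bsub>M\<^esub>"]
    by (simp add: zero_quot_module a_minus_def)
qed

lemma mod_hom_image_submodule:
  assumes "module R M" "module R N" "f \<in> mod_hom R M N"
  shows "submodule (f ` carrier M) R N"
proof -
  interpret M: module R M by fact
  interpret N: module R N by fact
  note f = mod_homD[OF assms(3)]
  show ?thesis
  proof (rule N.submoduleI)
    show "\<zero>\<^bsub>N\<^esub> \<in> f ` carrier M"
      using mod_hom_zero[OF assms] by (metis M.M.zero_closed image_eqI)
    show "\<ominus>\<^bsub>N\<^esub> a \<in> f ` carrier M" if "a \<in> f ` carrier M" for a
      using that by (auto simp: mod_hom_minus[OF assms, symmetric])
    show "a \<oplus>\<^bsub>N\<^esub> b \<in> f ` carrier M" if "a \<in> f ` carrier M" "b \<in> f ` carrier M" for a b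
      using that by (auto simp: f(2)[symmetric])
    show "a \<odot>\<^bsub>N\<^esub> x \<in> f ` carrier M" if "a \<in> carrier R" "x \<in> f ` carrier M" for a x
      using that by (auto simp: f(3)[symmetric])
  qed (use f in auto)
qed

section \<open>Faithful flatness from coordinates\<close>

text \<open>The homomorphism \<open>M \<otimes> N \<rightarrow> N\<close>, \<open>m \<otimes> y \<mapsto> e m y\<close>, on representatives.\<close>

definition contract ::
  "('a, 'm) module \<Rightarrow> ('a, 'n) module \<Rightarrow> ('m \<Rightarrow> 'a) \<Rightarrow> ('m \<times> 'n \<Rightarrow>\<^sub>0 int) \<Rightarrow> 'n" where
  "contract M N e = (SOME \<theta>. \<theta> \<in> hom (free_Abelian_group (carrier M \<times> carrier N)) (add_monoid N) \<and>
     (\<forall>m\<in>carrier M. \<forall>y\<in>carrier N. \<theta> (frag_of (m, y)) = e m \<odot>\<^bsub>N\<^esub> y))"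

lemma contract:
  assumes "module R N" "e \<in> carrier M \<rightarrow> carrier R"
  shows "contract M N e \<in> hom (free_Abelian_group (carrier M \<times> carrier N)) (add_monoid N)"
    and "m \<in> carrier M \<Longrightarrow> y \<in> carrier N \<Longrightarrow> contract M N e (frag_of (m, y)) = e m \<odot>\<^bsub>N\<^esub> y"
proof -
  interpret module R N by fact
  have "(\<lambda>(m, y). e m \<odot>\<^bsub>N\<^esub> y) ` (carrier M \<times> carrier N) \<subseteq> carrier (add_monoid N)"
    using assms by auto
  from comm_group.free_Abelian_group_universal[OF M.a_comm_group this]
  obtain \<theta> where "\<theta> \<in> hom (free_Abelian_group (carrier M \<times> carrier N)) (add_monoid N)"
    "\<And>x. x \<in> carrier M \<times> carrier N \<Longrightarrow> \<theta> (frag_of x) = (case x of (m, y) \<Rightarrow> e m \<odot>\<^bsub>N\<^esub> y)" by blast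
  then have "\<exists>\<theta>. \<theta> \<in> hom (free_Abelian_group (carrier M \<times> carrier N)) (add_monoid N) \<and>
     (\<forall>m\<in>carrier M. \<forall>y\<in>carrier N. \<theta> (frag_of (m, y)) = e m \<odot>\<^bsub>N\<^esub> y)"
    by (intro exI[of _ \<theta>]) auto
  from someI_ex[OF this]
  show "contract M N e \<in> hom (free_Abelian_group (carrier M \<times> carrier N)) (add_monoid N)"
    "m \<in> carrier M \<Longrightarrow> y \<in> carrier N \<Longrightarrow> contract M N e (frag_of (m, y)) = e m \<odot>\<^bsub>N\<^esub> y"
    unfolding contract_def by blast+
qed

lemma contract_simps:
  assumes "module R N" "e \<in> carrier M \<rightarrow> carrier R"
  shows "contract M N e 0 = \<zero>\<^bsub>N\<^esub>"
    and "formal_sum M N c \<Longrightarrow> contract M N e c \<in> carrier N"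
    and "formal_sum M N c \<Longrightarrow>
      formal_sum M N d \<Longrightarrow>
      contract M N e (c - d) = contract M N e c \<ominus>\<^bsub>N\<^esub> contract M N e d"
proof -
  interpret module R N by fact
  interpret h: group_hom "free_Abelian_group (carrier M \<times> carrier N)" "add_monoid N" "contract M N e"
    using contract(1)[OF assms] M.a_group by (simp add: group_hom_def group_hom_axioms_def)
  show "contract M N e 0 = \<zero>\<^bsub>N\<^esub>" using h.hom_one by simp
  show "contract M N e c \<in> carrier N" if "formal_sum M N c" for c
    using h.hom_closed[of c] that by simp
  show "contract M N e (c - d) = contract M N e c \<ominus>\<^bsub>N\<^esub> contract M N e d"
    if c: "formal_sum M N c" and d: "formal_sum M N d"
  proof -
    have "contract M N e (c + (- d)) = contract M N e c \<oplus>\<^bsub>N\<^esub> contract M N e (- d)"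
      using h.hom_mult[of c "- d"] c d by simp
    also have "contract M N e (- d) = \<ominus>\<^bsub>N\<^esub> contract M N e d"
      using h.hom_inv[of d] d by (simp add: a_inv_def)
    finally show ?thesis by (simp add: a_minus_def)
  qed
qed

text \<open>
  What is needed of \<open>e\<close> for \<open>m \<otimes> y \<mapsto> e m y\<close> to be well defined.  The condition only concerns the
  action on \<open>N\<close>: representatives of residue classes are admitted if \<open>N\<close> is killed by the ideal.
\<close>

definition acts_additively ::
  "'a ring \<Rightarrow> ('a, 'm) module \<Rightarrow> ('a, 'n) module \<Rightarrow> ('m \<times> 'm) set \<Rightarrow> ('a \<times> 'm) set \<Rightarrow> ('m \<Rightarrow> 'a) \<Rightarrow> bool" where
  "acts_additively R M N Q P e \<longleftrightarrow> e \<in> carrier M \<rightarrow> carrier R \<and>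
     (\<forall>(x, x')\<in>Q. \<forall>y\<in>carrier N. e (x \<oplus>\<^bsub>M\<^esub> x') \<odot>\<^bsub>N\<^esub> y = e x \<odot>\<^bsub>N\<^esub> y \<oplus>\<^bsub>N\<^esub> e x' \<odot>\<^bsub>N\<^esub> y) \<and>
     (\<forall>(r, x)\<in>P. \<forall>y\<in>carrier N. e (r \<odot>\<^bsub>M\<^esub> x) \<odot>\<^bsub>N\<^esub> y = e x \<odot>\<^bsub>N\<^esub> (r \<odot>\<^bsub>N\<^esub> y))"

lemma acts_additively_mono:
  "acts_additively R M N Q P e \<Longrightarrow> Q' \<subseteq> Q \<Longrightarrow> P' \<subseteq> P \<Longrightarrow> acts_additively R M N Q' P' e"
  unfolding acts_additively_def by blast

lemma preserves_acts_additively: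
  assumes "module R M" "module R N" "relation_pairs R M Q P" "preserves R M (regular_module R) Q P e"
  shows "acts_additively R M N Q P e"
proof -
  interpret N: module R N by fact
  have e: "e x \<in> carrier R" if "x \<in> carrier M" for x using assms(4) that by (auto simp: preserves_def)
  have "e (x \<oplus>\<^bsub>M\<^esub> x') \<odot>\<^bsub>N\<^esub> y = e x \<odot>\<^bsub>N\<^esub> y \<oplus>\<^bsub>N\<^esub> e x' \<odot>\<^bsub>N\<^esub> y"
    if "(x, x') \<in> Q" "y \<in> carrier N" for x x' y
  proof -
    have "e (x \<oplus>\<^bsub>M\<^esub> x') = e x \<oplus>\<^bsub>R\<^esub> e x'" "x \<in> carrier M" "x' \<in> carrier M"
      using that assms(3,4) by (auto simp: preserves_def relation_pairs_def)
    then show ?thesis using e that by (simp add: N.smult_l_distr)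
  qed
  moreover have "e (r \<odot>\<^bsub>M\<^esub> x) \<odot>\<^bsub>N\<^esub> y = e x \<odot>\<^bsub>N\<^esub> (r \<odot>\<^bsub>N\<^esub> y)"
    if "(r, x) \<in> P" "y \<in> carrier N" for r x y
  proof -
    have "e (r \<odot>\<^bsub>M\<^esub> x) = r \<otimes>\<^bsub>R\<^esub> e x" "r \<in> carrier R" "x \<in> carrier M"
      using that assms(3,4) by (auto simp: preserves_def relation_pairs_def)
    then show ?thesis using e that by (simp add: N.smult_assoc1[symmetric] N.R.m_comm)
  qed
  ultimately show ?thesis using e by (auto simp: acts_additively_def)
qed

text \<open>
  The dependence on finitely many relations in the first factor, dual to
  \<open>push_preserves_relations\<close>.
\<close>

lemma contract_relations:
  assumes mods: "module R M" "module R N" and c: "c \<in> tensor_relations R M N"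
  shows "\<exists>Q P. relation_pairs R M Q P \<and>
    (\<forall>e. acts_additively R M N Q P e \<longrightarrow> contract M N e c = \<zero>\<^bsub>N\<^esub>)"
proof -
  interpret MN: module_pair R M N using mods by (simp add: module_pair_def)
  have eR: "e \<in> carrier M \<rightarrow> carrier R" if "acts_additively R M N Q P e" for Q P e
    using that by (simp add: acts_additively_def)
  show ?thesis
    using c
  proof (induction rule: MN.relations_induct)
    case zero
    show ?case using contract_simps(1)[OF mods(2) eR]
      by (intro exI[of _ "{}"]) (auto simp: relation_pairs_def)
  next
    case (diff c d)
    obtain Q P where 1: "relation_pairs R M Q P"
      "\<And>e. acts_additively R M N Q P e \<Longrightarrow> contract M N e c = \<zero>\<^bsub>N\<^esub>" using diff(3) by blast
    obtain Q' P' where 2: "relation_pairs R M Q' P'"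
      "\<And>e. acts_additively R M N Q' P' e \<Longrightarrow> contract M N e d = \<zero>\<^bsub>N\<^esub>" using diff(4) by blast
    have "contract M N e (c - d) = \<zero>\<^bsub>N\<^esub>"
      if e: "acts_additively R M N (Q \<union> Q') (P \<union> P') e" for e
      using 1(2)[OF acts_additively_mono[OF e]] 2(2)[OF acts_additively_mono[OF e]]
        contract_simps(3)[OF mods(2) eR[OF e] MN.relations_keys[OF diff(1)] MN.relations_keys[OF diff(2)]]
      by (simp add: a_minus_def)
    then show ?case using relation_pairs_Un[OF 1(1) 2(1)] by blast
  next
    case (add_left x x' y)
    have "contract M N e (frag_of (x \<oplus>\<^bsub>M\<^esub> x', y) - frag_of (x, y) - frag_of (x', y)) = \<zero>\<^bsub>N\<^esub>"
      if "acts_additively R M N {(x, x')} {} e" for e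
    proof -
      note e = eR[OF that]
      have ex: "e (x \<oplus>\<^bsub>M\<^esub> x') \<odot>\<^bsub>N\<^esub> y = e x \<odot>\<^bsub>N\<^esub> y \<oplus>\<^bsub>N\<^esub> e x' \<odot>\<^bsub>N\<^esub> y"
        using that add_left(3) by (simp add: acts_additively_def)
      have exR: "e x \<in> carrier R" "e x' \<in> carrier R" using e add_left by auto
      have k: "formal_sum M N (frag_of (x \<oplus>\<^bsub>M\<^esub> x', y) - frag_of (x, y) :: _ \<Rightarrow>\<^sub>0 int)"
        using add_left by (intro keys_diff_subset) auto
      show ?thesis
        using add_left exR k
        by (simp add: contract_simps(3)[OF mods(2) e] contract(2)[OF mods(2) e] ex
            a_minus_def MN.N.M.a_ac MN.N.M.r_neg MN.N.M.r_neg1 MN.N.M.r_neg2)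
    qed
    then show ?case
      using add_left by (intro exI[of _ "{(x, x')}"] exI[of _ "{}"]) (auto simp: relation_pairs_def)
  next
    case (add_right x y y')
    have "contract M N e (frag_of (x, y \<oplus>\<^bsub>N\<^esub> y') - frag_of (x, y) - frag_of (x, y')) = \<zero>\<^bsub>N\<^esub>"
      if "acts_additively R M N {} {} e" for e
    proof -
      note e = eR[OF that]
      have exR: "e x \<in> carrier R" using e add_right by auto
      have k: "formal_sum M N (frag_of (x, y \<oplus>\<^bsub>N\<^esub> y') - frag_of (x, y) :: _ \<Rightarrow>\<^sub>0 int)"
        using add_right by (intro keys_diff_subset) auto
      show ?thesis
        using add_right exR k
        by (simp add: contract_simps(3)[OF mods(2) e] contract(2)[OF mods(2) e] MN.N.smult_r_distr
            a_minus_def MN.N.M.a_ac MN.N.M.r_neg MN.N.M.r_neg1 MN.N.M.r_neg2)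
    qed
    then show ?case
      using add_right by (intro exI[of _ "{}"]) (auto simp: relation_pairs_def)
  next
    case (smult r x y)
    have "contract M N e (frag_of (r \<odot>\<^bsub>M\<^esub> x, y) - frag_of (x, r \<odot>\<^bsub>N\<^esub> y)) = \<zero>\<^bsub>N\<^esub>"
      if "acts_additively R M N {} {(r, x)} e" for e
    proof -
      note e = eR[OF that]
      have exR: "e x \<in> carrier R" using e smult by auto
      have ex: "e (r \<odot>\<^bsub>M\<^esub> x) \<odot>\<^bsub>N\<^esub> y = e x \<odot>\<^bsub>N\<^esub> (r \<odot>\<^bsub>N\<^esub> y)"
        using that smult(3) by (simp add: acts_additively_def)
      show ?thesis
        using smult exR
        by (simp add: contract_simps(3)[OF mods(2) e] contract(2)[OF mods(2) e] ex
            a_minus_def MN.N.M.r_neg)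
    qed
    then show ?case
      using smult by (intro exI[of _ "{}"] exI[of _ "{(r, x)}"]) (auto simp: relation_pairs_def)
  qed
qed

lemma contract_push:
  assumes mods: "module R B" "module R C" and g: "g \<in> mod_hom R B C" and e: "e \<in> carrier M \<rightarrow> carrier R"
    and c: "formal_sum M B c"
  shows "g (contract M B e c) = contract M C e (push g c)"
  using c
proof (induction rule: free_Abelian_group_induct[consumes 1, case_names zero diff generator])
  case zero
  show ?case using mod_hom_zero[OF mods g] by (simp add: contract_simps[OF mods(1) e] contract_simps[OF mods(2) e])
next
  case (diff c d)
  interpret B: module R B by fact
  have cl: "contract M B e c \<in> carrier B" "contract M B e d \<in> carrier B"
    using contract_simps(2)[OF mods(1) e] diff by blast+
  have k: "formal_sum M C (push g c)" "formal_sum M C (push g d)"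
    using keys_push[OF diff(1)] keys_push[OF diff(2)] mod_homD(1)[OF g] by blast+
  have "g (contract M B e (c - d)) = g (contract M B e c) \<ominus>\<^bsub>C\<^esub> g (contract M B e d)"
    using cl mod_homD(2)[OF g] mod_hom_minus[OF mods g]
    by (simp add: contract_simps(3)[OF mods(1) e diff(1,2)] a_minus_def)
  then show ?case using diff(3,4) contract_simps(3)[OF mods(2) e k] by simp
next
  case (generator a)
  obtain m y where a: "a = (m, y)" "m \<in> carrier M" "y \<in> carrier B" using generator by auto
  then have "e m \<in> carrier R" using e by auto
  then show ?case
    using a mod_homD[OF g] by (simp add: contract(2)[OF mods(1) e] contract(2)[OF mods(2) e])
qed

context module_pair
begin

lemma relations_sum:
  "finite V \<Longrightarrow> (\<And>v. v \<in> V \<Longrightarrow> c v \<in> tensor_relations R M N) \<Longrightarrow> sum c V \<in> tensor_relations R M N"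
  by (induction V rule: finite_induct) (auto intro: relations_zero relations_add)

lemma relation_diff_right:
  assumes "x \<in> carrier M" "y \<in> carrier N" "y' \<in> carrier N"
  shows "frag_of (x, y \<ominus>\<^bsub>N\<^esub> y') - (frag_of (x, y) - frag_of (x, y')) \<in> tensor_relations R M N"
proof -
  have "(y \<ominus>\<^bsub>N\<^esub> y') \<oplus>\<^bsub>N\<^esub> y' = y" using assms by (simp add: a_minus_def N.M.a_assoc N.M.l_neg)
  then have "frag_of (x, y) - frag_of (x, y \<ominus>\<^bsub>N\<^esub> y') - frag_of (x, y') \<in> tensor_relations R M N"
    using relation_add_right[of x "y \<ominus>\<^bsub>N\<^esub> y'" y'] assms by simp
  from relations_minus[OF this] show ?thesis by (simp add: algebra_simps)
qed

lemma relation_lincomb: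
  assumes "finite V" "a \<in> V \<rightarrow> carrier R" "p \<in> V \<rightarrow> carrier M" "y \<in> carrier N"
  shows "frag_of (lincomb M V a p, y) - (\<Sum>w\<in>V. frag_of (p w, a w \<odot>\<^bsub>N\<^esub> y)) \<in> tensor_relations R M N"
  using assms(1-3)
proof (induction V rule: finite_induct)
  case empty
  then show ?case using relation_zero_left[OF assms(4)] by (simp add: M.lincomb_empty)
next
  case (insert w V)
  have [simp]: "a w \<in> carrier R" "p w \<in> carrier M" "lincomb M V a p \<in> carrier M"
    using insert.prems by (auto intro: M.lincomb_closed)
  have 1: "frag_of (a w \<odot>\<^bsub>M\<^esub> p w \<oplus>\<^bsub>M\<^esub> lincomb M V a p, y) - frag_of (a w \<odot>\<^bsub>M\<^esub> p w, y) -
      frag_of (lincomb M V a p, y) \<in> tensor_relations R M N"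
    using assms(4) by (intro relation_add_left) auto
  have 2: "frag_of (a w \<odot>\<^bsub>M\<^esub> p w, y) - frag_of (p w, a w \<odot>\<^bsub>N\<^esub> y) \<in> tensor_relations R M N"
    using assms(4) by (intro relation_smult) auto
  have "frag_of (lincomb M V a p, y) - (\<Sum>w\<in>V. frag_of (p w, a w \<odot>\<^bsub>N\<^esub> y)) \<in> tensor_relations R M N"
    using insert by auto
  from relations_add[OF relations_add[OF 1 2] this] show ?case
    using insert by (simp add: M.lincomb_insert algebra_simps)
qed

end

text \<open>
  An element killed in \<open>M \<otimes> C\<close> is killed because of finitely many relations in \<open>M\<close>.  In
  coordinates that respect these relations it becomes a finite family of elements of the kernel
  of \<open>g\<close>.
\<close>

lemma torsion_flat_exact:
  assumes vr: "valuation_ring R" and mods: "module R M" "module R A" "module R B" "module R C"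
    and tf: "torsion_flat R M" and f: "f \<in> mod_hom R A B" and g: "g \<in> mod_hom R B C"
    and ex: "f ` carrier A = {y \<in> carrier B. g y = \<zero>\<^bsub>C\<^esub>}"
  shows "exact_at (tensor_group R M A) (tensor_group R M B) (tensor_group R M C)
    (tensor_map R M B f) (tensor_map R M C g)"
  unfolding exact_at_tensor_iff[OF mods f g]
proof (intro allI impI iffI)
  interpret MB: module_pair R M B using mods by (simp add: module_pair_def)
  interpret MC: module_pair R M C using mods by (simp add: module_pair_def)
  fix c :: "'b \<times> 'd \<Rightarrow>\<^sub>0 int"
  assume c: "formal_sum M B c"
  {
    assume "\<exists>d. formal_sum M A d \<and> c - push f d \<in> tensor_relations R M B"
    then obtain d where d: "formal_sum M A d"
      "c - push f d \<in> tensor_relations R M B" by blast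
    have "push g (push f d) \<in> tensor_relations R M C"
      unfolding push_push using ex by (intro MC.push_null[OF d(1)]) blast
    then show "push g c \<in> tensor_relations R M C"
      using MC.relations_add[OF push_relations[OF mods(1,3,4) g d(2)], of "push g (push f d)"] by simp
  }
  assume gc: "push g c \<in> tensor_relations R M C"
  obtain Q P where QP: "relation_pairs R M Q P"
    and kill: "\<And>e. preserves R M (regular_module R) Q P e \<Longrightarrow> contract M C e (push g c) = \<zero>\<^bsub>C\<^esub>"
    using contract_relations[OF mods(1,4) gc] preserves_acts_additively[OF mods(1,4)] by blast
  define T where "T = fst ` Poly_Mapping.keys c"
  have T: "finite T" "T \<subseteq> carrier M" "Poly_Mapping.keys c \<subseteq> T \<times> carrier B"
    using c by (auto simp: T_def intro!: image_eqI)
  obtain V :: "'b set" and e p where V: "finite V" and p: "p \<in> V \<rightarrow> carrier M"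
    and e0: "\<forall>w\<in>V. preserves R M (regular_module R) Q P (\<lambda>m. e m w)"
    and ep: "\<forall>m\<in>T. m = lincomb M V (e m) p"
    using torsion_flat_coordinates[OF vr mods(1) tf QP T(1,2)] by (elim exE conjE) (rule that)
  have e: "(\<lambda>m. e m w) \<in> carrier M \<rightarrow> carrier R" if "w \<in> V" for w
    using e0 that by (simp add: preserves_def)
  define b where "b w = contract M B (\<lambda>m. e m w)" for w
  have bB: "b w c \<in> carrier B" if "w \<in> V" "formal_sum M B c" for w c
    unfolding b_def by (rule contract_simps(2)[OF mods(3) e[OF that(1)] that(2)])
  have "b w c \<in> f ` carrier A" if w: "w \<in> V" for w
    unfolding ex using bB[OF w c] contract_push[OF mods(3,4) g e[OF w] c] kill e0 w
    by (simp add: b_def)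
  then have "\<forall>w\<in>V. \<exists>a\<in>carrier A. f a = b w c" by (metis imageE)
  then obtain a where a: "\<And>w. w \<in> V \<Longrightarrow> a w \<in> carrier A" "\<And>w. w \<in> V \<Longrightarrow> f (a w) = b w c"
    by metis
  \<comment> \<open>every element supported on \<open>T\<close> is recovered from its coordinates\<close>
  have recover: "c' - (\<Sum>w\<in>V. frag_of (p w, b w c')) \<in> tensor_relations R M B"
    if "Poly_Mapping.keys c' \<subseteq> T \<times> carrier B" for c'
    using that
  proof (induction rule: free_Abelian_group_induct[consumes 1, case_names zero diff generator])
    case zero
    have "(\<Sum>w\<in>V. frag_of (p w, b w 0)) \<in> tensor_relations R M B"
      using p contract_simps(1)[OF mods(3) e]
      by (intro MB.relations_sum[OF V]) (auto simp: b_def intro: MB.relation_zero_right)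
    from MB.relations_minus[OF this] show ?case by simp
  next
    case (diff c' d')
    have k: "formal_sum M B c'" "formal_sum M B d'"
      using diff(1,2) T(2) by blast+
    have "(\<Sum>w\<in>V. frag_of (p w, b w (c' - d')) - (frag_of (p w, b w c') - frag_of (p w, b w d')))
        \<in> tensor_relations R M B"
    proof (rule MB.relations_sum[OF V])
      fix w assume w: "w \<in> V"
      have "b w (c' - d') = b w c' \<ominus>\<^bsub>B\<^esub> b w d'"
        unfolding b_def by (rule contract_simps(3)[OF mods(3) e[OF w] k])
      then show "frag_of (p w, b w (c' - d')) - (frag_of (p w, b w c') - frag_of (p w, b w d'))
          \<in> tensor_relations R M B"
        using MB.relation_diff_right[of "p w" "b w c'" "b w d'"] p w bB[OF w] k by auto
    qed
    from MB.relations_diff[OF MB.relations_diff[OF diff(3,4)] this[unfolded sum_subtractf]]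
    show ?case by (simp add: algebra_simps)
  next
    case (generator x)
    then obtain m y where x: "x = (m, y)" "m \<in> T" "y \<in> carrier B" by auto
    have mM: "m \<in> carrier M" using x T(2) by blast
    have "e m \<in> V \<rightarrow> carrier R" using e mM by auto
    from MB.relation_lincomb[OF V this p x(3)]
    have "frag_of (m, y) - (\<Sum>w\<in>V. frag_of (p w, e m w \<odot>\<^bsub>B\<^esub> y)) \<in> tensor_relations R M B"
      using ep x(2) by metis
    moreover have "b w (frag_of x) = e m w \<odot>\<^bsub>B\<^esub> y" if "w \<in> V" for w
      unfolding b_def x(1) by (rule contract(2)[OF mods(3) e[OF that] mM x(3)])
    ultimately show ?case by (simp add: x(1))
  qed
  let ?d = "\<Sum>w\<in>V. frag_of (p w, a w)"
  have "formal_sum M A ?d"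
  proof -
    have "?d \<in> carrier (free_Abelian_group (carrier M \<times> carrier A))"
      using p a(1) by (intro sum_closed_free_Abelian_group) auto
    then show ?thesis by simp
  qed
  moreover have "push f ?d = (\<Sum>w\<in>V. frag_of (p w, b w c))"
    using V a(2) by (simp add: push_def frag_extend_sum)
  ultimately show "\<exists>d. formal_sum M A d \<and>
      c - push f d \<in> tensor_relations R M B"
    using recover[OF T(3)] by metis
qed

text \<open>
  A torsion-free cyclic submodule \<open>R u\<close> that is pure in \<open>M\<close> makes \<open>u \<otimes> _\<close> injective: a
  finite partial retraction of \<open>M\<close> onto \<open>R u\<close> contracts \<open>u \<otimes> y\<close> to \<open>y\<close>.
\<close>

lemma pure_generator_tensor_injective:
  fixes R (structure)
  assumes vr: "valuation_ring R" and mods: "module R M" "module R N"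
    and u: "u \<in> carrier M" and tfree: "\<And>r. r \<in> carrier R \<Longrightarrow> r \<odot>\<^bsub>M\<^esub> u = \<zero>\<^bsub>M\<^esub> \<Longrightarrow> r = \<zero>"
    and rd: "rd_pure R ((\<lambda>r. r \<odot>\<^bsub>M\<^esub> u) ` carrier R) M"
    and y: "y \<in> carrier N" and rel: "frag_of (u, y) \<in> tensor_relations R M N"
  shows "y = \<zero>\<^bsub>N\<^esub>"
proof -
  interpret M: module R M by fact
  interpret N: module R N by fact
  let ?S = "(\<lambda>r. r \<odot>\<^bsub>M\<^esub> u) ` carrier R"
  have inj: "r = s" if "r \<in> carrier R" "s \<in> carrier R" "r \<odot>\<^bsub>M\<^esub> u = s \<odot>\<^bsub>M\<^esub> u" for r s
  proof -
    have "(r \<ominus> s) \<odot>\<^bsub>M\<^esub> u = \<zero>\<^bsub>M\<^esub>"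
      using that u by (simp add: a_minus_def M.smult_l_distr M.smult_l_minus M.M.r_neg)
    then show ?thesis using tfree[of "r \<ominus> s"] that by simp
  qed
  obtain Q P where QP: "relation_pairs R M Q P"
    and kill: "\<And>e. preserves R M (regular_module R) Q P e \<Longrightarrow> contract M N e (frag_of (u, y)) = \<zero>\<^bsub>N\<^esub>"
    using contract_relations[OF mods rel] preserves_acts_additively[OF mods] by blast
  have uS: "u \<in> ?S" using u by (intro image_eqI[of _ _ "\<one>"]) auto
  then have "\<exists>\<phi>. preserves R M (M\<lparr>carrier := ?S\<rparr>) Q P \<phi> \<and> (\<forall>x\<in>{u}. \<phi> x = x)"
    using QP
    by (intro rd_pure_finitely_split[OF vr mods(1) rd, unfolded finitely_split_def, rule_format]) simp
  then obtain \<phi> where \<phi>: "preserves R M (M\<lparr>carrier := ?S\<rparr>) Q P \<phi>" "\<phi> u = u"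
    by (elim exE conjE) (rule that, assumption, simp)
  have "\<forall>m\<in>carrier M. \<exists>r\<in>carrier R. \<phi> m = r \<odot>\<^bsub>M\<^esub> u"
    using \<phi>(1) by (auto simp: preserves_def Pi_def)
  then obtain e where e: "\<And>m. m \<in> carrier M \<Longrightarrow> e m \<in> carrier R"
    "\<And>m. m \<in> carrier M \<Longrightarrow> \<phi> m = e m \<odot>\<^bsub>M\<^esub> u" by metis
  have "preserves R M (regular_module R) Q P e"
    unfolding preserves_def
  proof (intro conjI ballI)
    show "e \<in> carrier M \<rightarrow> carrier (regular_module R)" using e by auto
    show "case z of (x, y) \<Rightarrow> e (x \<oplus>\<^bsub>M\<^esub> y) = e x \<oplus>\<^bsub>regular_module R\<^esub> e y" if "z \<in> Q" for z
    proof -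
      obtain x y where z: "z = (x, y)" "x \<in> carrier M" "y \<in> carrier M"
        using \<open>z \<in> Q\<close> QP by (auto simp: relation_pairs_def)
      have "\<phi> (x \<oplus>\<^bsub>M\<^esub> y) = \<phi> x \<oplus>\<^bsub>M\<^esub> \<phi> y" using \<phi>(1) \<open>z \<in> Q\<close> z by (auto simp: preserves_def)
      then have "e (x \<oplus>\<^bsub>M\<^esub> y) = e x \<oplus> e y"
        using z e u by (intro inj) (auto simp: M.smult_l_distr)
      then show ?thesis using z by simp
    qed
    show "case z of (r, x) \<Rightarrow> e (r \<odot>\<^bsub>M\<^esub> x) = r \<odot>\<^bsub>regular_module R\<^esub> e x" if "z \<in> P" for z
    proof -
      obtain r x where z: "z = (r, x)" "r \<in> carrier R" "x \<in> carrier M"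
        using \<open>z \<in> P\<close> QP by (auto simp: relation_pairs_def)
      have "\<phi> (r \<odot>\<^bsub>M\<^esub> x) = r \<odot>\<^bsub>M\<^esub> \<phi> x" using \<phi>(1) \<open>z \<in> P\<close> z by (auto simp: preserves_def)
      then have "e (r \<odot>\<^bsub>M\<^esub> x) = r \<otimes> e x"
        using z e u by (intro inj) (auto simp: M.smult_assoc1)
      then show ?thesis using z by simp
    qed
  qed
  then have "contract M N e (frag_of (u, y)) = \<zero>\<^bsub>N\<^esub>" by (rule kill)
  moreover have "e u = \<one>" using e[OF u] \<phi>(2) u by (intro inj) auto
  moreover have "e \<in> carrier M \<rightarrow> carrier R" using e by auto
  ultimately show ?thesis using contract(2)[OF mods(2), of e M u y] u y by simp
qed

text \<open>
  Exactness is preserved by \<open>torsion_flat_exact\<close>.  It is reflected because \<open>u \<otimes> _\<close> is injective: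
  \<open>g (f a) = 0\<close> follows from \<open>u \<otimes> g (f a) = 0\<close>, and an element of the kernel of \<open>g\<close> lies in the image
  of \<open>f\<close> because \<open>u \<otimes> _\<close> sends its class modulo that image to zero.
\<close>

lemma faithfully_flatI:
  assumes vr: "valuation_ring R" and mod: "module R M" and tf: "torsion_flat R M"
    and u: "u \<in> carrier M" and tfree: "\<And>r. r \<in> carrier R \<Longrightarrow> r \<odot>\<^bsub>M\<^esub> u = \<zero>\<^bsub>M\<^esub> \<Longrightarrow> r = \<zero>\<^bsub>R\<^esub>"
    and rd: "rd_pure R ((\<lambda>r. r \<odot>\<^bsub>M\<^esub> u) ` carrier R) M"
  shows "faithfully_flat TYPE('v) R M"
  unfolding faithfully_flat_def
proof (intro conjI allI impI, fact mod, elim conjE)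
  fix A B C :: "('a, 'v) module" and f g
  assume mods: "module R A" "module R B" "module R C"
    and f: "f \<in> mod_hom R A B" and g: "g \<in> mod_hom R B C"
  interpret MA: module_pair R M A using mod mods by (simp add: module_pair_def)
  interpret MB: module_pair R M B using mod mods by (simp add: module_pair_def)
  interpret MC: module_pair R M C using mod mods by (simp add: module_pair_def)
  have ex_iff: "exact_at (add_monoid A) (add_monoid B) (add_monoid C) f g \<longleftrightarrow>
      f ` carrier A = {y \<in> carrier B. g y = \<zero>\<^bsub>C\<^esub>}"
    by (simp add: exact_at_def kernel_def)
  show "exact_at (add_monoid A) (add_monoid B) (add_monoid C) f g \<longleftrightarrow>
      exact_at (tensor_group R M A) (tensor_group R M B) (tensor_group R M C)
        (tensor_map R M B f) (tensor_map R M C g)"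
  proof
    assume "exact_at (add_monoid A) (add_monoid B) (add_monoid C) f g"
    then show "exact_at (tensor_group R M A) (tensor_group R M B) (tensor_group R M C)
        (tensor_map R M B f) (tensor_map R M C g)"
      unfolding ex_iff by (rule torsion_flat_exact[OF vr mod mods tf f g])
  next
    assume "exact_at (tensor_group R M A) (tensor_group R M B) (tensor_group R M C)
        (tensor_map R M B f) (tensor_map R M C g)"
    then have ex: "push g c \<in> tensor_relations R M C \<longleftrightarrow>
        (\<exists>d. formal_sum M A d \<and> c - push f d \<in> tensor_relations R M B)"
      if "formal_sum M B c" for c
      using that unfolding exact_at_tensor_iff[OF mod mods f g] by blast
    have "g (f a) = \<zero>\<^bsub>C\<^esub>" if a: "a \<in> carrier A" for a
    proof (rule pure_generator_tensor_injective[OF vr mod mods(3) u tfree rd])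
      have "\<exists>d. formal_sum M A d \<and>
          frag_of (u, f a) - push f d \<in> tensor_relations R M B"
        using a u MB.relations_zero by (intro exI[of _ "frag_of (u, a)"]) auto
      then have "push g (frag_of (u, f a)) \<in> tensor_relations R M C"
        using a u mod_homD(1)[OF f] by (subst ex) auto
      then show "frag_of (u, g (f a)) \<in> tensor_relations R M C" by simp
    qed (use a mod_homD(1)[OF f] mod_homD(1)[OF g] in auto)
    moreover have "b \<in> f ` carrier A" if b: "b \<in> carrier B" "g b = \<zero>\<^bsub>C\<^esub>" for b
    proof -
      let ?K = "f ` carrier A"
      have K: "submodule ?K R B" by (rule mod_hom_image_submodule[OF mods(1,2) f])
      note pr = quot_proj[OF mods(2) K]
      have qm: "module R (quot_module B ?K)" by (rule quot_module[OF mods(2) K])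
      interpret MQ: module_pair R M "quot_module B ?K" using mod qm by (simp add: module_pair_def)
      have "push g (frag_of (u, b)) \<in> tensor_relations R M C"
        using b u by (simp add: MC.relation_zero_right)
      then obtain d where d: "formal_sum M A d"
        "frag_of (u, b) - push f d \<in> tensor_relations R M B"
        using ex[of "frag_of (u, b)"] b u by auto
      have "push (\<lambda>x. ?K +>\<^bsub>B\<^esub> x) (push f d) \<in> tensor_relations R M (quot_module B ?K)"
        unfolding push_push using pr(2) mod_homD(1)[OF f] by (intro MQ.push_null[OF d(1)]) auto
      from MQ.relations_add[OF push_relations[OF mod mods(2) qm pr(1) d(2)] this]
      have "frag_of (u, ?K +>\<^bsub>B\<^esub> b) \<in> tensor_relations R M (quot_module B ?K)" by simp
      then have "?K +>\<^bsub>B\<^esub> b = \<zero>\<^bsub>quot_module B ?K\<^esub>"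
        using b by (intro pure_generator_tensor_injective[OF vr mod qm u tfree rd])
          (auto simp: carrier_quot_module)
      then show ?thesis using pr(2)[OF b(1)] by simp
    qed
    ultimately show "exact_at (add_monoid A) (add_monoid B) (add_monoid C) f g"
      unfolding ex_iff using mod_homD(1)[OF f] by blast
  qed
qed

section \<open>Purity\<close>

text \<open>
  Right exactness holds for every sequence, so only injectivity depends on the splittings.  They do
  not refer to a test module, hence the universe \<open>'u\<close> is arbitrary.
\<close>

lemma finitely_split_pure_exact:
  assumes mods: "module R F" "module R E" "module R G"
    and f: "f \<in> mod_hom R F E" and g: "g \<in> mod_hom R E G"
    and inj: "inj_on f (carrier F)" and im: "f ` carrier F = {x \<in> carrier E. g x = \<zero>\<^bsub>G\<^esub>}"
    and surj: "g ` carrier E = carrier G" and split: "finitely_split R F E f"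
  shows "pure_exact TYPE('u) R F E G f g"
proof -
  have "short_exact (tensor_group R N F) (tensor_group R N E) (tensor_group R N G)
      (tensor_map R N E f) (tensor_map R N G g)" if N: "module R N" for N :: "('a, 'u) module"
    unfolding short_exact_def
    using finitely_split_tensor_injective[OF N mods(1,2) f split]
      tensor_right_exact[OF N mods f g im surj] by blast
  moreover have "short_exact (add_monoid F) (add_monoid E) (add_monoid G) f g"
    using inj im surj by (simp add: short_exact_def exact_at_def kernel_def)
  ultimately show ?thesis using mods f g by (simp add: pure_exact_def)
qed

lemma inclusion_mod_hom:
  assumes "submodule S R M"
  shows "(\<lambda>x. x) \<in> mod_hom R (M\<lparr>carrier := S\<rparr>) M"
  using subgroup.subset[OF submodule.axioms(1)[OF assms]] by (intro mod_homI) auto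

lemma rd_pure_pure_submodule:
  assumes vr: "valuation_ring R" and mod: "module R M" and rd: "rd_pure R S M"
  shows "pure_submodule TYPE('u) R S M"
proof -
  interpret module R M by fact
  have sub: "submodule S R M" using rd by (simp add: rd_pure_def)
  note pr = quot_proj[OF mod sub]
  have "pure_exact TYPE('u) R (M\<lparr>carrier := S\<rparr>) M (quot_module M S) (\<lambda>x. x) (\<lambda>x. S +>\<^bsub>M\<^esub> x)"
  proof (rule finitely_split_pure_exact)
    show "module R (M\<lparr>carrier := S\<rparr>)" by (rule submodule.submodule_is_module[OF sub mod])
    show "module R M" by fact
    show "module R (quot_module M S)" by (rule quot_module[OF mod sub])
    show "(\<lambda>x. x) \<in> mod_hom R (M\<lparr>carrier := S\<rparr>) M" by (rule inclusion_mod_hom[OF sub])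
    show "(\<lambda>x. S +>\<^bsub>M\<^esub> x) \<in> mod_hom R M (quot_module M S)" by (rule pr)
    show "(\<lambda>x. x) ` carrier (M\<lparr>carrier := S\<rparr>) = {x \<in> carrier M. S +>\<^bsub>M\<^esub> x = \<zero>\<^bsub>quot_module M S\<^esub>}"
      using pr(2) submoduleE(1)[OF sub] by auto
    show "(\<lambda>x. S +>\<^bsub>M\<^esub> x) ` carrier M = carrier (quot_module M S)"
      by (simp add: carrier_quot_module)
    show "finitely_split R (M\<lparr>carrier := S\<rparr>) M (\<lambda>x. x)"
      by (rule rd_pure_finitely_split[OF vr mod rd])
  qed simp
  then show ?thesis using sub by (simp add: pure_submodule_def)
qed

lemma mod_hom_factor:
  assumes mods: "module R P" "module R E" "module R G"
    and p: "p \<in> mod_hom R P E" "p ` carrier P = carrier E" and q: "q \<in> mod_hom R P G"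
    and ker: "\<And>x. x \<in> carrier P \<Longrightarrow> p x = \<zero>\<^bsub>E\<^esub> \<Longrightarrow> q x = \<zero>\<^bsub>G\<^esub>"
  obtains g where "g \<in> mod_hom R E G" "\<And>x. x \<in> carrier P \<Longrightarrow> g (p x) = q x"
proof -
  interpret P: module R P by fact
  interpret E: module R E by fact
  interpret G: module R G by fact
  note ph = mod_homD[OF p(1)] and qh = mod_homD[OF q]
  define s where "s = inv_into (carrier P) p"
  have s: "s e \<in> carrier P" "p (s e) = e" if "e \<in> carrier E" for e
    using that p(2) by (auto simp: s_def inv_into_into f_inv_into_f)
  have eq: "q x = q y" if xy: "x \<in> carrier P" "y \<in> carrier P" "p x = p y" for x y
  proof -
    have "p (x \<oplus>\<^bsub>P\<^esub> \<ominus>\<^bsub>P\<^esub> y) = \<zero>\<^bsub>E\<^esub>"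
      using xy ph by (simp add: mod_hom_minus[OF mods(1,2) p(1)] E.M.r_neg)
    then have "q (x \<oplus>\<^bsub>P\<^esub> \<ominus>\<^bsub>P\<^esub> y) = \<zero>\<^bsub>G\<^esub>" using xy by (intro ker) auto
    then have "q x \<ominus>\<^bsub>G\<^esub> q y = \<zero>\<^bsub>G\<^esub>"
      using xy qh by (simp add: mod_hom_minus[OF mods(1,3) q] a_minus_def)
    then show ?thesis using xy qh by (simp add: G.diff_eq_zero_iff)
  qed
  show thesis
  proof (rule that[of "\<lambda>e. q (s e)"])
    show "q (s (p x)) = q x" if "x \<in> carrier P" for x
      using that s[OF ph(1)[OF that]] by (intro eq) auto
    show "(\<lambda>e. q (s e)) \<in> mod_hom R E G"
    proof (rule mod_homI)
      show "q (s x) \<in> carrier G" if "x \<in> carrier E" for x using s(1)[OF that] qh(1) by blast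
      show "q (s (x \<oplus>\<^bsub>E\<^esub> y)) = q (s x) \<oplus>\<^bsub>G\<^esub> q (s y)" if "x \<in> carrier E" "y \<in> carrier E" for x y
        unfolding qh(2)[OF s(1) s(1), OF that, symmetric] using that s ph by (intro eq) auto
      show "q (s (r \<odot>\<^bsub>E\<^esub> x)) = r \<odot>\<^bsub>G\<^esub> q (s x)" if "r \<in> carrier R" "x \<in> carrier E" for r x
        unfolding qh(3)[OF that(1) s(1)[OF that(2)], symmetric] using that s ph by (intro eq) auto
    qed
  qed
qed

text \<open>
  A quotient realised inside a given type by an injective map \<open>\<iota>\<close> from the set of cosets.
\<close>

definition embedded_quot :: "('m set \<Rightarrow> 'u) \<Rightarrow> ('a, 'm) module \<Rightarrow> 'm set \<Rightarrow> ('a, 'u) module" where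
  "embedded_quot \<iota> M K =
     \<lparr>carrier = \<iota> ` carrier (quot_module M K), monoid.mult = undefined, one = undefined,
      ring.zero = \<iota> K, add = (\<lambda>x y. \<iota> (inv_into UNIV \<iota> x \<oplus>\<^bsub>quot_module M K\<^esub> inv_into UNIV \<iota> y)),
      smult = (\<lambda>r x. \<iota> (r \<odot>\<^bsub>quot_module M K\<^esub> inv_into UNIV \<iota> x))\<rparr>"

lemma embedded_quot:
  assumes \<iota>: "inj \<iota>" and mod: "module R M" and K: "submodule K R M"
  shows "module R (embedded_quot \<iota> M K)"
    and "(\<lambda>x. \<iota> (K +>\<^bsub>M\<^esub> x)) \<in> mod_hom R M (embedded_quot \<iota> M K)"
    and "(\<lambda>x. \<iota> (K +>\<^bsub>M\<^esub> x)) ` carrier M = carrier (embedded_quot \<iota> M K)"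
    and "x \<in> carrier M \<Longrightarrow> \<iota> (K +>\<^bsub>M\<^esub> x) = \<zero>\<^bsub>embedded_quot \<iota> M K\<^esub> \<longleftrightarrow> x \<in> K"
proof -
  let ?Q = "quot_module M K"
  interpret Q: module R ?Q by (rule quot_module[OF mod K])
  have simps: "carrier (embedded_quot \<iota> M K) = \<iota> ` carrier ?Q"
    "\<zero>\<^bsub>embedded_quot \<iota> M K\<^esub> = \<iota> \<zero>\<^bsub>?Q\<^esub>"
    "\<iota> x \<oplus>\<^bsub>embedded_quot \<iota> M K\<^esub> \<iota> y = \<iota> (x \<oplus>\<^bsub>?Q\<^esub> y)"
    "r \<odot>\<^bsub>embedded_quot \<iota> M K\<^esub> \<iota> x = \<iota> (r \<odot>\<^bsub>?Q\<^esub> x)" for x y r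
    using \<iota> by (simp_all add: embedded_quot_def zero_quot_module)
  show "module R (embedded_quot \<iota> M K)"
  proof (rule moduleI)
    show "abelian_group (embedded_quot \<iota> M K)"
    proof (rule abelian_groupI)
      show "\<exists>y\<in>carrier (embedded_quot \<iota> M K). y \<oplus>\<^bsub>embedded_quot \<iota> M K\<^esub> x = \<zero>\<^bsub>embedded_quot \<iota> M K\<^esub>"
        if x: "x \<in> carrier (embedded_quot \<iota> M K)" for x
      proof -
        obtain x' where x': "x = \<iota> x'" "x' \<in> carrier ?Q" using x by (auto simp: simps)
        then show ?thesis
          by (auto simp: simps Q.M.l_neg intro!: bexI[of _ "\<ominus>\<^bsub>?Q\<^esub> x'"])
      qed
    qed (auto simp: simps Q.M.a_ac)
  qed (auto simp: simps Q.R.cring_axioms Q.smult_l_distr Q.smult_r_distr Q.smult_assoc1)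
  note pr = quot_proj[OF mod K]
  show "(\<lambda>x. \<iota> (K +>\<^bsub>M\<^esub> x)) \<in> mod_hom R M (embedded_quot \<iota> M K)"
    using mod_homD[OF pr(1)] by (intro mod_homI) (auto simp: simps)
  show "(\<lambda>x. \<iota> (K +>\<^bsub>M\<^esub> x)) ` carrier M = carrier (embedded_quot \<iota> M K)"
    by (auto simp: simps carrier_quot_module)
  show "\<iota> (K +>\<^bsub>M\<^esub> x) = \<zero>\<^bsub>embedded_quot \<iota> M K\<^esub> \<longleftrightarrow> x \<in> K" if "x \<in> carrier M"
    using pr(2)[OF that] \<iota> by (simp add: simps inj_eq)
qed

text \<open>
  Testing purity on the cyclic module \<open>R / t R\<close>: if \<open>s = t y\<close> then \<open>1 \<otimes> s\<close> vanishes in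
  \<open>R / t R \<otimes> M\<close>, hence in \<open>R / t R \<otimes> S\<close>, which is \<open>S / t S\<close>.
\<close>

lemma pure_submodule_rd_pure:
  fixes R :: "'a ring" (structure) and M :: "('a, 'm) module" and \<iota> :: "'a set \<Rightarrow> 'u"
  assumes \<iota>: "inj \<iota>" and mod: "module R M" and pure: "pure_submodule TYPE('u) R S M"
  shows "rd_pure R S M"
proof -
  interpret M: module R M by fact
  have sub: "submodule S R M" using pure by (simp add: pure_submodule_def)
  note S = M.submoduleE[OF sub]
  have modS: "module R (M\<lparr>carrier := S\<rparr>)" by (rule submodule.submodule_is_module[OF sub mod])
  interpret S: module R "M\<lparr>carrier := S\<rparr>" by fact
  have modR: "module R (regular_module R)" by (rule module_regular_module) (rule M.R.cring_axioms)
  have "\<exists>y'\<in>S. t \<odot>\<^bsub>M\<^esub> y' = t \<odot>\<^bsub>M\<^esub> y"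
    if t: "t \<in> carrier R" and y: "y \<in> carrier M" and tyS: "t \<odot>\<^bsub>M\<^esub> y \<in> S" for t y
  proof -
    define K where "K = (\<lambda>r. t \<otimes> r) ` carrier (regular_module R)"
    have "(\<lambda>r. t \<otimes> r) \<in> mod_hom R (regular_module R) (regular_module R)"
      using t by (intro mod_homI) (auto simp: M.R.r_distr M.R.m_lcomm)
    then have K: "submodule K R (regular_module R)"
      unfolding K_def by (rule mod_hom_image_submodule[OF modR modR])
    define N where "N = embedded_quot \<iota> (regular_module R) K"
    define q where "q r = \<iota> (K +>\<^bsub>regular_module R\<^esub> r)" for r
    note eq = embedded_quot[OF \<iota> modR K, folded N_def q_def[abs_def] q_def]
    note qh = mod_homD[OF eq(2)]
    have modN: "module R N" by (rule eq)
    define tS where "tS = (\<lambda>x. t \<odot>\<^bsub>M\<^esub> x) ` carrier (M\<lparr>carrier := S\<rparr>)"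
    have "(\<lambda>x. t \<odot>\<^bsub>M\<^esub> x) \<in> mod_hom R (M\<lparr>carrier := S\<rparr>) (M\<lparr>carrier := S\<rparr>)"
      using t S(1,4) subsetD[OF S(1)]
      by (intro mod_homI) (auto simp: M.smult_r_distr M.smult_assoc1[symmetric] M.R.m_comm)
    then have tS: "submodule tS R (M\<lparr>carrier := S\<rparr>)"
      unfolding tS_def by (rule mod_hom_image_submodule[OF modS modS])
    define W where "W = quot_module (M\<lparr>carrier := S\<rparr>) tS"
    define \<pi> where "\<pi> x = tS +>\<^bsub>M\<lparr>carrier := S\<rparr>\<^esub> x" for x
    note pr = quot_proj[OF modS tS, folded W_def \<pi>_def[abs_def] \<pi>_def]
    have modW: "module R W" unfolding W_def by (rule quot_module[OF modS tS])
    interpret NM: module_pair R N M using modN mod by (simp add: module_pair_def)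
    interpret NW: module_pair R N W using modN modW by (simp add: module_pair_def)
    let ?s = "t \<odot>\<^bsub>M\<^esub> y" and ?n = "q \<one>"
    have n: "?n \<in> carrier N" by (rule qh(1)) simp
    have "t \<odot>\<^bsub>N\<^esub> ?n = q t" using qh(3)[of t "\<one>"] t by simp
    also have "\<dots> = \<zero>\<^bsub>N\<^esub>"
    proof -
      have "t \<in> K" unfolding K_def using t by (intro image_eqI[of _ _ "\<one>"]) auto
      then show ?thesis using eq(4)[of t] t by simp
    qed
    finally have tn: "t \<odot>\<^bsub>N\<^esub> ?n = \<zero>\<^bsub>N\<^esub>" .
    have "frag_of (?n, ?s) \<in> tensor_relations R N M"
      using NM.relations_diff[OF NM.relation_zero_left[OF y] NM.relation_smult[OF t n y]] tn by simp
    then have "push (\<lambda>x. x) (frag_of (?n, ?s)) \<in> tensor_relations R N M" by simp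
    moreover have "inj_on (tensor_map R N M (\<lambda>x. x)) (carrier (tensor_group R N (M\<lparr>carrier := S\<rparr>)))"
      using pure modN by (simp add: pure_submodule_def pure_exact_def short_exact_def)
    moreover have "formal_sum N (M\<lparr>carrier := S\<rparr>) (frag_of (?n, ?s))"
      using n tyS by simp
    ultimately have "frag_of (?n, ?s) \<in> tensor_relations R N (M\<lparr>carrier := S\<rparr>)"
      unfolding inj_tensor_map_iff[OF modN modS mod inclusion_mod_hom[OF sub]] by blast
    from push_relations[OF modN modS modW pr(1) this]
    have rel: "frag_of (?n, \<pi> ?s) \<in> tensor_relations R N W" by simp
    have \<pi>h: "\<pi> x \<in> carrier W" if "x \<in> S" for x using mod_homD(1)[OF pr(1)] that by simp
    have kill: "r \<odot>\<^bsub>W\<^esub> w = r' \<odot>\<^bsub>W\<^esub> w"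
      if r: "r \<in> carrier R" "r' \<in> carrier R" "q r = q r'" and w: "w \<in> carrier W" for r r' w
    proof -
      have "r \<ominus>\<^bsub>regular_module R\<^esub> r' \<in> K"
        using coset_eq_iff[OF modR K, of r r'] r \<iota> by (simp add: q_def inj_eq)
      moreover have "r \<ominus>\<^bsub>regular_module R\<^esub> r' = r \<ominus> r'"
        by (simp add: a_minus_def a_inv_def m_inv_def)
      ultimately obtain k where k: "k \<in> carrier R" "r \<ominus> r' = t \<otimes> k" by (auto simp: K_def)
      obtain x where x: "x \<in> S" "w = \<pi> x"
        using w by (auto simp: W_def \<pi>_def carrier_quot_module)
      have "(r \<ominus> r') \<odot>\<^bsub>W\<^esub> w = \<pi> ((t \<otimes> k) \<odot>\<^bsub>M\<^esub> x)"
        using mod_homD(3)[OF pr(1), of "t \<otimes> k" x] x k t by simp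
      also have "(t \<otimes> k) \<odot>\<^bsub>M\<^esub> x = t \<odot>\<^bsub>M\<^esub> (k \<odot>\<^bsub>M\<^esub> x)"
        using x k t S(1) by (auto intro!: M.smult_assoc1)
      also have "\<pi> \<dots> = \<zero>\<^bsub>W\<^esub>"
      proof -
        have "t \<odot>\<^bsub>M\<^esub> (k \<odot>\<^bsub>M\<^esub> x) \<in> tS" using x k S(4) by (auto simp: tS_def)
        then show ?thesis using pr(2) x k t S(4) by simp
      qed
      finally have "(r \<ominus> r') \<odot>\<^bsub>W\<^esub> w = \<zero>\<^bsub>W\<^esub>" .
      then have "r \<odot>\<^bsub>W\<^esub> w \<ominus>\<^bsub>W\<^esub> r' \<odot>\<^bsub>W\<^esub> w = \<zero>\<^bsub>W\<^esub>"
        using r w by (simp add: a_minus_def NW.N.smult_l_distr NW.N.smult_l_minus)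
      then show ?thesis using r w by (simp add: NW.N.diff_eq_zero_iff)
    qed
    \<comment> \<open>a choice of representatives; it is additive up to \<open>t R\<close>, which kills \<open>W\<close>\<close>
    define e where "e = inv_into (carrier R) q"
    have qR: "q ` carrier R = carrier N" using eq(3) by simp
    have e: "e x \<in> carrier R" "q (e x) = x" if "x \<in> carrier N" for x
      using that qR by (auto simp: e_def inv_into_into f_inv_into_f)
    have acts: "acts_additively R N W Q P e" if QP: "relation_pairs R N Q P" for Q P
    proof -
      have "e (x \<oplus>\<^bsub>N\<^esub> x') \<odot>\<^bsub>W\<^esub> w = e x \<odot>\<^bsub>W\<^esub> w \<oplus>\<^bsub>W\<^esub> e x' \<odot>\<^bsub>W\<^esub> w"
        if x: "x \<in> carrier N" "x' \<in> carrier N" and w: "w \<in> carrier W" for x x' w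
      proof -
        have "e (x \<oplus>\<^bsub>N\<^esub> x') \<odot>\<^bsub>W\<^esub> w = (e x \<oplus> e x') \<odot>\<^bsub>W\<^esub> w"
          using x w e qh(2)[of "e x" "e x'"] by (intro kill) auto
        then show ?thesis using x w e by (simp add: NW.N.smult_l_distr)
      qed
      moreover have "e (r \<odot>\<^bsub>N\<^esub> x) \<odot>\<^bsub>W\<^esub> w = e x \<odot>\<^bsub>W\<^esub> (r \<odot>\<^bsub>W\<^esub> w)"
        if x: "r \<in> carrier R" "x \<in> carrier N" and w: "w \<in> carrier W" for r x w
      proof -
        have "e (r \<odot>\<^bsub>N\<^esub> x) \<odot>\<^bsub>W\<^esub> w = (r \<otimes> e x) \<odot>\<^bsub>W\<^esub> w"
          using x w e qh(3)[of r "e x"] by (intro kill) auto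
        also have "r \<otimes> e x = e x \<otimes> r" using x e by (simp add: M.R.m_comm)
        finally show ?thesis using x w e by (simp add: NW.N.smult_assoc1)
      qed
      ultimately show ?thesis
        using QP e by (auto simp: acts_additively_def relation_pairs_def subset_iff)
    qed
    obtain Q P where "relation_pairs R N Q P"
      "\<forall>e. acts_additively R N W Q P e \<longrightarrow> contract N W e (frag_of (?n, \<pi> ?s)) = \<zero>\<^bsub>W\<^esub>"
      using contract_relations[OF modN modW rel] by blast
    then have "contract N W e (frag_of (?n, \<pi> ?s)) = \<zero>\<^bsub>W\<^esub>" using acts by blast
    then have "e ?n \<odot>\<^bsub>W\<^esub> \<pi> ?s = \<zero>\<^bsub>W\<^esub>"
      using contract(2)[OF modW, of e N ?n "\<pi> ?s"] e n \<pi>h[OF tyS] by auto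
    moreover have "e ?n \<odot>\<^bsub>W\<^esub> \<pi> ?s = \<one> \<odot>\<^bsub>W\<^esub> \<pi> ?s"
      using e[OF n] \<pi>h[OF tyS] by (intro kill) auto
    ultimately have "\<pi> ?s = \<zero>\<^bsub>W\<^esub>" using \<pi>h[OF tyS] by simp
    then have "?s \<in> tS" using pr(2) tyS by simp
    then show ?thesis by (auto simp: tS_def)
  qed
  then show ?thesis using sub by (auto simp: rd_pure_def)
qed

section \<open>Pure-injective modules have limits along filters\<close>

definition function_module :: "('a, 'm) module \<Rightarrow> ('a, 'i \<Rightarrow> 'm) module" where
  "function_module M =
     \<lparr>carrier = {f. \<forall>i. f i \<in> carrier M}, monoid.mult = undefined, one = undefined,
      ring.zero = (\<lambda>_. \<zero>\<^bsub>M\<^esub>), add = (\<lambda>f g i. f i \<oplus>\<^bsub>M\<^esub> g i), smult = (\<lambda>r f i. r \<odot>\<^bsub>M\<^esub> f i)\<rparr>"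

lemma function_module_simps [simp]:
  "f \<in> carrier (function_module M) \<longleftrightarrow> (\<forall>i. f i \<in> carrier M)"
  "\<zero>\<^bsub>function_module M\<^esub> = (\<lambda>_. \<zero>\<^bsub>M\<^esub>)"
  "f \<oplus>\<^bsub>function_module M\<^esub> g = (\<lambda>i. f i \<oplus>\<^bsub>M\<^esub> g i)"
  "r \<odot>\<^bsub>function_module M\<^esub> f = (\<lambda>i. r \<odot>\<^bsub>M\<^esub> f i)"
  by (simp_all add: function_module_def)

lemma module_function_module:
  assumes "module R M"
  shows "module R (function_module M :: ('a, 'i \<Rightarrow> 'm) module)"
proof -
  interpret module R M by fact
  show ?thesis
  proof (rule moduleI)
    show "abelian_group (function_module M :: ('a, 'i \<Rightarrow> 'm) module)"
    proof (rule abelian_groupI)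
      show "\<exists>g\<in>carrier (function_module M). g \<oplus>\<^bsub>function_module M\<^esub> f = \<zero>\<^bsub>function_module M\<^esub>"
        if "f \<in> carrier (function_module M)" for f :: "'i \<Rightarrow> 'm"
        using that by (intro bexI[of _ "\<lambda>i. \<ominus>\<^bsub>M\<^esub> f i"]) (auto simp: M.l_neg)
    qed (auto simp: M.a_ac)
  qed (auto simp: R.cring_axioms smult_l_distr smult_r_distr smult_assoc1)
qed

lemma function_module_minus:
  assumes "module R M" "f \<in> carrier (function_module M)"
  shows "\<ominus>\<^bsub>function_module M\<^esub> f = (\<lambda>i. \<ominus>\<^bsub>M\<^esub> f i)"
proof -
  interpret module R M by fact
  interpret P: module R "function_module M" by (rule module_function_module) fact
  show ?thesis
    using assms(2) by (intro P.M.minus_equality) (auto simp: M.l_neg)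
qed

text \<open>
  The reduced power of \<open>M\<close> along a proper filter: functions modulo those that vanish eventually.
  Finitely many relations between its elements hold at a common index, so evaluating
  representatives at such an index splits the diagonal embedding of \<open>M\<close> as far as these relations
  are concerned.  Thus the diagonal is pure and \<open>M\<close> is a retract, and the retraction sends the
  class of \<open>w\<close> to the limit.  The reduced power and its quotient modulo the diagonal are realised
  in \<open>'u\<close>, where pure-injectivity is tested.
\<close>

lemma pure_injective_filter_limit:
  fixes R :: "'a ring" and M :: "('a, 'm) module" and \<iota> :: "('i \<Rightarrow> 'm) set \<Rightarrow> 'u"
    and F :: "'i filter" and w :: "'i \<Rightarrow> 'm"
  assumes \<iota>: "inj \<iota>" and pinj: "pure_injective TYPE('u) R M"
    and F: "F \<noteq> bot" and w: "\<And>i. w i \<in> carrier M"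
    and A: "A \<subseteq> carrier R \<times> carrier M"
    and cong: "\<And>r m. (r, m) \<in> A \<Longrightarrow> \<forall>\<^sub>F i in F. \<exists>y\<in>carrier M. w i = m \<oplus>\<^bsub>M\<^esub> r \<odot>\<^bsub>M\<^esub> y"
  shows "\<exists>z\<in>carrier M. \<forall>(r, m)\<in>A. \<exists>y\<in>carrier M. z = m \<oplus>\<^bsub>M\<^esub> r \<odot>\<^bsub>M\<^esub> y"
proof -
  have mod: "module R M" using pinj by (simp add: pure_injective_def)
  interpret M: module R M by fact
  define P where "P = (function_module M :: ('a, 'i \<Rightarrow> 'm) module)"
  have modP: "module R P" unfolding P_def by (rule module_function_module[OF mod])
  interpret P: module R P by fact
  have Pc: "f \<in> carrier P \<longleftrightarrow> (\<forall>i. f i \<in> carrier M)" for f by (simp add: P_def)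
  have Pm: "\<ominus>\<^bsub>P\<^esub> f = (\<lambda>i. \<ominus>\<^bsub>M\<^esub> f i)" if "f \<in> carrier P" for f
    using function_module_minus[OF mod] that by (simp add: P_def)
  have Pd: "f \<ominus>\<^bsub>P\<^esub> g = (\<lambda>i. f i \<ominus>\<^bsub>M\<^esub> g i)" if "g \<in> carrier P" for f g
    using Pm[OF that] by (simp add: a_minus_def P_def)
  \<comment> \<open>\<open>K\<close> gives the reduced power, \<open>L\<close> its quotient modulo the diagonal\<close>
  define K where "K = {f \<in> carrier P. \<forall>\<^sub>F i in F. f i = \<zero>\<^bsub>M\<^esub>}"
  define L where "L = {f \<in> carrier P. \<exists>m\<in>carrier M. \<forall>\<^sub>F i in F. f i = m}"
  have K: "submodule K R P"
  proof (rule P.submoduleI)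
    show "\<zero>\<^bsub>P\<^esub> \<in> K" by (simp add: K_def P_def)
    show "\<ominus>\<^bsub>P\<^esub> f \<in> K" if f: "f \<in> K" for f
    proof -
      have "\<forall>\<^sub>F i in F. f i = \<zero>\<^bsub>M\<^esub>" using f by (simp add: K_def)
      then have "\<forall>\<^sub>F i in F. \<ominus>\<^bsub>M\<^esub> f i = \<zero>\<^bsub>M\<^esub>"
        by (rule eventually_mono) (simp add: M.M.minus_equality)
      then show ?thesis using f Pm by (auto simp: K_def Pc)
    qed
    show "f \<oplus>\<^bsub>P\<^esub> g \<in> K" if fg: "f \<in> K" "g \<in> K" for f g
    proof -
      have "\<forall>\<^sub>F i in F. f i = \<zero>\<^bsub>M\<^esub>" "\<forall>\<^sub>F i in F. g i = \<zero>\<^bsub>M\<^esub>" using fg by (simp_all add: K_def)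
      then have "\<forall>\<^sub>F i in F. f i \<oplus>\<^bsub>M\<^esub> g i = \<zero>\<^bsub>M\<^esub>" by eventually_elim simp
      then show ?thesis using fg by (auto simp: K_def P_def)
    qed
    show "r \<odot>\<^bsub>P\<^esub> f \<in> K" if rf: "r \<in> carrier R" "f \<in> K" for r f
    proof -
      have "\<forall>\<^sub>F i in F. f i = \<zero>\<^bsub>M\<^esub>" using rf by (simp add: K_def)
      then have "\<forall>\<^sub>F i in F. r \<odot>\<^bsub>M\<^esub> f i = \<zero>\<^bsub>M\<^esub>" by eventually_elim (use rf in simp)
      then show ?thesis using rf by (auto simp: K_def P_def)
    qed
  qed (auto simp: K_def)
  have L: "submodule L R P"
  proof (rule P.submoduleI)
    show "\<zero>\<^bsub>P\<^esub> \<in> L" by (auto simp: L_def P_def intro!: bexI[of _ "\<zero>\<^bsub>M\<^esub>"])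
    show "\<ominus>\<^bsub>P\<^esub> f \<in> L" if f: "f \<in> L" for f
    proof -
      obtain m where m: "m \<in> carrier M" "\<forall>\<^sub>F i in F. f i = m" using f by (auto simp: L_def)
      then have "\<forall>\<^sub>F i in F. \<ominus>\<^bsub>M\<^esub> f i = \<ominus>\<^bsub>M\<^esub> m" by (auto elim: eventually_mono)
      then show ?thesis using f m(1) Pm by (auto simp: L_def Pc intro!: bexI[of _ "\<ominus>\<^bsub>M\<^esub> m"])
    qed
    show "f \<oplus>\<^bsub>P\<^esub> g \<in> L" if fg: "f \<in> L" "g \<in> L" for f g
    proof -
      obtain m n where m: "m \<in> carrier M" "n \<in> carrier M"
        and ev: "\<forall>\<^sub>F i in F. f i = m" "\<forall>\<^sub>F i in F. g i = n" using fg by (auto simp: L_def)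
      from ev have "\<forall>\<^sub>F i in F. f i \<oplus>\<^bsub>M\<^esub> g i = m \<oplus>\<^bsub>M\<^esub> n" by eventually_elim simp
      moreover have "\<forall>i. f i \<oplus>\<^bsub>M\<^esub> g i \<in> carrier M" using fg by (auto simp: L_def P_def)
      ultimately show ?thesis
        using m by (auto simp: L_def P_def intro!: bexI[of _ "m \<oplus>\<^bsub>M\<^esub> n"])
    qed
    show "r \<odot>\<^bsub>P\<^esub> f \<in> L" if rf: "r \<in> carrier R" "f \<in> L" for r f
    proof -
      obtain m where m: "m \<in> carrier M" "\<forall>\<^sub>F i in F. f i = m" using rf by (auto simp: L_def)
      then have "\<forall>\<^sub>F i in F. r \<odot>\<^bsub>M\<^esub> f i = r \<odot>\<^bsub>M\<^esub> m" by (auto elim: eventually_mono)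
      moreover have "\<forall>i. r \<odot>\<^bsub>M\<^esub> f i \<in> carrier M" using rf by (auto simp: L_def P_def)
      ultimately show ?thesis
        using m(1) rf(1) by (auto simp: L_def P_def intro!: bexI[of _ "r \<odot>\<^bsub>M\<^esub> m"])
    qed
  qed (auto simp: L_def)
  define E where "E = embedded_quot \<iota> P K"
  define p where "p f = \<iota> (K +>\<^bsub>P\<^esub> f)" for f
  note E = embedded_quot[OF \<iota> modP K, folded E_def p_def[abs_def] p_def]
  define G where "G = embedded_quot \<iota> P L"
  define q where "q f = \<iota> (L +>\<^bsub>P\<^esub> f)" for f
  note G = embedded_quot[OF \<iota> modP L, folded G_def q_def[abs_def] q_def]
  interpret E: module R E by (rule E(1))
  note ph = mod_homD[OF E(2)]
  have p_eq: "p f = p g \<longleftrightarrow> (\<forall>\<^sub>F i in F. f i = g i)" if fg: "f \<in> carrier P" "g \<in> carrier P" for f g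
  proof -
    have "p f = p g \<longleftrightarrow> f \<ominus>\<^bsub>P\<^esub> g \<in> K"
      using coset_eq_iff[OF modP K fg] \<iota> by (simp add: p_def inj_eq)
    also have "\<dots> \<longleftrightarrow> (\<forall>\<^sub>F i in F. f i \<ominus>\<^bsub>M\<^esub> g i = \<zero>\<^bsub>M\<^esub>)"
      unfolding K_def using fg by (auto simp: Pd Pc)
    also have "\<dots> \<longleftrightarrow> (\<forall>\<^sub>F i in F. f i = g i)"
      using fg by (intro eventually_cong refl) (auto simp: Pc M.diff_eq_zero_iff intro!: always_eventually)
    finally show ?thesis .
  qed
  define \<delta> where "\<delta> m = p (\<lambda>_. m)" for m
  have \<delta>: "\<delta> \<in> mod_hom R M E"
    unfolding \<delta>_def using ph by (intro mod_homI) (auto simp: P_def)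
  have \<delta>_inj: "m = n" if "m \<in> carrier M" "n \<in> carrier M" "\<delta> m = \<delta> n" for m n
    using that p_eq[of "\<lambda>_. m" "\<lambda>_. n"] F by (simp add: \<delta>_def Pc eventually_const)
  define D where "D = E\<lparr>carrier := \<delta> ` carrier M\<rparr>"
  have subD: "submodule (\<delta> ` carrier M) R E" by (rule mod_hom_image_submodule[OF mod E(1) \<delta>])
  have modD: "module R D" unfolding D_def by (rule submodule.submodule_is_module[OF subD E(1)])
  obtain g where g: "g \<in> mod_hom R E G" "\<And>f. f \<in> carrier P \<Longrightarrow> g (p f) = q f"
  proof (rule mod_hom_factor[OF modP E(1) G(1) E(2,3) G(2)])
    show "q f = \<zero>\<^bsub>G\<^esub>" if f: "f \<in> carrier P" "p f = \<zero>\<^bsub>E\<^esub>" for f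
    proof -
      have "f \<in> K" using E(4) f by simp
      then have "f \<in> L" by (auto simp: K_def L_def)
      then show ?thesis using G(4) f by simp
    qed
  qed (rule that)
  have ker: "\<delta> ` carrier M = {x \<in> carrier E. g x = \<zero>\<^bsub>G\<^esub>}"
  proof (intro subset_antisym subsetI)
    fix x assume "x \<in> \<delta> ` carrier M"
    then obtain m where m: "m \<in> carrier M" "x = p (\<lambda>_. m)" by (auto simp: \<delta>_def)
    have mP: "(\<lambda>_. m) \<in> carrier P" using m by (simp add: Pc)
    then have "(\<lambda>_. m) \<in> L" using m by (auto simp: L_def intro!: bexI[of _ m])
    then have "g x = \<zero>\<^bsub>G\<^esub>" using g(2)[OF mP] G(4)[OF mP] m by simp
    then show "x \<in> {x \<in> carrier E. g x = \<zero>\<^bsub>G\<^esub>}" using ph(1)[OF mP] m by simp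
  next
    fix x assume x: "x \<in> {x \<in> carrier E. g x = \<zero>\<^bsub>G\<^esub>}"
    then obtain f where f: "f \<in> carrier P" "x = p f" using E(3) by blast
    then have "q f = \<zero>\<^bsub>G\<^esub>" using x g(2) by simp
    then have "f \<in> L" using G(4)[OF f(1)] by simp
    then obtain m where m: "m \<in> carrier M" "\<forall>\<^sub>F i in F. f i = m" by (auto simp: L_def)
    then have "x = \<delta> m" unfolding f(2) \<delta>_def using f(1) by (subst p_eq) (auto simp: Pc)
    then show "x \<in> \<delta> ` carrier M" using m by blast
  qed
  have surj: "g ` carrier E = carrier G"
    using E(3) G(3) g(2) by (metis (no_types, lifting) image_cong image_image)
  define s where "s = inv_into (carrier P) p"
  have s: "s x \<in> carrier P" "p (s x) = x" if "x \<in> carrier E" for x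
    using that E(3) by (auto simp: s_def inv_into_into f_inv_into_f)
  have split: "finitely_split R D E (\<lambda>x. x)"
    unfolding finitely_split_def
  proof (intro allI impI, elim conjE)
    fix Q S T assume QS: "relation_pairs R E Q S" and T: "finite T" "T \<subseteq> carrier D"
    have "\<forall>\<^sub>F i in F. s (x \<oplus>\<^bsub>E\<^esub> y) i = s x i \<oplus>\<^bsub>M\<^esub> s y i" if "(x, y) \<in> Q" for x y
    proof -
      have xy: "x \<in> carrier E" "y \<in> carrier E" using that QS by (auto simp: relation_pairs_def)
      have "p (s (x \<oplus>\<^bsub>E\<^esub> y)) = p (s x \<oplus>\<^bsub>P\<^esub> s y)" using s xy ph(2) by simp
      then have "\<forall>\<^sub>F i in F. s (x \<oplus>\<^bsub>E\<^esub> y) i = (s x \<oplus>\<^bsub>P\<^esub> s y) i"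
        using p_eq[OF s(1) P.M.a_closed[OF s(1) s(1)]] xy E.M.a_closed by blast
      then show ?thesis by (simp add: P_def)
    qed
    then have 1: "\<forall>\<^sub>F i in F. \<forall>z\<in>Q. case z of (x, y) \<Rightarrow> s (x \<oplus>\<^bsub>E\<^esub> y) i = s x i \<oplus>\<^bsub>M\<^esub> s y i"
      using QS by (intro eventually_ball_finite) (auto simp: relation_pairs_def)
    have "\<forall>\<^sub>F i in F. s (r \<odot>\<^bsub>E\<^esub> x) i = r \<odot>\<^bsub>M\<^esub> s x i" if "(r, x) \<in> S" for r x
    proof -
      have rx: "r \<in> carrier R" "x \<in> carrier E" using that QS by (auto simp: relation_pairs_def)
      have "p (s (r \<odot>\<^bsub>E\<^esub> x)) = p (r \<odot>\<^bsub>P\<^esub> s x)" using s rx ph(3) by simp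
      then have "\<forall>\<^sub>F i in F. s (r \<odot>\<^bsub>E\<^esub> x) i = (r \<odot>\<^bsub>P\<^esub> s x) i"
        using p_eq[OF s(1) P.smult_closed[OF rx(1) s(1)]] rx E.smult_closed by blast
      then show ?thesis by (simp add: P_def)
    qed
    then have 2: "\<forall>\<^sub>F i in F. \<forall>z\<in>S. case z of (r, x) \<Rightarrow> s (r \<odot>\<^bsub>E\<^esub> x) i = r \<odot>\<^bsub>M\<^esub> s x i"
      using QS by (intro eventually_ball_finite) (auto simp: relation_pairs_def)
    have "\<forall>\<^sub>F i in F. \<delta> (s x i) = x" if x: "x \<in> T" for x
    proof -
      obtain m where m: "m \<in> carrier M" "x = p (\<lambda>_. m)" using x T by (auto simp: D_def \<delta>_def)
      have mP: "(\<lambda>_. m) \<in> carrier P" using m by (simp add: Pc)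
      have "\<forall>\<^sub>F i in F. s x i = m"
        using p_eq[OF s(1) mP, of x] s(2)[of x] ph(1)[OF mP] m by simp
      then show ?thesis by (rule eventually_mono) (simp add: m(2) \<delta>_def)
    qed
    then have 3: "\<forall>\<^sub>F i in F. \<forall>x\<in>T. \<delta> (s x i) = x"
      using T by (intro eventually_ball_finite) auto
    from 1 2 3 have "\<forall>\<^sub>F i in F. (\<forall>z\<in>Q. case z of (x, y) \<Rightarrow> s (x \<oplus>\<^bsub>E\<^esub> y) i = s x i \<oplus>\<^bsub>M\<^esub> s y i) \<and>
        (\<forall>z\<in>S. case z of (r, x) \<Rightarrow> s (r \<odot>\<^bsub>E\<^esub> x) i = r \<odot>\<^bsub>M\<^esub> s x i) \<and> (\<forall>x\<in>T. \<delta> (s x i) = x)"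
      by eventually_elim blast
    from eventually_happens'[OF F this] obtain i where
      i1: "\<And>x y. (x, y) \<in> Q \<Longrightarrow> s (x \<oplus>\<^bsub>E\<^esub> y) i = s x i \<oplus>\<^bsub>M\<^esub> s y i"
      and i2: "\<And>r x. (r, x) \<in> S \<Longrightarrow> s (r \<odot>\<^bsub>E\<^esub> x) i = r \<odot>\<^bsub>M\<^esub> s x i"
      and i3: "\<And>x. x \<in> T \<Longrightarrow> \<delta> (s x i) = x" by fast
    have si: "s x i \<in> carrier M" if "x \<in> carrier E" for x using s(1)[OF that] by (simp add: Pc)
    have "preserves R E D Q S (\<lambda>x. \<delta> (s x i))"
      unfolding preserves_def
    proof (intro conjI ballI)
      show "(\<lambda>x. \<delta> (s x i)) \<in> carrier E \<rightarrow> carrier D" using si by (auto simp: D_def)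
      show "case z of (x, y) \<Rightarrow> \<delta> (s (x \<oplus>\<^bsub>E\<^esub> y) i) = \<delta> (s x i) \<oplus>\<^bsub>D\<^esub> \<delta> (s y i)" if "z \<in> Q" for z
        using that QS mod_homD(2)[OF \<delta>] si by (auto simp: i1 D_def relation_pairs_def)
      show "case z of (r, x) \<Rightarrow> \<delta> (s (r \<odot>\<^bsub>E\<^esub> x) i) = r \<odot>\<^bsub>D\<^esub> \<delta> (s x i)" if "z \<in> S" for z
        using that QS mod_homD(3)[OF \<delta>] si by (auto simp: i2 D_def relation_pairs_def)
    qed
    then show "\<exists>\<phi>. preserves R E D Q S \<phi> \<and> (\<forall>x\<in>T. \<phi> x = x)" using i3 by blast
  qed
  have "pure_exact TYPE('u) R D E G (\<lambda>x. x) g"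
    using modD E(1) G(1) inclusion_mod_hom[OF subD] g(1) ker surj split
    by (intro finitely_split_pure_exact) (auto simp: D_def)
  then have "short_exact (Hom_group R G M) (Hom_group R E M) (Hom_group R D M)
      (\<lambda>h. compose (carrier E) h g) (\<lambda>h. compose (carrier D) h (\<lambda>x. x))"
    using pinj by (simp add: pure_injective_def)
  then have ext: "(\<lambda>h. compose (carrier D) h (\<lambda>x. x)) ` carrier (Hom_group R E M) = carrier (Hom_group R D M)"
    by (simp add: short_exact_def)
  obtain h0 where h0: "h0 \<in> mod_hom R D M" "\<And>m. m \<in> carrier M \<Longrightarrow> h0 (\<delta> m) = m"
  proof (rule mod_hom_factor[OF mod modD mod, of \<delta> "\<lambda>x. x"])
    show "\<delta> \<in> mod_hom R M D" using mod_homD[OF \<delta>] by (intro mod_homI) (auto simp: D_def)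
    show "\<delta> ` carrier M = carrier D" by (simp add: D_def)
    show "(\<lambda>x. x) \<in> mod_hom R M M" by (intro mod_homI) auto
    show "m = \<zero>\<^bsub>M\<^esub>" if "m \<in> carrier M" "\<delta> m = \<zero>\<^bsub>D\<^esub>" for m
      using \<delta>_inj[of m "\<zero>\<^bsub>M\<^esub>"] that mod_hom_zero[OF mod E(1) \<delta>] by (simp add: D_def)
  qed (rule that)
  interpret D: module R D by fact
  have "restrict h0 (carrier D) \<in> carrier (Hom_group R D M)"
    using mod_homD[OF h0(1)] by (auto simp: Hom_group_def intro!: mod_homI)
  then obtain h where h1: "h \<in> carrier (Hom_group R E M)"
    and h2: "compose (carrier D) h (\<lambda>x. x) = restrict h0 (carrier D)"
    using ext by (metis (no_types, lifting) imageE)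
  have h: "h \<in> mod_hom R E M" using h1 by (simp add: Hom_group_def)
  have h\<delta>: "h (\<delta> m) = m" if m: "m \<in> carrier M" for m
  proof -
    have "\<delta> m \<in> carrier D" using m by (simp add: D_def)
    then show ?thesis using fun_cong[OF h2, of "\<delta> m"] h0(2)[OF m] by (simp add: compose_def)
  qed
  have wP: "w \<in> carrier P" using w by (simp add: Pc)
  show ?thesis
  proof (intro bexI[of _ "h (p w)"] ballI)
    show "h (p w) \<in> carrier M" using mod_homD(1)[OF h] ph(1)[OF wP] by blast
    fix a assume a: "a \<in> A"
    then obtain r m where rm: "a = (r, m)" "r \<in> carrier R" "m \<in> carrier M" using A by auto
    have "\<exists>y\<in>carrier M. w i = m \<oplus>\<^bsub>M\<^esub> r \<odot>\<^bsub>M\<^esub> y \<or> (\<nexists>y. y \<in> carrier M \<and> w i = m \<oplus>\<^bsub>M\<^esub> r \<odot>\<^bsub>M\<^esub> y)" for i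
      by blast
    then obtain y where y: "\<And>i. y i \<in> carrier M"
      "\<And>i. w i = m \<oplus>\<^bsub>M\<^esub> r \<odot>\<^bsub>M\<^esub> y i \<or> (\<nexists>y. y \<in> carrier M \<and> w i = m \<oplus>\<^bsub>M\<^esub> r \<odot>\<^bsub>M\<^esub> y)"
      by metis
    have yP: "y \<in> carrier P" "(\<lambda>_. m) \<in> carrier P" using y(1) rm by (simp_all add: Pc)
    have "\<forall>\<^sub>F i in F. w i = m \<oplus>\<^bsub>M\<^esub> r \<odot>\<^bsub>M\<^esub> y i"
      using cong[of r m] a rm(1) y(2) by (auto elim!: eventually_mono)
    then have "p w = p ((\<lambda>_. m) \<oplus>\<^bsub>P\<^esub> r \<odot>\<^bsub>P\<^esub> y)"
      using wP yP rm(2) by (subst p_eq) (auto simp: P_def)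
    also have "\<dots> = \<delta> m \<oplus>\<^bsub>E\<^esub> r \<odot>\<^bsub>E\<^esub> p y" using ph yP rm by (simp add: \<delta>_def)
    finally have "h (p w) = m \<oplus>\<^bsub>M\<^esub> r \<odot>\<^bsub>M\<^esub> h (p y)"
      using mod_homD[OF h] mod_homD(1)[OF \<delta>] ph(1)[OF yP(1)] rm h\<delta> by simp
    moreover have "h (p y) \<in> carrier M" using mod_homD(1)[OF h] ph(1)[OF yP(1)] by blast
    ultimately show "case a of (r, m) \<Rightarrow> \<exists>y\<in>carrier M. h (p w) = m \<oplus>\<^bsub>M\<^esub> r \<odot>\<^bsub>M\<^esub> y"
      unfolding rm(1) by auto
  qed
qed

section \<open>Pure-essential extensions of a valuation ring\<close>

lemma (in abelian_group) add_minus_cancel: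
  assumes "x \<in> carrier G" "y \<in> carrier G"
  shows "y \<oplus> (x \<oplus> \<ominus> y) = x"
  using assms by (simp add: a_comm[of x] r_neg2)

text \<open>
  If the stated equation never occurred, \<open>R u\<close> would meet \<open>R m\<close> trivially and would still be pure
  modulo \<open>R m\<close>, since over a valuation ring relative divisibility is enough for purity.
\<close>

lemma pure_essential_nonzero_element:
  fixes R (structure)
  assumes vr: "valuation_ring R" and mod: "module R M" and u: "u \<in> carrier M"
    and pe: "pure_essential TYPE('u) R ((\<lambda>r. r \<odot>\<^bsub>M\<^esub> u) ` carrier R) M"
    and m: "m \<in> carrier M" "m \<noteq> \<zero>\<^bsub>M\<^esub>"
  shows "\<exists>t\<in>carrier R. \<exists>r\<in>carrier R. \<exists>s\<in>carrier R. \<exists>y\<in>carrier M.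
    t \<odot>\<^bsub>M\<^esub> y = r \<odot>\<^bsub>M\<^esub> u \<oplus>\<^bsub>M\<^esub> s \<odot>\<^bsub>M\<^esub> m \<and> (\<forall>q\<in>carrier R. r \<odot>\<^bsub>M\<^esub> u \<noteq> (t \<otimes> q) \<odot>\<^bsub>M\<^esub> u)"
proof (rule ccontr)
  interpret module R M by fact
  assume contr: "\<not> ?thesis"
  have divides: "\<exists>q\<in>carrier R. r \<odot>\<^bsub>M\<^esub> u = (t \<otimes> q) \<odot>\<^bsub>M\<^esub> u"
    if "t \<in> carrier R" "r \<in> carrier R" "s \<in> carrier R" "y \<in> carrier M"
      "t \<odot>\<^bsub>M\<^esub> y = r \<odot>\<^bsub>M\<^esub> u \<oplus>\<^bsub>M\<^esub> s \<odot>\<^bsub>M\<^esub> m" for t r s y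
    using contr that by blast
  let ?S = "(\<lambda>r. r \<odot>\<^bsub>M\<^esub> u) ` carrier R"
  define K where "K = (\<lambda>s. s \<odot>\<^bsub>M\<^esub> m) ` carrier (regular_module R)"
  have modR: "module R (regular_module R)" by (rule module_regular_module) (rule R.cring_axioms)
  have "(\<lambda>s. s \<odot>\<^bsub>M\<^esub> m) \<in> mod_hom R (regular_module R) M"
    using m by (intro mod_homI) (auto simp: smult_l_distr smult_assoc1)
  then have K: "submodule K R M" unfolding K_def by (rule mod_hom_image_submodule[OF modR mod])
  define Q where "Q = quot_module M K"
  define \<pi> where "\<pi> x = K +>\<^bsub>M\<^esub> x" for x
  note pr = quot_proj[OF mod K, folded Q_def \<pi>_def[abs_def] \<pi>_def]
  note \<pi>h = mod_homD[OF pr(1)]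
  have modQ: "module R Q" unfolding Q_def by (rule quot_module[OF mod K])
  interpret Q: module R Q by fact
  have \<pi>_eq: "\<exists>s\<in>carrier R. x = y \<oplus>\<^bsub>M\<^esub> s \<odot>\<^bsub>M\<^esub> m"
    if xy: "x \<in> carrier M" "y \<in> carrier M" "\<pi> x = \<pi> y" for x y
  proof -
    have "x \<ominus>\<^bsub>M\<^esub> y \<in> K" using coset_eq_iff[OF mod K xy(1,2)] xy(3) by (simp add: \<pi>_def)
    then obtain s where s: "s \<in> carrier R" "x \<ominus>\<^bsub>M\<^esub> y = s \<odot>\<^bsub>M\<^esub> m" by (auto simp: K_def)
    have "x = y \<oplus>\<^bsub>M\<^esub> (x \<ominus>\<^bsub>M\<^esub> y)" using xy by (simp add: a_minus_def M.add_minus_cancel)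
    then show ?thesis using s by auto
  qed
  have "m \<in> K" unfolding K_def using m by (intro image_eqI[of _ _ "\<one>"]) auto
  then have "K \<noteq> {\<zero>\<^bsub>M\<^esub>}" using m by auto
  moreover have "K \<inter> ?S = {\<zero>\<^bsub>M\<^esub>}"
  proof -
    have "x = \<zero>\<^bsub>M\<^esub>" if "x \<in> K" "x \<in> ?S" for x
    proof -
      obtain s where s: "s \<in> carrier R" "x = s \<odot>\<^bsub>M\<^esub> m" using \<open>x \<in> K\<close> by (auto simp: K_def)
      obtain r where r: "r \<in> carrier R" "x = r \<odot>\<^bsub>M\<^esub> u" using \<open>x \<in> ?S\<close> by blast
      have xM: "x \<in> carrier M" using s m by simp
      have "\<zero> \<odot>\<^bsub>M\<^esub> u = r \<odot>\<^bsub>M\<^esub> u \<oplus>\<^bsub>M\<^esub> (\<ominus> s) \<odot>\<^bsub>M\<^esub> m"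
        unfolding smult_l_minus[OF s(1) m(1)] s(2)[symmetric] r(2)[symmetric]
        using u xM by (simp add: M.r_neg)
      from divides[OF R.zero_closed r(1) R.a_inv_closed[OF s(1)] u this]
      obtain q where "q \<in> carrier R" "r \<odot>\<^bsub>M\<^esub> u = (\<zero> \<otimes> q) \<odot>\<^bsub>M\<^esub> u" by blast
      then show ?thesis using r u by simp
    qed
    moreover have "\<zero>\<^bsub>M\<^esub> \<in> ?S" using u by (intro image_eqI[of _ _ "\<zero>"]) auto
    ultimately show ?thesis using submodule_zero[OF K] by blast
  qed
  ultimately have not_pure: "\<not> pure_submodule TYPE('u) R (\<pi> ` (?S <+>\<^bsub>M\<^esub> K)) Q"
    using pe K unfolding pure_essential_def Q_def \<pi>_def by blast
  define S' where "S' = (\<lambda>r. \<pi> (r \<odot>\<^bsub>M\<^esub> u)) ` carrier (regular_module R)"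
  have "\<pi> ` (?S <+>\<^bsub>M\<^esub> K) = S'"
  proof -
    have 1: "\<pi> (r \<odot>\<^bsub>M\<^esub> u \<oplus>\<^bsub>M\<^esub> s \<odot>\<^bsub>M\<^esub> m) = \<pi> (r \<odot>\<^bsub>M\<^esub> u)" if "r \<in> carrier R" "s \<in> carrier R" for r s
    proof -
      have "\<pi> (s \<odot>\<^bsub>M\<^esub> m) = \<zero>\<^bsub>Q\<^esub>" using pr(2)[of "s \<odot>\<^bsub>M\<^esub> m"] that m by (auto simp: K_def)
      then show ?thesis using \<pi>h(1,2) that m u by simp
    qed
    have 2: "r \<odot>\<^bsub>M\<^esub> u \<in> ?S <+>\<^bsub>M\<^esub> K" if "r \<in> carrier R" for r
    proof -
      have "r \<odot>\<^bsub>M\<^esub> u \<oplus>\<^bsub>M\<^esub> \<zero>\<^bsub>M\<^esub> \<in> ?S <+>\<^bsub>M\<^esub> K"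
        unfolding set_add_def' using submodule_zero[OF K] that by blast
      then show ?thesis using that u by simp
    qed
    show ?thesis
    proof (intro subset_antisym subsetI)
      fix x assume "x \<in> \<pi> ` (?S <+>\<^bsub>M\<^esub> K)"
      then obtain r s where "r \<in> carrier R" "s \<in> carrier R" "x = \<pi> (r \<odot>\<^bsub>M\<^esub> u \<oplus>\<^bsub>M\<^esub> s \<odot>\<^bsub>M\<^esub> m)"
        by (auto simp: set_add_def' K_def)
      then show "x \<in> S'" using 1 by (auto simp: S'_def)
    next
      fix x assume "x \<in> S'"
      then show "x \<in> \<pi> ` (?S <+>\<^bsub>M\<^esub> K)" using 2 by (auto simp: S'_def)
    qed
  qed
  moreover have "rd_pure R S' Q"
    unfolding rd_pure_def
  proof (intro conjI ballI impI)
    have "(\<lambda>r. \<pi> (r \<odot>\<^bsub>M\<^esub> u)) \<in> mod_hom R (regular_module R) Q"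
      using \<pi>h u by (intro mod_homI) (auto simp: smult_l_distr smult_assoc1)
    then show "submodule S' R Q" unfolding S'_def by (rule mod_hom_image_submodule[OF modR modQ])
    fix t y' assume t: "t \<in> carrier R" and y': "y' \<in> carrier Q" and ty: "t \<odot>\<^bsub>Q\<^esub> y' \<in> S'"
    obtain y where y: "y \<in> carrier M" "y' = \<pi> y"
      using y' by (auto simp: Q_def \<pi>_def carrier_quot_module)
    obtain r where r: "r \<in> carrier R" "t \<odot>\<^bsub>Q\<^esub> y' = \<pi> (r \<odot>\<^bsub>M\<^esub> u)" using ty by (auto simp: S'_def)
    have "\<pi> (t \<odot>\<^bsub>M\<^esub> y) = \<pi> (r \<odot>\<^bsub>M\<^esub> u)" using r y t \<pi>h(3) by simp
    then obtain s where "s \<in> carrier R" "t \<odot>\<^bsub>M\<^esub> y = r \<odot>\<^bsub>M\<^esub> u \<oplus>\<^bsub>M\<^esub> s \<odot>\<^bsub>M\<^esub> m"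
      using \<pi>_eq[of "t \<odot>\<^bsub>M\<^esub> y" "r \<odot>\<^bsub>M\<^esub> u"] y t r u by auto
    then obtain q where q: "q \<in> carrier R" "r \<odot>\<^bsub>M\<^esub> u = (t \<otimes> q) \<odot>\<^bsub>M\<^esub> u"
      using divides t r y by blast
    have "t \<odot>\<^bsub>Q\<^esub> \<pi> (q \<odot>\<^bsub>M\<^esub> u) = \<pi> (t \<odot>\<^bsub>M\<^esub> (q \<odot>\<^bsub>M\<^esub> u))" using \<pi>h(3) t q u by simp
    also have "\<dots> = t \<odot>\<^bsub>Q\<^esub> y'" using r(2) q t u by (simp add: smult_assoc1)
    finally show "\<exists>z\<in>S'. t \<odot>\<^bsub>Q\<^esub> z = t \<odot>\<^bsub>Q\<^esub> y'" using q by (auto simp: S'_def)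
  qed
  ultimately show False using not_pure rd_pure_pure_submodule[OF vr modQ] by metis
qed

text \<open>
  Here \<open>w\<close> arises from \<open>m\<close> by subtracting a multiple of a scalar \<open>x\<close> that is killed by the
  annihilator of \<open>m\<close> but not by that of \<open>w\<close>.  The annihilator grows strictly in each step, and for
  \<open>m \<noteq> 0\<close> a descent from \<open>m\<close> to \<open>0\<close> is precisely a factorisation as in \<^const>\<open>torsion_flat\<close>.
\<close>

definition descends :: "'a ring \<Rightarrow> ('a, 'm) module \<Rightarrow> 'm \<Rightarrow> 'm \<Rightarrow> bool" where
  "descends R M m w \<longleftrightarrow> (\<exists>x\<in>carrier R. \<exists>p\<in>carrier M. m = w \<oplus>\<^bsub>M\<^esub> x \<odot>\<^bsub>M\<^esub> p \<and>
     (\<forall>a\<in>carrier R. a \<odot>\<^bsub>M\<^esub> m = \<zero>\<^bsub>M\<^esub> \<longrightarrow> a \<otimes>\<^bsub>R\<^esub> x = \<zero>\<^bsub>R\<^esub>) \<and>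
     (\<exists>s\<in>carrier R. s \<odot>\<^bsub>M\<^esub> w = \<zero>\<^bsub>M\<^esub> \<and> s \<otimes>\<^bsub>R\<^esub> x \<noteq> \<zero>\<^bsub>R\<^esub>))"

lemma descends_irrefl: "\<not> descends R M m m"
  by (auto simp: descends_def)

text \<open>
  The scalar of the second step is a multiple of that of the first, because some \<open>s\<close> with \<open>s w = 0\<close>
  kills the second scalar but not the first.  The first scalar therefore serves the composite.
\<close>

lemma descends_trans:
  fixes R (structure)
  assumes vr: "valuation_ring R" and mod: "module R M"
    and mem: "m \<in> carrier M" "w \<in> carrier M" "v \<in> carrier M"
    and mw: "descends R M m w" and wv: "descends R M w v"
  shows "descends R M m v"
proof -
  interpret module R M by fact
  obtain x p s where x: "x \<in> carrier R" "p \<in> carrier M" "m = w \<oplus>\<^bsub>M\<^esub> x \<odot>\<^bsub>M\<^esub> p"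
    and xm: "\<And>a. a \<in> carrier R \<Longrightarrow> a \<odot>\<^bsub>M\<^esub> m = \<zero>\<^bsub>M\<^esub> \<Longrightarrow> a \<otimes> x = \<zero>"
    and s: "s \<in> carrier R" "s \<odot>\<^bsub>M\<^esub> w = \<zero>\<^bsub>M\<^esub>" "s \<otimes> x \<noteq> \<zero>"
    using mw unfolding descends_def by blast
  obtain x' p' s' where x': "x' \<in> carrier R" "p' \<in> carrier M" "w = v \<oplus>\<^bsub>M\<^esub> x' \<odot>\<^bsub>M\<^esub> p'"
    and xw: "\<And>a. a \<in> carrier R \<Longrightarrow> a \<odot>\<^bsub>M\<^esub> w = \<zero>\<^bsub>M\<^esub> \<Longrightarrow> a \<otimes> x' = \<zero>"
    and s': "s' \<in> carrier R" "s' \<odot>\<^bsub>M\<^esub> v = \<zero>\<^bsub>M\<^esub>" "s' \<otimes> x' \<noteq> \<zero>"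
    using wv unfolding descends_def by blast
  have "\<not> (\<exists>c\<in>carrier R. x = x' \<otimes> c)"
  proof
    assume "\<exists>c\<in>carrier R. x = x' \<otimes> c"
    then obtain c where c: "c \<in> carrier R" "x = x' \<otimes> c" by blast
    have "s \<otimes> x = (s \<otimes> x') \<otimes> c" using c s(1) x'(1) by (simp add: R.m_assoc)
    then show False using xw[OF s(1,2)] s(3) c by simp
  qed
  then obtain c where c: "c \<in> carrier R" "x' = x \<otimes> c"
    using valuation_ringD[OF vr x(1) x'(1)] by blast
  have "m = v \<oplus>\<^bsub>M\<^esub> x \<odot>\<^bsub>M\<^esub> (c \<odot>\<^bsub>M\<^esub> p' \<oplus>\<^bsub>M\<^esub> p)"
    using x x' c mem by (simp add: smult_r_distr smult_assoc1 M.a_assoc)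
  moreover have "s' \<otimes> x \<noteq> \<zero>"
  proof
    assume "s' \<otimes> x = \<zero>"
    then have "(s' \<otimes> x) \<otimes> c = \<zero>" using c by simp
    then show False using s'(1,3) c x(1) by (simp add: R.m_assoc)
  qed
  moreover have "c \<odot>\<^bsub>M\<^esub> p' \<oplus>\<^bsub>M\<^esub> p \<in> carrier M" using c x x' by simp
  ultimately show ?thesis unfolding descends_def using x(1) xm s' by blast
qed

text \<open>
  Here \<open>s x (d - c k) = s x\<close> while \<open>s x \<notin> s x c R\<close>.  By comparability, \<open>d - c k\<close> or
  \<open>1 - (d - c k)\<close> is a unit, and the latter would force \<open>s x = 0\<close>.  As \<open>c\<close> is no unit, \<open>d\<close> is one.
\<close>

lemma valuation_ring_associated:
  fixes R (structure)
  assumes vr: "valuation_ring R"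
    and mem: "x \<in> carrier R" "d \<in> carrier R" "c \<in> carrier R" "k \<in> carrier R" "s \<in> carrier R"
    and eq: "s \<otimes> x \<otimes> d = s \<otimes> x \<oplus> s \<otimes> x \<otimes> c \<otimes> k"
    and c: "\<And>w. w \<in> carrier R \<Longrightarrow> s \<otimes> x \<noteq> s \<otimes> x \<otimes> c \<otimes> w"
  shows "\<exists>w\<in>carrier R. d \<otimes> w = \<one>"
proof -
  interpret cring R using vr by (simp add: valuation_ring_def)
  define z where "z = s \<otimes> x"
  define v where "v = d \<ominus> c \<otimes> k"
  have zR: "z \<in> carrier R" "v \<in> carrier R" using mem by (simp_all add: z_def v_def)
  have "z \<otimes> v = z \<otimes> d \<ominus> z \<otimes> c \<otimes> k"
    using zR mem by (simp add: v_def a_minus_def r_distr r_minus m_assoc)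
  also have "\<dots> = z"
    using zR mem eq by (simp add: z_def[symmetric] a_minus_def a_assoc r_neg)
  finally have zv: "z \<otimes> v = z" .
  have "\<one> \<ominus> v \<in> carrier R" using zR by simp
  from valuation_ringD[OF vr zR(2) this]
  have "\<exists>l\<in>carrier R. v \<otimes> l = \<one>"
  proof (elim disjE bexE)
    fix l assume l: "l \<in> carrier R" "v = (\<one> \<ominus> v) \<otimes> l"
    have "z \<otimes> (\<one> \<ominus> v) = \<zero>"
      using zR zv by (simp add: a_minus_def r_distr r_minus r_neg)
    then have "(z \<otimes> (\<one> \<ominus> v)) \<otimes> l = \<zero>" using l by simp
    then have "z = \<zero>" using zv l zR by (metis \<open>\<one> \<ominus> v \<in> carrier R\<close> m_assoc)
    then show ?thesis using c[of "\<zero>"] mem by (simp add: z_def)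
  next
    fix l assume l: "l \<in> carrier R" "\<one> \<ominus> v = v \<otimes> l"
    have "v \<otimes> (\<one> \<oplus> l) = v \<oplus> (\<one> \<ominus> v)" using l zR by (simp add: r_distr)
    also have "\<dots> = \<one>" using zR by (simp add: a_minus_def add_minus_cancel)
    finally show ?thesis using l by blast
  qed
  then obtain l where l: "l \<in> carrier R" "v \<otimes> l = \<one>" by blast
  from valuation_ringD[OF vr mem(2,3)] show ?thesis
  proof (elim disjE bexE)
    fix e assume e: "e \<in> carrier R" "d = c \<otimes> e"
    have "v = c \<otimes> (e \<ominus> k)" using e mem by (simp add: v_def a_minus_def r_distr r_minus)
    then have "c \<otimes> ((e \<ominus> k) \<otimes> l) = \<one>" using l e mem by (simp add: m_assoc)
    then have "z = z \<otimes> c \<otimes> ((e \<ominus> k) \<otimes> l)" using l e mem zR by (simp add: m_assoc)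
    then show ?thesis using c[of "(e \<ominus> k) \<otimes> l"] l e mem by (simp add: z_def)
  next
    fix e assume e: "e \<in> carrier R" "c = d \<otimes> e"
    have "v = d \<otimes> (\<one> \<ominus> e \<otimes> k)"
      using e mem by (simp add: v_def a_minus_def r_distr r_minus m_assoc)
    then have "d \<otimes> ((\<one> \<ominus> e \<otimes> k) \<otimes> l) = \<one>" using l e mem by (simp add: m_assoc)
    then show ?thesis using l e mem by blast
  qed
qed

text \<open>
  The equation \<open>t y = r u + s m\<close> with \<open>t\<close> not dividing \<open>r\<close> says how \<open>m\<close> is linked to the ring.  By
  relative divisibility it has an approximate solution in the ring: some \<open>x\<close>, killed by the
  annihilator of \<open>m\<close>, such that \<open>t\<close> divides \<open>r + s x\<close>.  Then \<open>t\<close> divides \<open>s (m - x u)\<close> but not \<open>s x\<close>,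
  so \<open>t = s x c\<close>, and subtracting a further multiple of \<open>x\<close> from \<open>m - x u\<close> leaves an element killed
  by \<open>s\<close>, whereas \<open>s x \<noteq> 0\<close>.
\<close>

lemma descends_step:
  fixes R (structure)
  assumes vr: "valuation_ring R" and mod: "module R M" and u: "u \<in> carrier M"
    and div: "\<And>t r y. t \<in> carrier R \<Longrightarrow> r \<in> carrier R \<Longrightarrow> y \<in> carrier M \<Longrightarrow>
      t \<odot>\<^bsub>M\<^esub> y = r \<odot>\<^bsub>M\<^esub> u \<Longrightarrow> \<exists>q\<in>carrier R. r = t \<otimes> q"
    and m: "m \<in> carrier M"
    and mem: "t \<in> carrier R" "r \<in> carrier R" "s \<in> carrier R" "y \<in> carrier M"
    and eq: "t \<odot>\<^bsub>M\<^esub> y = r \<odot>\<^bsub>M\<^esub> u \<oplus>\<^bsub>M\<^esub> s \<odot>\<^bsub>M\<^esub> m"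
    and ndiv: "\<And>q. q \<in> carrier R \<Longrightarrow> r \<noteq> t \<otimes> q"
  shows "\<exists>w\<in>carrier M. descends R M m w"
proof -
  interpret module R M by fact
  have ru: "r \<odot>\<^bsub>M\<^esub> u = t \<odot>\<^bsub>M\<^esub> y \<ominus>\<^bsub>M\<^esub> s \<odot>\<^bsub>M\<^esub> m"
    using eq mem u m by (simp add: a_minus_def M.a_assoc M.r_neg)
  \<comment> \<open>the equation for \<open>m\<close> together with a single annihilator condition is solvable in \<open>R\<close>\<close>
  have approx: "\<exists>x\<in>carrier R. \<exists>q\<in>carrier R. a \<otimes> x = \<zero> \<and> t \<otimes> q = r \<oplus> s \<otimes> x"
    if a: "a \<in> carrier R" "a \<odot>\<^bsub>M\<^esub> m = \<zero>\<^bsub>M\<^esub>" for a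
  proof -
    have "\<not> (\<exists>d\<in>carrier R. s = t \<otimes> d)"
    proof
      assume "\<exists>d\<in>carrier R. s = t \<otimes> d"
      then obtain d where d: "d \<in> carrier R" "s = t \<otimes> d" by blast
      have "t \<odot>\<^bsub>M\<^esub> (y \<ominus>\<^bsub>M\<^esub> d \<odot>\<^bsub>M\<^esub> m) = r \<odot>\<^bsub>M\<^esub> u"
        unfolding ru using d mem m by (simp add: a_minus_def smult_r_distr smult_r_minus smult_assoc1)
      from div[OF mem(1,2) _ this] show False using ndiv d mem m by auto
    qed
    then obtain d where d: "d \<in> carrier R" "t = s \<otimes> d"
      using valuation_ringD[OF vr mem(1,3)] by blast
    have "s \<odot>\<^bsub>M\<^esub> (d \<odot>\<^bsub>M\<^esub> y \<ominus>\<^bsub>M\<^esub> m) = r \<odot>\<^bsub>M\<^esub> u"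
      unfolding ru using d mem m by (simp add: a_minus_def smult_r_distr smult_r_minus smult_assoc1)
    from div[OF mem(3,2) _ this] obtain r' where r': "r' \<in> carrier R" "r = s \<otimes> r'"
      using d mem m by auto
    have "\<not> (\<exists>e\<in>carrier R. s = a \<otimes> e)"
    proof
      assume "\<exists>e\<in>carrier R. s = a \<otimes> e"
      then obtain e where e: "e \<in> carrier R" "s = e \<otimes> a" using a by (auto simp: R.m_comm)
      then have "s \<odot>\<^bsub>M\<^esub> m = \<zero>\<^bsub>M\<^esub>" using a m by (simp add: smult_assoc1)
      then have "t \<odot>\<^bsub>M\<^esub> y = r \<odot>\<^bsub>M\<^esub> u" using eq mem u by simp
      from div[OF mem(1,2,4) this] show False using ndiv by blast
    qed
    then obtain a' where a': "a' \<in> carrier R" "a = s \<otimes> a'"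
      using valuation_ringD[OF vr a(1) mem(3)] by blast
    have "(a \<otimes> r') \<odot>\<^bsub>M\<^esub> u = a' \<odot>\<^bsub>M\<^esub> (r \<odot>\<^bsub>M\<^esub> u)"
      using a' r' mem u by (simp add: smult_assoc1[symmetric] R.m_ac)
    also have "\<dots> = a' \<odot>\<^bsub>M\<^esub> (t \<odot>\<^bsub>M\<^esub> y) \<ominus>\<^bsub>M\<^esub> a \<odot>\<^bsub>M\<^esub> m"
    proof -
      have "a \<odot>\<^bsub>M\<^esub> m = a' \<odot>\<^bsub>M\<^esub> (s \<odot>\<^bsub>M\<^esub> m)"
        using a' mem m by (simp add: smult_assoc1[symmetric] R.m_comm)
      then show ?thesis
        unfolding ru using a'(1) mem m by (simp add: a_minus_def smult_r_distr smult_r_minus)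
    qed
    also have "\<dots> = a' \<odot>\<^bsub>M\<^esub> (t \<odot>\<^bsub>M\<^esub> y)"
      using a a' mem m by (simp add: M.minus_eq M.minus_equality[of "\<zero>\<^bsub>M\<^esub>" "\<zero>\<^bsub>M\<^esub>"])
    also have "\<dots> = (a \<otimes> d) \<odot>\<^bsub>M\<^esub> y"
      using a' d mem by (simp add: smult_assoc1[symmetric] R.m_ac)
    finally have "(a \<otimes> d) \<odot>\<^bsub>M\<^esub> y = (a \<otimes> r') \<odot>\<^bsub>M\<^esub> u" ..
    from div[OF _ _ mem(4) this] obtain q where q: "q \<in> carrier R" "a \<otimes> r' = a \<otimes> d \<otimes> q"
      using a d r' by auto
    show ?thesis
    proof (intro bexI conjI)
      show "a \<otimes> (d \<otimes> q \<ominus> r') = \<zero>"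
        using q a(1) d(1) r'(1) by (simp add: a_minus_def R.r_distr R.r_minus R.m_assoc R.r_neg)
      show "t \<otimes> q = r \<oplus> s \<otimes> (d \<otimes> q \<ominus> r')"
        using q(1) d r' mem(3)
        by (simp add: a_minus_def R.r_distr R.r_minus R.m_assoc R.add_minus_cancel)
    qed (use q d r' in auto)
  qed
  \<comment> \<open>any annihilator, for instance \<open>0\<close>, provides the approximation to be used\<close>
  have "\<zero> \<odot>\<^bsub>M\<^esub> m = \<zero>\<^bsub>M\<^esub>" using m by simp
  from approx[OF _ this] obtain x q where xq: "x \<in> carrier R" "q \<in> carrier R"
    and tq: "t \<otimes> q = r \<oplus> s \<otimes> x" by auto
  have r_eq: "r = t \<otimes> q \<ominus> s \<otimes> x"
    unfolding tq using xq mem by (simp add: a_minus_def R.a_assoc R.r_neg)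
  have sx: "s \<otimes> x \<noteq> t \<otimes> k" if k: "k \<in> carrier R" for k
  proof
    assume "s \<otimes> x = t \<otimes> k"
    then have "r = t \<otimes> (q \<ominus> k)"
      using r_eq xq k mem by (simp add: a_minus_def R.r_distr R.r_minus)
    then show False using ndiv[of "q \<ominus> k"] xq k by simp
  qed
  have sxR: "s \<otimes> x \<in> carrier R" using mem xq by simp
  obtain c where c: "c \<in> carrier R" "t = s \<otimes> x \<otimes> c"
    using valuation_ringD[OF vr sxR mem(1)] sx by blast
  \<comment> \<open>all solutions generate the same ideal, so one of them works for every annihilator\<close>
  have ann: "a \<otimes> x = \<zero>" if a: "a \<in> carrier R" "a \<odot>\<^bsub>M\<^esub> m = \<zero>\<^bsub>M\<^esub>" for a
  proof -
    obtain x' q' where x': "x' \<in> carrier R" "q' \<in> carrier R" "a \<otimes> x' = \<zero>"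
      and tq': "t \<otimes> q' = r \<oplus> s \<otimes> x'" using approx[OF a] by blast
    have "\<exists>w\<in>carrier R. x = x' \<otimes> w"
      using valuation_ringD[OF vr xq(1) x'(1)]
    proof (elim disjE)
      assume "\<exists>d\<in>carrier R. x' = x \<otimes> d"
      then obtain d where d: "d \<in> carrier R" "x' = x \<otimes> d" by blast
      have "s \<otimes> x' = s \<otimes> x \<oplus> t \<otimes> (q' \<ominus> q)"
      proof -
        have "t \<otimes> (q' \<ominus> q) = (r \<oplus> s \<otimes> x') \<ominus> (r \<oplus> s \<otimes> x)"
          using tq tq' mem xq x' by (simp add: a_minus_def R.r_distr R.r_minus)
        also have "\<dots> = s \<otimes> x' \<ominus> s \<otimes> x"
          using mem xq x' by (simp add: a_minus_def R.minus_add R.a_ac R.r_neg1 R.r_neg2 R.add_minus_cancel)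
        finally show ?thesis using mem xq x' by (simp add: a_minus_def R.add_minus_cancel)
      qed
      then have "s \<otimes> x \<otimes> d = s \<otimes> x \<oplus> s \<otimes> x \<otimes> c \<otimes> (q' \<ominus> q)"
        using d c(2) mem(3) xq by (simp add: R.m_assoc)
      moreover have "s \<otimes> x \<noteq> s \<otimes> x \<otimes> c \<otimes> w" if "w \<in> carrier R" for w
        using sx[OF that] c(2) by metis
      ultimately obtain w where w: "w \<in> carrier R" "d \<otimes> w = \<one>"
        using valuation_ring_associated[OF vr xq(1) d(1) c(1) _ mem(3), of "q' \<ominus> q"] xq x' by auto
      have "x = x' \<otimes> w" using d w xq by (simp add: R.m_assoc)
      then show ?thesis using w by blast
    qed
    then obtain w where w: "w \<in> carrier R" "x = x' \<otimes> w" by blast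
    have "a \<otimes> x = a \<otimes> x' \<otimes> w" by (simp only: w(2) R.m_assoc[OF a(1) x'(1) w(1)])
    then show ?thesis using x'(3) w(1) by simp
  qed
  define p where "p = u \<oplus>\<^bsub>M\<^esub> c \<odot>\<^bsub>M\<^esub> (y \<ominus>\<^bsub>M\<^esub> q \<odot>\<^bsub>M\<^esub> u)"
  have p: "p \<in> carrier M" using u c mem xq by (simp add: p_def)
  define w where "w = m \<ominus>\<^bsub>M\<^esub> x \<odot>\<^bsub>M\<^esub> p"
  have w: "w \<in> carrier M" using m p xq by (simp add: w_def)
  have "s \<odot>\<^bsub>M\<^esub> (x \<odot>\<^bsub>M\<^esub> p) = (s \<otimes> x) \<odot>\<^bsub>M\<^esub> u \<oplus>\<^bsub>M\<^esub> t \<odot>\<^bsub>M\<^esub> (y \<ominus>\<^bsub>M\<^esub> q \<odot>\<^bsub>M\<^esub> u)"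
    unfolding c(2) p_def using u c(1) mem xq by (simp add: smult_r_distr smult_assoc1)
  also have "t \<odot>\<^bsub>M\<^esub> (y \<ominus>\<^bsub>M\<^esub> q \<odot>\<^bsub>M\<^esub> u) = t \<odot>\<^bsub>M\<^esub> y \<ominus>\<^bsub>M\<^esub> (t \<otimes> q) \<odot>\<^bsub>M\<^esub> u"
    using u mem xq by (simp add: a_minus_def smult_r_distr smult_r_minus smult_assoc1)
  also have "(t \<otimes> q) \<odot>\<^bsub>M\<^esub> u = r \<odot>\<^bsub>M\<^esub> u \<oplus>\<^bsub>M\<^esub> (s \<otimes> x) \<odot>\<^bsub>M\<^esub> u"
    unfolding tq using u mem sxR by (simp add: smult_l_distr)
  also have "(s \<otimes> x) \<odot>\<^bsub>M\<^esub> u \<oplus>\<^bsub>M\<^esub> (t \<odot>\<^bsub>M\<^esub> y \<ominus>\<^bsub>M\<^esub> (r \<odot>\<^bsub>M\<^esub> u \<oplus>\<^bsub>M\<^esub> (s \<otimes> x) \<odot>\<^bsub>M\<^esub> u)) = s \<odot>\<^bsub>M\<^esub> m"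
    unfolding eq using u m mem sxR
    by (simp add: a_minus_def M.minus_add M.a_ac M.r_neg M.r_neg1 M.r_neg2 M.add_minus_cancel)
  finally have "s \<odot>\<^bsub>M\<^esub> w = \<zero>\<^bsub>M\<^esub>"
    using m p xq mem by (simp add: w_def a_minus_def smult_r_distr smult_r_minus M.r_neg)
  moreover have "m = w \<oplus>\<^bsub>M\<^esub> x \<odot>\<^bsub>M\<^esub> p"
    using m p xq by (simp add: w_def a_minus_def M.a_assoc M.l_neg)
  moreover have "s \<otimes> x \<noteq> \<zero>" using sx[of "\<zero>"] mem by simp
  ultimately have "descends R M m w"
    unfolding descends_def using xq p ann mem by blast
  then show ?thesis using w by blast
qed

text \<open>
  Along a chain of descents the difference between \<open>a\<close> and all sufficiently late elements lies in
  \<open>x a M\<close> for a scalar \<open>x a\<close>.  A limit of the chain along its tails satisfies all these congruences,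
  and they make it a common target of descents from all members of the chain.
\<close>

lemma descends_chain_bound:
  fixes R (structure) and M :: "('a, 'm) module" and \<iota> :: "('m \<Rightarrow> 'm) set \<Rightarrow> 'u"
  assumes vr: "valuation_ring R" and \<iota>: "inj \<iota>" and pinj: "pure_injective TYPE('u) R M"
    and C: "C \<subseteq> carrier M" "C \<noteq> {}"
    and chain: "\<And>a b. a \<in> C \<Longrightarrow> b \<in> C \<Longrightarrow> a = b \<or> descends R M a b \<or> descends R M b a"
    and nomax: "\<And>a. a \<in> C \<Longrightarrow> \<exists>b\<in>C. descends R M a b"
  shows "\<exists>z\<in>carrier M. \<forall>a\<in>C. descends R M a z"
proof -
  have mod: "module R M" using pinj by (simp add: pure_injective_def)
  interpret module R M by fact
  note trans = descends_trans[OF vr mod]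
  define step where "step a b x s \<longleftrightarrow> b \<in> C \<and> x \<in> carrier R \<and> s \<in> carrier R \<and>
      (\<exists>p\<in>carrier M. a = b \<oplus>\<^bsub>M\<^esub> x \<odot>\<^bsub>M\<^esub> p) \<and>
      (\<forall>c\<in>carrier R. c \<odot>\<^bsub>M\<^esub> a = \<zero>\<^bsub>M\<^esub> \<longrightarrow> c \<otimes> x = \<zero>) \<and>
      s \<odot>\<^bsub>M\<^esub> b = \<zero>\<^bsub>M\<^esub> \<and> s \<otimes> x \<noteq> \<zero>" for a b x s
  have "\<forall>a\<in>C. \<exists>b x s. step a b x s"
    using nomax unfolding descends_def step_def by blast
  from bchoice[OF this] obtain b where "\<forall>a\<in>C. \<exists>x s. step a (b a) x s" by (elim exE)
  from bchoice[OF this] obtain x where "\<forall>a\<in>C. \<exists>s. step a (b a) (x a) s" by (elim exE)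
  from bchoice[OF this] obtain s where "\<forall>a\<in>C. step a (b a) (x a) (s a)" by (elim exE)
  then have steps: "step a (b a) (x a) (s a)" if "a \<in> C" for a using that by simp
  have b: "b a \<in> C" and x: "x a \<in> carrier R" and s: "s a \<in> carrier R"
    and abx: "\<exists>p\<in>carrier M. a = b a \<oplus>\<^bsub>M\<^esub> x a \<odot>\<^bsub>M\<^esub> p"
    and sb: "s a \<odot>\<^bsub>M\<^esub> b a = \<zero>\<^bsub>M\<^esub>" and sx: "s a \<otimes> x a \<noteq> \<zero>" if "a \<in> C" for a
    using steps[OF that] unfolding step_def by simp_all
  have ann: "c \<otimes> x a = \<zero>"
    if "a \<in> C" "c \<in> carrier R" "c \<odot>\<^bsub>M\<^esub> a = \<zero>\<^bsub>M\<^esub>" for a c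
    using steps[OF that(1)] that(2,3) unfolding step_def by simp
  \<comment> \<open>beyond \<open>b a\<close> the chain stays in \<open>a + x a M\<close>\<close>
  have tail: "\<exists>p\<in>carrier M. c = a \<oplus>\<^bsub>M\<^esub> x a \<odot>\<^bsub>M\<^esub> p"
    if a: "a \<in> C" and c: "c \<in> C" "c = b a \<or> descends R M (b a) c" for a c
  proof -
    obtain p where p: "p \<in> carrier M" "a = b a \<oplus>\<^bsub>M\<^esub> x a \<odot>\<^bsub>M\<^esub> p" using abx[OF a] by blast
    have "\<exists>p'\<in>carrier M. b a = c \<oplus>\<^bsub>M\<^esub> x a \<odot>\<^bsub>M\<^esub> p'"
      using c(2)
    proof (elim disjE)
      assume "c = b a"
      then show ?thesis using c(1) C x[OF a] by (intro bexI[of _ "\<zero>\<^bsub>M\<^esub>"]) auto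
    next
      assume "descends R M (b a) c"
      then obtain x' p' where x': "x' \<in> carrier R" "p' \<in> carrier M" "b a = c \<oplus>\<^bsub>M\<^esub> x' \<odot>\<^bsub>M\<^esub> p'"
        and ann': "\<And>d. d \<in> carrier R \<Longrightarrow> d \<odot>\<^bsub>M\<^esub> b a = \<zero>\<^bsub>M\<^esub> \<Longrightarrow> d \<otimes> x' = \<zero>"
        unfolding descends_def by blast
      have "\<not> (\<exists>d\<in>carrier R. x a = x' \<otimes> d)"
      proof
        assume "\<exists>d\<in>carrier R. x a = x' \<otimes> d"
        then obtain d where d: "d \<in> carrier R" "x a = x' \<otimes> d" by blast
        have "s a \<otimes> x a = (s a \<otimes> x') \<otimes> d" using d s[OF a] x' by (simp add: R.m_assoc)
        then show False using sx[OF a] ann'[OF s[OF a] sb[OF a]] d by simp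
      qed
      then obtain d where d: "d \<in> carrier R" "x' = x a \<otimes> d"
        using valuation_ringD[OF vr x[OF a] x'(1)] by blast
      then have "b a = c \<oplus>\<^bsub>M\<^esub> x a \<odot>\<^bsub>M\<^esub> (d \<odot>\<^bsub>M\<^esub> p')" using x' x[OF a] by (simp add: smult_assoc1)
      then show ?thesis using d x' by blast
    qed
    then obtain p' where p': "p' \<in> carrier M" "b a = c \<oplus>\<^bsub>M\<^esub> x a \<odot>\<^bsub>M\<^esub> p'" by blast
    have cM: "c \<in> carrier M" using c C by blast
    let ?q = "p' \<oplus>\<^bsub>M\<^esub> p"
    have q: "?q \<in> carrier M" using p(1) p'(1) by simp
    have "a = c \<oplus>\<^bsub>M\<^esub> x a \<odot>\<^bsub>M\<^esub> ?q"
      using p p' cM x[OF a] by (simp add: smult_r_distr M.a_assoc)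
    moreover have "c \<oplus>\<^bsub>M\<^esub> x a \<odot>\<^bsub>M\<^esub> ?q \<oplus>\<^bsub>M\<^esub> x a \<odot>\<^bsub>M\<^esub> (\<ominus>\<^bsub>M\<^esub> ?q) = c"
      using q cM x[OF a] by (simp add: smult_r_minus M.a_assoc M.r_neg del: M.minus_add)
    ultimately have "c = a \<oplus>\<^bsub>M\<^esub> x a \<odot>\<^bsub>M\<^esub> (\<ominus>\<^bsub>M\<^esub> ?q)" by metis
    then show ?thesis using q M.a_inv_closed by blast
  qed
  \<comment> \<open>the filter generated by the tails of the chain\<close>
  define F where "F = (INF a\<in>C. principal {c\<in>C. c = a \<or> descends R M a c})"
  have ev: "eventually Pr F \<longleftrightarrow> (\<exists>a\<in>C. \<forall>c\<in>C. c = a \<or> descends R M a c \<longrightarrow> Pr c)" for Pr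
    unfolding F_def
  proof (subst eventually_INF_base)
    show "\<exists>d\<in>C. principal {c\<in>C. c = d \<or> descends R M d c} \<le>
        inf (principal {c\<in>C. c = a \<or> descends R M a c}) (principal {c\<in>C. c = a' \<or> descends R M a' c})"
      if a: "a \<in> C" "a' \<in> C" for a a'
    proof -
      have *: "principal {c\<in>C. c = e \<or> descends R M e c} \<le> principal {c\<in>C. c = d \<or> descends R M d c}"
        if "d \<in> C" "e \<in> C" "descends R M d e" for d e
        using that trans C by (auto simp: subset_iff)
      from chain[OF a] show ?thesis
      proof (elim disjE)
        assume "a = a'"
        then show ?thesis using a by auto
      next
        assume "descends R M a a'"
        then show ?thesis using *[OF a] a(2) by (intro bexI[of _ a'] le_infI order_refl) simp_all
      next
        assume "descends R M a' a"
        then show ?thesis using *[OF a(2,1)] a(1) by (intro bexI[of _ a] le_infI order_refl) simp_all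
      qed
    qed
  qed (use C in \<open>auto simp: eventually_principal\<close>)
  have "F \<noteq> bot"
  proof
    assume "F = bot"
    then have "eventually (\<lambda>_. False) F" by simp
    then show False unfolding ev by blast
  qed
  \<comment> \<open>along \<open>F\<close> this is the identity, so its limit is a limit of the chain itself\<close>
  define w where "w c = (if c \<in> carrier M then c else \<zero>\<^bsub>M\<^esub>)" for c
  have "\<exists>z\<in>carrier M. \<forall>(r, m)\<in>(\<lambda>a. (x a, a)) ` C. \<exists>p\<in>carrier M. z = m \<oplus>\<^bsub>M\<^esub> r \<odot>\<^bsub>M\<^esub> p"
  proof (rule pure_injective_filter_limit[OF \<iota> pinj \<open>F \<noteq> bot\<close>])
    show "w c \<in> carrier M" for c by (simp add: w_def)
    show "(\<lambda>a. (x a, a)) ` C \<subseteq> carrier R \<times> carrier M" using x C by auto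
    show "\<forall>\<^sub>F c in F. \<exists>p\<in>carrier M. w c = m \<oplus>\<^bsub>M\<^esub> r \<odot>\<^bsub>M\<^esub> p" if "(r, m) \<in> (\<lambda>a. (x a, a)) ` C" for r m
    proof -
      have m: "m \<in> C" "r = x m" using that by auto
      have "\<exists>p\<in>carrier M. w c = m \<oplus>\<^bsub>M\<^esub> r \<odot>\<^bsub>M\<^esub> p" if "c \<in> C" "c = b m \<or> descends R M (b m) c" for c
        using tail[OF m(1) that] m(2) that(1) C by (auto simp: w_def subset_iff)
      then show ?thesis unfolding ev using b[OF m(1)] by blast
    qed
  qed
  then obtain z where z: "z \<in> carrier M"
    and za: "\<And>a. a \<in> C \<Longrightarrow> \<exists>p\<in>carrier M. z = a \<oplus>\<^bsub>M\<^esub> x a \<odot>\<^bsub>M\<^esub> p" by auto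
  have "descends R M a z" if a: "a \<in> C" for a
  proof -
    have aM: "a \<in> carrier M" using a C by blast
    obtain p where p: "p \<in> carrier M" "z = a \<oplus>\<^bsub>M\<^esub> x a \<odot>\<^bsub>M\<^esub> p" using za[OF a] by blast
    have "a = z \<oplus>\<^bsub>M\<^esub> x a \<odot>\<^bsub>M\<^esub> (\<ominus>\<^bsub>M\<^esub> p)"
      unfolding p(2) using p(1) aM x[OF a] by (simp add: smult_r_minus M.a_assoc M.r_neg)
    moreover have "s a \<odot>\<^bsub>M\<^esub> z = \<zero>\<^bsub>M\<^esub>"
    proof -
      obtain p' where p': "p' \<in> carrier M" "z = b a \<oplus>\<^bsub>M\<^esub> x (b a) \<odot>\<^bsub>M\<^esub> p'" using za[OF b[OF a]] by blast
      have "b a \<in> carrier M" using b[OF a] C by blast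
      moreover have "s a \<odot>\<^bsub>M\<^esub> (x (b a) \<odot>\<^bsub>M\<^esub> p') = (s a \<otimes> x (b a)) \<odot>\<^bsub>M\<^esub> p'"
        using s[OF a] x[OF b[OF a]] p' by (simp add: smult_assoc1)
      moreover have "s a \<otimes> x (b a) = \<zero>" by (rule ann[OF b[OF a] s[OF a] sb[OF a]])
      ultimately show ?thesis
        unfolding p'(2) using s[OF a] x[OF b[OF a]] p'(1) sb[OF a] by (simp add: smult_r_distr)
    qed
    moreover have "\<ominus>\<^bsub>M\<^esub> p \<in> carrier M" using p by simp
    ultimately show ?thesis unfolding descends_def using x[OF a] s[OF a] sx[OF a] ann[OF a] by blast
  qed
  then show ?thesis using z by blast
qed

text \<open>
  By Zorn's lemma a descent starting at \<open>m\<close> can be continued up to an element that does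
  not descend any further, and only \<open>0\<close> has this property.
\<close>

lemma torsion_flat_by_descent:
  fixes R (structure) and M :: "('a, 'm) module" and \<iota> :: "('m \<Rightarrow> 'm) set \<Rightarrow> 'u"
  assumes vr: "valuation_ring R" and \<iota>: "inj \<iota>" and pinj: "pure_injective TYPE('u) R M"
    and step: "\<And>m. m \<in> carrier M \<Longrightarrow> m \<noteq> \<zero>\<^bsub>M\<^esub> \<Longrightarrow> \<exists>w\<in>carrier M. descends R M m w"
  shows "torsion_flat R M"
  unfolding torsion_flat_def
proof
  have mod: "module R M" using pinj by (simp add: pure_injective_def)
  interpret module R M by fact
  note trans = descends_trans[OF vr mod]
  fix m assume m: "m \<in> carrier M"
  define A where "A = {w \<in> carrier M. w = m \<or> descends R M m w}"
  let ?P = "\<lambda>a b. a = b \<or> descends R M a b"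
  have "\<exists>z\<in>A. \<forall>a\<in>A. ?P z a \<longrightarrow> a = z"
  proof (rule predicate_Zorn)
    show "partial_order_on A (relation_of ?P A)"
      unfolding partial_order_on_def preorder_on_def
    proof (intro conjI)
      show "refl_on A (relation_of ?P A)" by (auto simp: refl_on_def relation_of_def)
      show "relation_of ?P A \<subseteq> A \<times> A" by (auto simp: relation_of_def)
      show "Relation.trans (relation_of ?P A)"
        using trans by (intro transI) (auto simp: relation_of_def A_def)
      show "antisym (relation_of ?P A)"
      proof (rule antisymI)
        fix a b assume "(a, b) \<in> relation_of ?P A" "(b, a) \<in> relation_of ?P A"
        then have ab: "a \<in> carrier M" "b \<in> carrier M" "?P a b" "?P b a"
          by (auto simp: relation_of_def A_def)
        show "a = b"
        proof (rule ccontr)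
          assume "a \<noteq> b"
          then have "descends R M a b" "descends R M b a" using ab by auto
          from trans[OF ab(1,2,1) this] show False by (simp add: descends_irrefl)
        qed
      qed
    qed
    fix C assume "C \<in> Chains (relation_of ?P A)"
    then have C: "C \<subseteq> A" and ch: "\<And>a b. a \<in> C \<Longrightarrow> b \<in> C \<Longrightarrow> ?P a b \<or> ?P b a"
      by (auto simp: Chains_def relation_of_def)
    show "\<exists>u\<in>A. \<forall>a\<in>C. ?P a u"
    proof (cases "C = {}")
      case True
      then show ?thesis using m by (auto simp: A_def)
    next
      case False
      show ?thesis
      proof (cases "\<exists>a\<in>C. \<forall>b\<in>C. \<not> descends R M a b")
        case True
        then show ?thesis using C ch by blast
      next
        case no_max: False
        have CM: "C \<subseteq> carrier M" using C by (auto simp: A_def)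
        have "\<exists>z\<in>carrier M. \<forall>a\<in>C. descends R M a z"
          using ch no_max by (intro descends_chain_bound[OF vr \<iota> pinj CM False]) blast+
        then obtain z where z: "z \<in> carrier M" "\<And>a. a \<in> C \<Longrightarrow> descends R M a z" by blast
        obtain a where a: "a \<in> C" using False by blast
        then have "a \<in> carrier M" "a = m \<or> descends R M m a" using C by (auto simp: A_def)
        then have "descends R M m z" using z(2)[OF a] trans[OF m _ z(1)] by blast
        then have "z \<in> A" using z by (simp add: A_def)
        then show ?thesis using z by blast
      qed
    qed
  qed
  then obtain z where z: "z \<in> A" "\<And>a. a \<in> A \<Longrightarrow> ?P z a \<Longrightarrow> a = z" by blast
  have zM: "z \<in> carrier M" using z by (simp add: A_def)
  have "z = \<zero>\<^bsub>M\<^esub>"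
  proof (rule ccontr)
    assume "z \<noteq> \<zero>\<^bsub>M\<^esub>"
    then obtain w where w: "w \<in> carrier M" "descends R M z w" using step[OF zM] by blast
    then have "w \<in> A" using z(1) trans[OF m zM w(1)] by (auto simp: A_def)
    then show False using z(2)[of w] w(2) by (auto simp: descends_irrefl)
  qed
  then have "m = \<zero>\<^bsub>M\<^esub> \<or> descends R M m \<zero>\<^bsub>M\<^esub>" using z(1) by (auto simp: A_def)
  then show "\<exists>x\<in>carrier R. \<exists>p\<in>carrier M. m = x \<odot>\<^bsub>M\<^esub> p \<and>
      (\<forall>a\<in>carrier R. a \<odot>\<^bsub>M\<^esub> m = \<zero>\<^bsub>M\<^esub> \<longrightarrow> a \<otimes> x = \<zero>)"
  proof
    assume "m = \<zero>\<^bsub>M\<^esub>"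
    then show ?thesis by (intro bexI[of _ "\<zero>"] bexI[of _ "\<zero>\<^bsub>M\<^esub>"]) auto
  next
    assume "descends R M m \<zero>\<^bsub>M\<^esub>"
    then obtain x p where xp: "x \<in> carrier R" "p \<in> carrier M" "m = \<zero>\<^bsub>M\<^esub> \<oplus>\<^bsub>M\<^esub> x \<odot>\<^bsub>M\<^esub> p"
      "\<forall>a\<in>carrier R. a \<odot>\<^bsub>M\<^esub> m = \<zero>\<^bsub>M\<^esub> \<longrightarrow> a \<otimes> x = \<zero>"
      unfolding descends_def by blast
    then have "m = x \<odot>\<^bsub>M\<^esub> p" by simp
    then show ?thesis using xp by blast
  qed
qed

text \<open>
  A function is encoded by its graph, a set of pairs; pairs over an infinite type embed into that
  type.
\<close>

lemma inj_function_sets: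
  fixes j :: "'b \<Rightarrow> 'x" and k :: "'x set set \<Rightarrow> 'u"
  assumes "infinite (UNIV :: 'x set)" "inj j" "inj k"
  shows "\<exists>\<iota> :: ('b \<Rightarrow> 'b) set \<Rightarrow> 'u. inj \<iota>"
proof -
  have "|(UNIV :: 'x set) \<times> (UNIV :: 'x set)| =o |UNIV :: 'x set|"
    by (rule card_of_Times_same_infinite) fact
  then obtain h where "bij_betw h ((UNIV :: 'x set) \<times> (UNIV :: 'x set)) (UNIV :: 'x set)"
    using card_of_ordIso by blast
  then have h: "inj h" by (simp add: bij_betw_def)
  define graph where "graph f = (\<lambda>x. h (j x, j (f x))) ` UNIV" for f :: "'b \<Rightarrow> 'b"
  have "inj graph"
  proof (rule injI, rule ext)
    fix f g x assume "graph f = graph g"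
    then have "h (j x, j (f x)) \<in> graph g" by (auto simp: graph_def)
    then show "f x = g x" using h assms(2) by (auto simp: graph_def inj_eq)
  qed
  then have "inj (\<lambda>A. k (graph ` A))"
    using assms(3) by (intro injI) (simp add: inj_eq inj_image_eq_iff)
  then show ?thesis by blast
qed

theorem proposition1p2:
  fixes R :: "'a ring"
    and Rhat :: "('a, 'b) module"
    and i :: "'a \<Rightarrow> 'b"
    and universe_emb :: "('a, 'b) test_universe \<Rightarrow> 'u"
  assumes "inj universe_emb"
    and "valuation_ring R"
    and "pure_injective_hull TYPE('u) R (regular_module R) Rhat i"
  shows "faithfully_flat TYPE('v) R Rhat"
proof -
  note vr = assms(2)
  have i: "i \<in> mod_hom R (regular_module R) Rhat" "inj_on i (carrier R)"
    and pinj: "pure_injective TYPE('u) R Rhat"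
    and pe0: "pure_essential TYPE('u) R (i ` carrier R) Rhat"
    using assms(3) by (simp_all add: pure_injective_hull_def)
  have mod: "module R Rhat" using pinj by (simp add: pure_injective_def)
  interpret module R Rhat by fact
  have modR: "module R (regular_module R)" by (rule module_regular_module) (rule R.cring_axioms)
  define u where "u = i \<one>\<^bsub>R\<^esub>"
  have u: "u \<in> carrier Rhat" using mod_homD(1)[OF i(1), of "\<one>\<^bsub>R\<^esub>"] by (simp add: u_def)
  have iu: "i r = r \<odot>\<^bsub>Rhat\<^esub> u" if "r \<in> carrier R" for r
    using mod_homD(3)[OF i(1) that, of "\<one>\<^bsub>R\<^esub>"] that by (simp add: u_def)
  have "i ` carrier R = (\<lambda>r. r \<odot>\<^bsub>Rhat\<^esub> u) ` carrier R" by (rule image_cong) (simp_all add: iu)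
  then have pe: "pure_essential TYPE('u) R ((\<lambda>r. r \<odot>\<^bsub>Rhat\<^esub> u) ` carrier R) Rhat" using pe0 by simp
  have u_inj: "r = s" if "r \<in> carrier R" "s \<in> carrier R" "r \<odot>\<^bsub>Rhat\<^esub> u = s \<odot>\<^bsub>Rhat\<^esub> u" for r s
    using inj_onD[OF i(2)] that iu by simp
  have tfree: "r = \<zero>\<^bsub>R\<^esub>" if "r \<in> carrier R" "r \<odot>\<^bsub>Rhat\<^esub> u = \<zero>\<^bsub>Rhat\<^esub>" for r
    using u_inj[OF that(1) R.zero_closed] that u by simp
  have "inj (\<lambda>x :: 'a. {Inr (Inl x)} :: (nat + 'a + 'b) set)" by (intro injI) simp
  then have "inj (\<lambda>A. universe_emb ((\<lambda>x. {Inr (Inl x)}) ` A))"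
    using assms(1) by (intro injI) (simp add: inj_eq inj_image_eq_iff)
  from pure_submodule_rd_pure[OF this mod]
  have rd: "rd_pure R ((\<lambda>r. r \<odot>\<^bsub>Rhat\<^esub> u) ` carrier R) Rhat"
    using pe by (simp add: pure_essential_def)
  have div: "\<exists>q\<in>carrier R. r = t \<otimes>\<^bsub>R\<^esub> q"
    if t: "t \<in> carrier R" and r: "r \<in> carrier R" and y: "y \<in> carrier Rhat" and eq: "t \<odot>\<^bsub>Rhat\<^esub> y = r \<odot>\<^bsub>Rhat\<^esub> u"
    for t r y
  proof -
    have "t \<odot>\<^bsub>Rhat\<^esub> y \<in> (\<lambda>r. r \<odot>\<^bsub>Rhat\<^esub> u) ` carrier R" using eq r by simp
    then obtain q where q: "q \<in> carrier R" "t \<odot>\<^bsub>Rhat\<^esub> (q \<odot>\<^bsub>Rhat\<^esub> u) = r \<odot>\<^bsub>Rhat\<^esub> u"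
      using rd t y eq unfolding rd_pure_def by fastforce
    then have "r = t \<otimes>\<^bsub>R\<^esub> q" using t r u by (intro u_inj) (auto simp: smult_assoc1)
    then show ?thesis using q by blast
  qed
  have step: "\<exists>w\<in>carrier Rhat. descends R Rhat m w"
    if m: "m \<in> carrier Rhat" "m \<noteq> \<zero>\<^bsub>Rhat\<^esub>" for m
  proof -
    obtain t r s y where *: "t \<in> carrier R" "r \<in> carrier R" "s \<in> carrier R" "y \<in> carrier Rhat"
      "t \<odot>\<^bsub>Rhat\<^esub> y = r \<odot>\<^bsub>Rhat\<^esub> u \<oplus>\<^bsub>Rhat\<^esub> s \<odot>\<^bsub>Rhat\<^esub> m"
      "\<forall>q\<in>carrier R. r \<odot>\<^bsub>Rhat\<^esub> u \<noteq> (t \<otimes>\<^bsub>R\<^esub> q) \<odot>\<^bsub>Rhat\<^esub> u"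
      using pure_essential_nonzero_element[OF vr mod u pe m] by blast
    show ?thesis
      by (rule descends_step[OF vr mod u div m(1) *(1-5)]) (use *(6) in auto)
  qed
  have "infinite (UNIV :: (nat + 'a + 'b) set)" by (simp add: finite_Plus_UNIV_iff)
  moreover have "inj (\<lambda>y :: 'b. Inr (Inr y) :: nat + 'a + 'b)" by (auto simp: inj_def)
  ultimately obtain \<iota> :: "('b \<Rightarrow> 'b) set \<Rightarrow> 'u" where "inj \<iota>"
    using inj_function_sets assms(1) by blast
  then have "torsion_flat R Rhat" by (rule torsion_flat_by_descent[OF vr _ pinj step])
  then show ?thesis by (rule faithfully_flatI[OF vr mod _ u tfree rd])
qed

end
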